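(* Assume that the linear homogeneous system $\dot x=L(t)x$ is exponentially stable and that the skew-product flow $(\sigma,\varphi)$ on $\Omega_L\times\mathbb{R}^d\times\mathbb{S}^{d-1}$ induced by the boundary system $$\begin{cases}\dot x=L(t)x+\rho\,n,\\ \dot n=-L(t)^\top n+\langle n,L(t)^\top n\rangle\,n\end{cases}$$ is continuous. Then: (i) For every $\omega\in\Omega_L$ there exists a uniform attractor $\mathcal{A}^\omega=(A^\omega_t)_{t\in\mathbb{R}}$ for the family $\dot x=\omega(t)x+\rho\,\xi(t)$, $\xi\in\mathcal{U}$. (ii) There exists a bounded set $B\subset\mathbb{R}^d$ such that $\bigcup_{\omega\in\Omega_L,\,t\in\mathbb{R}}A^\omega_t\subset B$. (iii) Let $A_\omega=A^\omega_0$ for $\omega\in\Omega_L$. The family of outward unit normal bundles $(N_1^+\partial A_\omega)_{\omega\in\Omega_L}$ is the unique pullback attractor for the skew-product flow $(\sigma,\varphi)$, and for every $\omega\in\Omega_L$, with $B$ as in (ii), $$N_1^+\partial A_\omega=\bigcap_{t\ge0}\ \overline{\bigcup_{\tau\ge t}\varphi(\tau,\omega_{-\tau},B\times\mathbb{S}^{d-1})}.$$ (iv) If $\Omega_L$ is compact, there is a global attractor of the skew-product flow $(\sigma,\varphi)$, given by $$\mathbb{A}=\bigcap_{t\ge0}\ \overline{\bigcup_{\tau\ge t}(\sigma,\varphi)(\tau,\Omega_L\times B\times\mathbb{S}^{d-1})}=\bigcup_{\omega\in\Omega_L}\{\omega\}\times N_1^+\partial A_\omega .$$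
   Context: Let $d\ge2$, $\rho>0$, $L:\mathbb{R}\to\mathbb{R}^{d\times d}$ locally integrable, $\mathcal{U}=\{\xi\in L^\infty(\mathbb{R},\mathbb{R}^d):\|\xi\|_\infty\le1\}$. $\Psi(t,s)$ is the principal matrix solution of $\dot x=L(t)x$ at $s$. Exponential stability: there are $K\ge1$, $\gamma>0$ with $\|\Psi(t,s)\|\le Ke^{-\gamma(t-s)}$ for all $t\ge s$. Hull and skew-product flow. For a locally integrable $\omega:\mathbb{R}\to\mathbb{R}^{d\times d}$ write $\omega_\tau(t)=\omega(t+\tau)$. The hull is $\Omega_L=\mathrm{cls}\{L_\tau:\tau\in\mathbb{R}\}$, the closure being taken with respect to a fixed suitable (metrizable) topology on the space of locally integrable matrix functions. For $\omega\in\Omega_L$, $\varphi(t,\omega,x_0,n_0)=(x(t,\omega,x_0,n_0),n(t,\omega,x_0,n_0))$ is the solution on $\mathbb{R}^d\times\mathbb{S}^{d-1}$ with value $(x_0,n_0)$ at time $0$ of $$\dot x=\omega(t)x+\rho\,n,\qquad \dot n=-\omega(t)^\top n+\langle n,\omega(t)^\top n\rangle\,n .$$ The skew-product flow is $(\sigma,\varphi):\mathbb{R}^+\times\Omega_L\times\mathbb{R}^d\times\mathbb{S}^{d-1}\to\Omega_L\times\mathbb{R}^d\times\mathbb{S}^{d-1}$, $(t,\omega,x_0,n_0)\mapsto(\omega_t,\varphi(t,\omega,x_0,n_0))$; its continuity (which depends on the topology of the hull) is the stated hypothesis. Uniform attractor. For $\omega\in\Omega_L$, let $\Phi_\omega^{t,t_0}(x_0)$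 be the set of values at time $t$ of all solutions of $\dot x=\omega(t)x+\rho\xi(t)$, $x(t_0)=x_0$, $\xi\in\mathcal{U}$, and $\Phi_\omega^{t,t_0}(M)=\bigcup_{x\in M}\Phi_\omega^{t,t_0}(x)$. A uniform attractor $\mathcal{A}^\omega=(A^\omega_t)_{t\in\mathbb{R}}$ is a uniformly bounded family (all fibres in one ball) of nonempty compact sets which is invariant, $\Phi_\omega^{t,t_0}(A^\omega_{t_0})=A^\omega_t$ for $t>t_0$, is minimal (contains no proper nonempty fibre-wise closed invariant nonautonomous subset), and attracts each nonempty compact $C\subset\mathbb{R}^d$ in the pullback and forward sense: $\mathrm{dist}(\Phi_\omega^{t,t_0}(C),A^\omega_t)\to0$ as $t_0\to-\infty$ for each $t$, and as $t\to\infty$ for each $t_0$. Here $\mathrm{dist}(C,D)=\sup_{x\in C}\inf_{y\in D}d(x,y)$ is the Hausdorff semi-distance, in the respective metric space. Outward unit normal bundle. For compact $M\subset\mathbb{R}^d$ with $C^1$ boundary, $N_1^+\partial M=\{(p,v)\in\partial M\times\mathbb{S}^{d-1}: v\perp T_p\partial M,\ v\text{ outward-pointing}\}$, where $v$ is outward-pointing at $p$ if $p+\varepsilon v\notin M$ for all sufficiently small $\varepsilon>0$. (For a general compact $M$ whose boundary is a possibly non-differentiable manifold, $N_1^+\partial M$ is defined through the Mordukhovich outward unit normal cone at $p\in\partial M$: all limits $v$ of outward-pointing $v_k\in\mathbb{S}^{d-1}$ at $p_k\to p$, $p_k\in\partial M$, with $\limsup_{y\to p_k,\,y\in\partial M}\langle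 v_k,y-p_k\rangle/|y-p_k|\le0$; when $\partial M$ is $C^1$, this cone consists exactly of the outward-pointing unit vectors $v\perp T_p\partial M$. The fibres $A_\omega$ have $C^1$ boundary.) Attractors of the skew-product flow. A pullback attractor is a family $\{P_\omega:\omega\in\Omega_L\}$ of nonempty compact subsets of $\mathbb{R}^d\times\mathbb{S}^{d-1}$ with $\varphi(t,\omega,P_\omega)=P_{\omega_t}$ for all $t\ge0$, $\omega\in\Omega_L$, and $\lim_{t\to\infty}\mathrm{dist}(\varphi(t,\omega_{-t},D),P_\omega)=0$ for every nonempty bounded $D\subset\mathbb{R}^d\times\mathbb{S}^{d-1}$ and $\omega\in\Omega_L$. A global attractor is a compact set $\mathbb{A}\subset\Omega_L\times\mathbb{R}^d\times\mathbb{S}^{d-1}$ which is the maximal nonempty compact invariant set ($(\sigma,\varphi)(t,\mathbb{A})=\mathbb{A}$ for all $t\ge0$) and satisfies $\lim_{t\to\infty}\mathrm{dist}((\sigma,\varphi)(t,\mathcal{D}),\mathbb{A})=0$ for every compact $\mathcal{D}\subset\Omega_L\times\mathbb{R}^d\times\mathbb{S}^{d-1}$.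
   Formalization: Literal uniqueness in (iii) fails for non-periodic L; instead the bundle family is the smallest pullback attractor and the only one with fibres bounded along each backward orbit. Invariance of the hull under all translations, implicit in the context, is an explicit hypothesis. *)

theory Defs
  imports "HOL-Analysis.Analysis"
begin

section \<open>Locally integrable matrix functions\<close>

definition locally_integrable :: "(real \<Rightarrow> 'a::euclidean_space) \<Rightarrow> bool" where
  "locally_integrable f \<longleftrightarrow> (\<forall>a b. f absolutely_integrable_on {a..b})"

definition loc_int_eq :: "(real \<Rightarrow> 'a::euclidean_space) \<Rightarrow> (real \<Rightarrow> 'a) \<Rightarrow> bool" where
  "loc_int_eq f g \<longleftrightarrow>
     locally_integrable f \<and> locally_integrable g \<and> (AE t in lebesgue. f t = g t)"

lemma part_equivp_loc_int_eq: "part_equivp loc_int_eq"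
proof (rule part_equivpI)
  show "\<exists>f. loc_int_eq f f"
    by (rule exI[of _ "\<lambda>_. 0"]) (simp add: loc_int_eq_def locally_integrable_def)
  show "symp loc_int_eq"
    by (auto simp: symp_def loc_int_eq_def eq_commute)
  show "transp loc_int_eq"
    unfolding transp_def loc_int_eq_def by (auto elim: eventually_elim2)
qed

text \<open>
  Functions that agree almost everywhere are identified: otherwise the usual topologies on the
  space of locally integrable functions would not be metrizable.
\<close>

quotient_type 'n mat_fun = "real \<Rightarrow> real ^ 'n::finite ^ 'n" / partial: loc_int_eq
  by (rule part_equivp_loc_int_eq)

lemma locally_integrable_translate:
  assumes "locally_integrable f"
  shows "locally_integrable (\<lambda>t. f (t + c))"
proof -
  have "f absolutely_integrable_on {a + c..b + c}" for a b
    using assms by (simp add: locally_integrable_def)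
  then have "(\<lambda>t. f (t + c)) absolutely_integrable_on {a..b}" for a b
    unfolding absolutely_integrable_on_def
    using integrable_on_shift_Icc_real[of f c a b]
      integrable_on_shift_Icc_real[of "\<lambda>t. norm (f t)" c a b]
    by (simp add: o_def add.commute)
  then show ?thesis by (simp add: locally_integrable_def)
qed

lemma AE_lebesgue_translate:
  assumes "AE t in lebesgue. P (t::real)"
  shows "AE t in lebesgue. P (t + c)"
proof -
  have "negligible {t. \<not> P t}"
    using assms by (simp add: completion.AE_iff_null_sets negligible_iff_null_sets)
  then have "negligible ((+) (- c) ` {t. \<not> P t})"
    by (rule negligible_translation)
  moreover have "(+) (- c) ` {t. \<not> P t} = {t. \<not> P (t + c)}"
    by (force simp: image_iff)
  ultimately show ?thesis
    by (simp add: completion.AE_iff_null_sets negligible_iff_null_sets)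
qed

lemma loc_int_eq_translate:
  "loc_int_eq f g \<Longrightarrow> loc_int_eq (\<lambda>t. f (t + c)) (\<lambda>t. g (t + c))"
  using AE_lebesgue_translate[of "\<lambda>t. f t = g t" c]
  by (simp add: loc_int_eq_def locally_integrable_translate)

lift_definition translate :: "real \<Rightarrow> 'n::finite mat_fun \<Rightarrow> 'n mat_fun"
  is "\<lambda>\<tau> f t. f (t + \<tau>)"
  by (rule loc_int_eq_translate)

text \<open>
  The space of matrix functions carries an arbitrary metric \<open>\<delta>\<close>, which
  stands for the fixed metrizable topology.
\<close>

definition translation_hull ::
  "('n::finite mat_fun \<Rightarrow> 'n mat_fun \<Rightarrow> real) \<Rightarrow> (real \<Rightarrow> real ^ 'n ^ 'n) \<Rightarrow> 'n mat_fun set"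
  where "translation_hull \<delta> L =
    Metric_space.mtopology UNIV \<delta> closure_of (range (\<lambda>\<tau>. translate \<tau> (abs_mat_fun L)))"


section \<open>Caratheodory solutions\<close>

text \<open>
  The integral equation is the usual reformulation of ``locally absolutely continuous, and
  satisfying the differential equation almost everywhere''.
\<close>

definition ode_solution :: "(real \<Rightarrow> 'a::euclidean_space \<Rightarrow> 'a) \<Rightarrow> (real \<Rightarrow> 'a) \<Rightarrow> bool" where
  "ode_solution f u \<longleftrightarrow>
     (\<forall>s t. s \<le> t \<longrightarrow>
        (\<lambda>r. f r (u r)) absolutely_integrable_on {s..t} \<and>
        u t - u s = integral {s..t} (\<lambda>r. f r (u r)))"

definition principal_matrix :: "(real \<Rightarrow> real ^ 'n ^ 'n) \<Rightarrow> real \<Rightarrow> real \<Rightarrow> real ^ 'n ^ 'n" where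
  "principal_matrix L t s =
     (THE X. ode_solution (\<lambda>r Y. L r ** Y) X \<and> X s = mat 1) t"

definition exponentially_stable :: "(real \<Rightarrow> real ^ 'n ^ 'n) \<Rightarrow> bool" where
  "exponentially_stable L \<longleftrightarrow>
     (\<exists>K\<ge>1. \<exists>\<gamma>>0. \<forall>s t. s \<le> t \<longrightarrow>
        onorm ((*v) (principal_matrix L t s)) \<le> K * exp (- \<gamma> * (t - s)))"


section \<open>The skew-product flow of the boundary system\<close>

text \<open>
  Below, \<open>rep_mat_fun \<omega>\<close> is some representative of the class \<open>\<omega>\<close>; solutions do not depend on
  its choice, since they are defined through integrals.
\<close>

definition boundary_field ::
  "real \<Rightarrow> 'n::finite mat_fun \<Rightarrow> real \<Rightarrow> (real ^ 'n) \<times> (real ^ 'n) \<Rightarrow> (real ^ 'n) \<times> (real ^ 'n)"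
  where "boundary_field \<rho> \<omega> t = (\<lambda>(x, n).
    let W = rep_mat_fun \<omega> t in
      (W *v x + \<rho> *\<^sub>R n, - (transpose W *v n) + (n \<bullet> (transpose W *v n)) *\<^sub>R n))"

definition \<phi> ::
  "real \<Rightarrow> real \<Rightarrow> 'n::finite mat_fun \<Rightarrow> (real ^ 'n) \<times> (real ^ 'n) \<Rightarrow> (real ^ 'n) \<times> (real ^ 'n)"
  where "\<phi> \<rho> t \<omega> p =
    (THE u. ode_solution (boundary_field \<rho> \<omega>) u \<and> (\<forall>s. u s \<in> UNIV \<times> sphere 0 1) \<and> u 0 = p) t"

definition skew_product ::
  "real \<Rightarrow> real \<Rightarrow> 'n::finite mat_fun \<times> ((real ^ 'n) \<times> (real ^ 'n))
     \<Rightarrow> 'n mat_fun \<times> ((real ^ 'n) \<times> (real ^ 'n))"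
  where "skew_product \<rho> t = (\<lambda>(\<omega>, p). (translate t \<omega>, \<phi> \<rho> t \<omega> p))"

definition state_space ::
  "('n::finite mat_fun \<Rightarrow> 'n mat_fun \<Rightarrow> real) \<Rightarrow> 'n mat_fun set
     \<Rightarrow> ('n mat_fun \<times> ((real ^ 'n) \<times> (real ^ 'n))) topology"
  where "state_space \<delta> \<Omega> =
    prod_topology (subtopology (Metric_space.mtopology UNIV \<delta>) \<Omega>)
      (top_of_set (UNIV \<times> sphere 0 1))"

text \<open>
  Continuity on \<open>[0, \<infinity>) \<times> \<Omega> \<times> \<real>\<^sup>d \<times> S\<^sup>d\<^sup>-\<^sup>1\<close>; \<^const>\<open>continuous_map\<close>
  includes that the flow maps into \<open>\<Omega> \<times> \<real>\<^sup>d \<times> S\<^sup>d\<^sup>-\<^sup>1\<close>.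
\<close>

definition continuous_skew_product ::
  "real \<Rightarrow> ('n::finite mat_fun \<Rightarrow> 'n mat_fun \<Rightarrow> real) \<Rightarrow> 'n mat_fun set \<Rightarrow> bool"
  where "continuous_skew_product \<rho> \<delta> \<Omega> \<longleftrightarrow>
    continuous_map (prod_topology (top_of_set {0..}) (state_space \<delta> \<Omega>)) (state_space \<delta> \<Omega>)
      (\<lambda>(t, z). skew_product \<rho> t z)"


section \<open>Hausdorff semi-distance\<close>

text \<open>Extended-valued, so that the supremum over an unbounded set is infinite.\<close>

definition semidist :: "('a \<Rightarrow> 'a \<Rightarrow> real) \<Rightarrow> 'a set \<Rightarrow> 'a set \<Rightarrow> ennreal" where
  "semidist d C D = (SUP x\<in>C. INF y\<in>D. ennreal (d x y))"


section \<open>Uniform attractors of the controlled system\<close>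

definition controls :: "(real \<Rightarrow> real ^ 'n) set" where
  "controls = {\<xi> \<in> borel_measurable lebesgue. AE t in lebesgue. norm (\<xi> t) \<le> 1}"

definition reach ::
  "real \<Rightarrow> 'n::finite mat_fun \<Rightarrow> real \<Rightarrow> real \<Rightarrow> (real ^ 'n) set \<Rightarrow> (real ^ 'n) set" where
  "reach \<rho> \<omega> t t\<^sub>0 M =
     (\<Union>x\<^sub>0\<in>M. {x t | x \<xi>. \<xi> \<in> controls \<and>
        ode_solution (\<lambda>s y. rep_mat_fun \<omega> s *v y + \<rho> *\<^sub>R \<xi> s) x \<and> x t\<^sub>0 = x\<^sub>0})"

definition invariant_family ::
  "real \<Rightarrow> 'n::finite mat_fun \<Rightarrow> (real \<Rightarrow> (real ^ 'n) set) \<Rightarrow> bool" where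
  "invariant_family \<rho> \<omega> A \<longleftrightarrow> (\<forall>t\<^sub>0 t. t\<^sub>0 < t \<longrightarrow> reach \<rho> \<omega> t t\<^sub>0 (A t\<^sub>0) = A t)"

definition uniform_attractor ::
  "real \<Rightarrow> 'n::finite mat_fun \<Rightarrow> (real \<Rightarrow> (real ^ 'n) set) \<Rightarrow> bool" where
  "uniform_attractor \<rho> \<omega> A \<longleftrightarrow>
     (\<exists>r. \<forall>t. A t \<subseteq> cball 0 r) \<and>
     (\<forall>t. A t \<noteq> {} \<and> compact (A t)) \<and>
     invariant_family \<rho> \<omega> A \<and>
     (\<forall>C. (\<forall>t. closed (C t) \<and> C t \<subseteq> A t) \<and> (\<exists>t. C t \<noteq> {}) \<and> invariant_family \<rho> \<omega> C
        \<longrightarrow> C = A) \<and>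
     (\<forall>C. C \<noteq> {} \<and> compact C \<longrightarrow>
        (\<forall>t. ((\<lambda>t\<^sub>0. semidist dist (reach \<rho> \<omega> t t\<^sub>0 C) (A t)) \<longlongrightarrow> 0) at_bot) \<and>
        (\<forall>t\<^sub>0. ((\<lambda>t. semidist dist (reach \<rho> \<omega> t t\<^sub>0 C) (A t)) \<longlongrightarrow> 0) at_top))"


section \<open>Outward unit normal bundle\<close>

definition outward_pointing :: "'a::euclidean_space set \<Rightarrow> 'a \<Rightarrow> 'a \<Rightarrow> bool" where
  "outward_pointing M p v \<longleftrightarrow> (\<forall>\<^sub>F \<epsilon> in at_right 0. p + \<epsilon> *\<^sub>R v \<notin> M)"

definition outward_regular_normal :: "'a::euclidean_space set \<Rightarrow> 'a \<Rightarrow> 'a \<Rightarrow> bool" where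
  "outward_regular_normal M p v \<longleftrightarrow>
     norm v = 1 \<and> outward_pointing M p v \<and>
     Limsup (at p within frontier M) (\<lambda>y. ereal (v \<bullet> (y - p) / norm (y - p))) \<le> 0"

text \<open>
  The bundle of Mordukhovich outward unit normal cones, which makes sense for every compact set.
  Where the boundary is of class \<open>C\<^sup>1\<close>, the cone at \<open>p\<close> consists of the outward-pointing unit
  vectors that are orthogonal to the tangent space at \<open>p\<close>.
\<close>

definition normal_bundle :: "'a::euclidean_space set \<Rightarrow> ('a \<times> 'a) set" where
  "normal_bundle M =
     {(p, v). p \<in> frontier M \<and>
        (\<exists>ps vs. (\<forall>k. ps k \<in> frontier M \<and> outward_regular_normal M (ps k) (vs k)) \<and>
           ps \<longlonglongrightarrow> p \<and> vs \<longlonglongrightarrow> v)}"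


section \<open>Attractors of the skew-product flow\<close>

definition pullback_attractor ::
  "real \<Rightarrow> 'n::finite mat_fun set \<Rightarrow> ('n mat_fun \<Rightarrow> ((real ^ 'n) \<times> (real ^ 'n)) set) \<Rightarrow> bool"
  where "pullback_attractor \<rho> \<Omega> P \<longleftrightarrow>
    (\<forall>\<omega>\<in>\<Omega>. P \<omega> \<noteq> {} \<and> compact (P \<omega>) \<and> P \<omega> \<subseteq> UNIV \<times> sphere 0 1 \<and>
       (\<forall>t\<ge>0. \<phi> \<rho> t \<omega> ` P \<omega> = P (translate t \<omega>)) \<and>
       (\<forall>D. D \<noteq> {} \<and> bounded D \<and> D \<subseteq> UNIV \<times> sphere 0 1 \<longrightarrow>
          ((\<lambda>t. semidist dist (\<phi> \<rho> t (translate (- t) \<omega>) ` D) (P \<omega>)) \<longlongrightarrow> 0) at_top))"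

definition backward_bounded ::
  "'n::finite mat_fun set \<Rightarrow> ('n mat_fun \<Rightarrow> ((real ^ 'n) \<times> (real ^ 'n)) set) \<Rightarrow> bool"
  where "backward_bounded \<Omega> P \<longleftrightarrow> (\<forall>\<omega>\<in>\<Omega>. bounded (\<Union>t\<in>{0..}. P (translate (- t) \<omega>)))"

text \<open>
  Uniqueness of a pullback attractor \<open>N\<close>. Invariance and attraction alone do not determine the
  family: for \<open>L(t) = (exp(-t\<^sup>2) - 2) I\<close> with a metric for
  \<open>L\<^sup>1\<close>-convergence on compact intervals, adding to the fibre over each translate \<open>L\<^sub>\<tau>\<close> its
  image under the shift of the \<open>x\<close>-component by \<open>\<Psi>(\<tau>, 0) v\<close> gives another pullback attractor
  for every \<open>v \<noteq> 0\<close>, with fibres that grow without bound as \<open>\<tau> \<rightarrow> -\<infinity>\<close>.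
  Hence \<open>N\<close> is required to be the smallest pullback attractor, and the only one whose fibres
  stay bounded in backward time.
\<close>

definition unique_pullback_attractor ::
  "real \<Rightarrow> 'n::finite mat_fun set \<Rightarrow> ('n mat_fun \<Rightarrow> ((real ^ 'n) \<times> (real ^ 'n)) set) \<Rightarrow> bool"
  where "unique_pullback_attractor \<rho> \<Omega> N \<longleftrightarrow>
    pullback_attractor \<rho> \<Omega> N \<and> backward_bounded \<Omega> N \<and>
    (\<forall>P. pullback_attractor \<rho> \<Omega> P \<longrightarrow>
       (\<forall>\<omega>\<in>\<Omega>. N \<omega> \<subseteq> P \<omega>) \<and> (backward_bounded \<Omega> P \<longrightarrow> (\<forall>\<omega>\<in>\<Omega>. P \<omega> = N \<omega>)))"

text \<open>
  The set \<open>\<Omega> \<times> \<real>\<^sup>d \<times> S\<^sup>d\<^sup>-\<^sup>1\<close> carries the product metric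
  \<^term>\<open>prod_dist \<delta> dist\<close>.
\<close>

definition global_attractor ::
  "real \<Rightarrow> ('n::finite mat_fun \<Rightarrow> 'n mat_fun \<Rightarrow> real) \<Rightarrow> 'n mat_fun set
     \<Rightarrow> ('n mat_fun \<times> ((real ^ 'n) \<times> (real ^ 'n))) set \<Rightarrow> bool"
  where "global_attractor \<rho> \<delta> \<Omega> A \<longleftrightarrow>
    (let X = state_space \<delta> \<Omega>; S = skew_product \<rho>;
         inv = (\<lambda>K. \<forall>t\<ge>0. S t ` K = K)
     in A \<noteq> {} \<and> compactin X A \<and> inv A \<and>
        (\<forall>K. K \<noteq> {} \<and> compactin X K \<and> inv K \<longrightarrow> K \<subseteq> A) \<and>
        (\<forall>D. compactin X D \<longrightarrow>
           ((\<lambda>t. semidist (prod_dist \<delta> dist) (S t ` D) A) \<longlongrightarrow> 0) at_top))"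

end

theory Submission
  imports Defs
begin

text \<open>
  Two trajectories with the same control differ by a homogeneous solution and hence approach each
  other exponentially. The fibre of the uniform attractor at time \<open>t\<close> therefore consists of the
  values at \<open>t\<close> of the bounded entire trajectories, and it is a compact convex set. Along a
  solution \<open>m\<close> of the adjoint equation \<open>m' = - W\<^sup>T m\<close> the product \<open>m \<bullet> x\<close> grows fastest for the
  control \<open>n = m / norm m\<close>; by strict convexity the bounded trajectory of this control is the only
  one that reaches the boundary in direction \<open>n\<close>. So the unit normal bundle is the set of values of
  bounded entire solutions of the boundary system, which the flow permutes. Since the normal
  component evolves autonomously, every other solution of the boundary system approaches the one
  with the same normal exponentially, which gives all attraction statements.
  Exponential stability carries over to the hull, because homogeneous solutions are differences of
  boundary trajectories and these depend continuously on the coefficients.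
\<close>

section \<open>Absolutely continuous functions\<close>

text \<open>The coefficients are only locally integrable, so all calculus is done on integral
  identities: product and chain rule are proved for primitives, and differential inequalities become
  comparisons of integrands. The equation for \<open>n\<close> is quadratic and not globally
  Lipschitz; its solutions on the whole line come from normalizing solutions of the linear adjoint
  equation, and only uniqueness is argued on the quadratic field itself, which is Lipschitz on the
  sphere. Closedness of the fibres is not drawn from weak compactness of the controls: a point of
  the closure missing from a convex fibre would be separated from it by a hyperplane, while the
  boundary trajectory with that normal lies in the fibre and, by a quantitative form of strict
  convexity, equals the point. For compact convex sets the limiting normals turn out to be the
  normals of supporting hyperplanes, which is what maximization along adjoint solutions produces.
  One pair \<open>K\<close>, \<open>\<gamma>\<close> serves the whole hull; this uniformity yields
  the global attractor from fibrewise estimates.\<close>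

text \<open>That is, \<open>u\<close> is locally absolutely continuous with derivative \<open>f\<close> almost everywhere.\<close>

definition antideriv :: "(real \<Rightarrow> 'a::euclidean_space) \<Rightarrow> (real \<Rightarrow> 'a) \<Rightarrow> bool" where
  "antideriv u f \<longleftrightarrow> locally_integrable f \<and> (\<forall>s t. s \<le> t \<longrightarrow> u t - u s = integral {s..t} f)"

lemma ode_solution_iff_antideriv:
  "ode_solution f u \<longleftrightarrow> antideriv u (\<lambda>r. f r (u r))"
proof -
  \<comment> \<open>For \<open>s > t\<close> the interval is empty, so the restriction to
    \<open>s \<le> t\<close> loses nothing.\<close>
  have "(\<forall>s t. s \<le> t \<longrightarrow> (g::real\<Rightarrow>'a) absolutely_integrable_on {s..t}) \<longleftrightarrow> locally_integrable g" for g
    unfolding locally_integrable_def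
    by (metis absolutely_integrable_negligible atLeastatMost_empty linorder_not_le negligible_empty)
  then show ?thesis
    unfolding ode_solution_def antideriv_def by metis
qed

lemma antideriv_integral: "antideriv u f \<Longrightarrow> s \<le> t \<Longrightarrow> u t - u s = integral {s..t} f"
  by (simp add: antideriv_def)

lemma antideriv_locally_integrable: "antideriv u f \<Longrightarrow> locally_integrable f"
  by (simp add: antideriv_def)

lemma locally_integrable_integrable: "locally_integrable f \<Longrightarrow> f integrable_on {a..b}"
  unfolding locally_integrable_def using absolutely_integrable_on_def by blast

lemma locally_integrable_norm:
  "locally_integrable f \<Longrightarrow> locally_integrable (\<lambda>t. norm (f t))"
  unfolding locally_integrable_def using absolutely_integrable_norm by (metis (no_types, lifting) comp_apply ext)

lemma locally_integrable_continuous: "continuous_on UNIV f \<Longrightarrow> locally_integrable f"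
  unfolding locally_integrable_def
  by (meson absolutely_integrable_continuous_real continuous_on_subset subset_UNIV)

lemma locally_integrable_add:
  "locally_integrable f \<Longrightarrow> locally_integrable g \<Longrightarrow> locally_integrable (\<lambda>t. f t + g t)"
  unfolding locally_integrable_def by (blast intro: set_integral_add)

lemma locally_integrable_diff:
  "locally_integrable f \<Longrightarrow> locally_integrable g \<Longrightarrow> locally_integrable (\<lambda>t. f t - g t)"
  unfolding locally_integrable_def by (blast intro: set_integral_diff)

lemma locally_integrable_linear:
  "locally_integrable f \<Longrightarrow> bounded_linear h \<Longrightarrow> locally_integrable (\<lambda>t. h (f t))"
  unfolding locally_integrable_def using absolutely_integrable_linear by (metis (no_types, lifting) comp_apply ext)

lemma locally_integrable_bilinear:
  fixes h :: "'a::euclidean_space \<Rightarrow> 'b::euclidean_space \<Rightarrow> 'c::euclidean_space"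
  assumes "bilinear h" "continuous_on UNIV f" "locally_integrable g"
  shows "locally_integrable (\<lambda>t. h (f t) (g t))"
  unfolding locally_integrable_def
proof (intro allI absolutely_integrable_bounded_measurable_product[OF \<open>bilinear h\<close>])
  fix a b :: real
  have c: "continuous_on {a..b} f" using assms(2) continuous_on_subset by blast
  then show "f \<in> borel_measurable (lebesgue_on {a..b})"
    by (simp add: continuous_imp_measurable_on_sets_lebesgue)
  show "bounded (f ` {a..b})"
    by (simp add: c compact_continuous_image compact_imp_bounded)
  show "g absolutely_integrable_on {a..b}" using assms(3) by (simp add: locally_integrable_def)
qed auto

lemma locally_integrable_mult:
  fixes f g :: "real \<Rightarrow> real"
  shows "continuous_on UNIV f \<Longrightarrow> locally_integrable g \<Longrightarrow> locally_integrable (\<lambda>t. f t * g t)"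
  by (rule locally_integrable_bilinear[OF bilinear_times])


lemma antideriv_continuous:
  assumes "antideriv u f"
  shows "continuous_on UNIV u"
proof -
  have "continuous_on {a..b} u" for a b
  proof -
    have "continuous_on {a..b} (\<lambda>x. u a + integral {a..x} f)"
      by (intro continuous_intros indefinite_integral_continuous_1 locally_integrable_integrable
          antideriv_locally_integrable[OF assms])
    then show ?thesis
      by (rule continuous_on_eq) (metis add_diff_cancel_left' antideriv_integral assms
          atLeastAtMost_iff diff_add_cancel add.commute)
  qed
  then have "isCont u x" for x
    by (metis (no_types, opaque_lifting) continuous_on_interior interior_atLeastAtMost_real
        greaterThanLessThan_iff linordered_field_no_lb linordered_field_no_ub)
  then show ?thesis by (simp add: continuous_at_imp_continuous_on)
qed

lemma antideriv_exists:
  assumes "locally_integrable f"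
  obtains u where "antideriv u f" "u a = c"
proof
  \<comment> \<open>The signed integral from \<open>a\<close> to \<open>t\<close>: for
    \<open>t < a\<close> the first interval is empty, for \<open>t > a\<close> the second.\<close>
  define u where "u t = c + integral {a..t} f - integral {t..a} f" for t
  have i: "f integrable_on {x..y}" for x y using assms locally_integrable_integrable by blast
  have comb: "integral {x..y} f + integral {y..z} f = integral {x..z} f" if "x \<le> y" "y \<le> z" for x y z
    using Henstock_Kurzweil_Integration.integral_combine[OF that i] .
  have e: "integral {x..y} f = 0" if "y < x" for x y using that by simp
  have "u t - u s = integral {s..t} f" if "s \<le> t" for s t
  proof -
    consider "a \<le> s" | "s < a" "a \<le> t" | "t < a" by linarith
    then show ?thesis
    proof cases
      case 1
      then have "integral {s..a} f = 0" "integral {t..a} f = 0"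
        using that by (cases "s = a"; cases "t = a"; auto)+
      then show ?thesis using comb[of a s t] 1 that by (simp add: u_def algebra_simps)
    next
      case 2
      then have "integral {a..s} f = 0" "integral {t..a} f = 0"
        by (cases "t = a"; auto)+
      then show ?thesis using comb[of s a t] 2 by (simp add: u_def algebra_simps)
    next
      case 3
      then show ?thesis using comb[of s t a] that by (simp add: u_def algebra_simps)
    qed
  qed
  then show "antideriv u f" using assms by (simp add: antideriv_def)
  show "u a = c" by (simp add: u_def)
qed

lemma antideriv_cong:
  "antideriv u f \<Longrightarrow> (\<And>t. u t = v t) \<Longrightarrow> (\<And>t. f t = g t) \<Longrightarrow> antideriv v g"
  by (metis ext)

lemma antideriv_const: "antideriv (\<lambda>t. c) (\<lambda>t. 0)"
  by (simp add: antideriv_def locally_integrable_def)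

lemma antideriv_add:
  assumes "antideriv u f" "antideriv v g"
  shows "antideriv (\<lambda>t. u t + v t) (\<lambda>t. f t + g t)"
  using assms unfolding antideriv_def
  by (auto intro!: locally_integrable_add
      simp: Henstock_Kurzweil_Integration.integral_add locally_integrable_integrable algebra_simps)

lemma antideriv_linear:
  assumes "antideriv u f" "bounded_linear h"
  shows "antideriv (\<lambda>t. h (u t)) (\<lambda>t. h (f t))"
  unfolding antideriv_def
proof (intro conjI allI impI)
  show "locally_integrable (\<lambda>t. h (f t))"
    using assms locally_integrable_linear antideriv_def by blast
  fix s t :: real assume "s \<le> t"
  have "h (u t) - h (u s) = h (integral {s..t} f)"
    by (metis \<open>s \<le> t\<close> antideriv_integral assms bounded_linear.linear linear_diff)
  also have "\<dots> = integral {s..t} (\<lambda>t. h (f t))"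
    using integral_linear[OF _ assms(2), of f "{s..t}"] locally_integrable_integrable
      antideriv_locally_integrable[OF assms(1)] by (metis (no_types, lifting) comp_apply ext)
  finally show "h (u t) - h (u s) = integral {s..t} (\<lambda>t. h (f t))" .
qed

lemma antideriv_diff:
  assumes "antideriv u f" "antideriv v g"
  shows "antideriv (\<lambda>t. u t - v t) (\<lambda>t. f t - g t)"
  using antideriv_add[OF assms(1) antideriv_linear[OF assms(2) bounded_linear_minus[OF bounded_linear_ident]]]
  by simp

lemma antideriv_scaleR_left:
  "antideriv u f \<Longrightarrow> antideriv (\<lambda>t. c *\<^sub>R u t) (\<lambda>t. c *\<^sub>R f t)"
  by (rule antideriv_linear[OF _ bounded_linear_scaleR_right])

lemma antideriv_componentwise:
  assumes "\<And>b. b \<in> Basis \<Longrightarrow> antideriv (\<lambda>t. u t \<bullet> b) (\<lambda>t. f t \<bullet> b)"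
  shows "antideriv u f"
  unfolding antideriv_def
proof (intro conjI allI impI)
  show li: "locally_integrable f"
    using assms absolutely_integrable_componentwise unfolding antideriv_def locally_integrable_def
    by blast
  fix s t :: real assume st: "s \<le> t"
  have "(u t - u s) \<bullet> b = integral {s..t} f \<bullet> b" if "b \<in> Basis" for b
    using antideriv_integral[OF assms[OF that] st] locally_integrable_integrable[OF li]
    by (simp add: inner_diff_left integral_component_eq)
  then show "u t - u s = integral {s..t} f" by (rule euclidean_eqI)
qed

lemma antideriv_eq_const:
  assumes "antideriv u (\<lambda>t. 0)"
  shows "u s = u t"
  using antideriv_integral[OF assms, of s t] antideriv_integral[OF assms, of t s] by (cases "s \<le> t") auto

lemma antideriv_norm_le:
  assumes "antideriv u f" "antideriv G k" "s \<le> t" "\<And>r. s \<le> r \<Longrightarrow> r \<le> t \<Longrightarrow> norm (f r) \<le> k r"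
  shows "norm (u t - u s) \<le> G t - G s"
  unfolding antideriv_integral[OF assms(1,3)] antideriv_integral[OF assms(2,3)]
  using assms by (intro Henstock_Kurzweil_Integration.integral_norm_bound_integral)
    (auto intro: locally_integrable_integrable antideriv_locally_integrable)

lemma antideriv_mono:
  assumes "antideriv u f" "antideriv v (g::real\<Rightarrow>real)" "s \<le> t" "\<And>r. s \<le> r \<Longrightarrow> r \<le> t \<Longrightarrow> f r \<le> g r"
  shows "u t - u s \<le> v t - v s"
  unfolding antideriv_integral[OF assms(1,3)] antideriv_integral[OF assms(2,3)]
  using assms by (intro Henstock_Kurzweil_Integration.integral_le)
    (auto intro: locally_integrable_integrable antideriv_locally_integrable)

text \<open>No pointwise derivative of \<open>u\<close> is used. With a primitive \<open>w\<close>
  of the expected derivative, the increments of \<open>\<Phi> (u t) - w t\<close> are at most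
  \<open>e\<close> times those of a primitive of \<open>norm (f t)\<close>, for every
  \<open>e > 0\<close>, so this function is constant.\<close>

lemma antideriv_chain:
  fixes u f \<Phi> D :: "real \<Rightarrow> real"
  assumes u: "antideriv u f"
    and S: "open S" "\<And>t. u t \<in> S"
    and D: "\<And>x. x \<in> S \<Longrightarrow> (\<Phi> has_real_derivative D x) (at x)"
    and cont: "continuous_on S D"
  shows "antideriv (\<lambda>t. \<Phi> (u t)) (\<lambda>t. D (u t) * f t)"
proof -
  have cu: "continuous_on UNIV u" using antideriv_continuous[OF u] .
  have cDu: "continuous_on UNIV (\<lambda>t. D (u t))"
    by (rule continuous_on_compose2[OF cont cu]) (use S in auto)
  have lf: "locally_integrable f" using u antideriv_def by blast
  have li: "locally_integrable (\<lambda>t. D (u t) * f t)"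
    by (rule locally_integrable_mult[OF cDu lf])
  obtain w where w: "antideriv w (\<lambda>t. D (u t) * f t)" using antideriv_exists[OF li] by metis
  obtain G where G: "antideriv G (\<lambda>t. norm (f t))"
    using antideriv_exists[OF locally_integrable_norm[OF lf]] by metis
  define F where "F t = \<Phi> (u t) - w t" for t
  have F: "\<bar>F t - F s\<bar> \<le> e * (G t - G s)" if st: "s \<le> t" and e: "e > 0" for s t e
    using st
  \<comment> \<open>The bound is additive over adjacent intervals, so by bisection it is enough to
    have it on short intervals around each point.\<close>
  proof (induction rule: Bolzano)
    case (trans a b c)
    then show ?case by (simp add: algebra_simps)
  next
    case (local x)
    have ux: "u x \<in> S" using S by simp
    obtain d1 where d1: "d1 > 0" "ball (u x) d1 \<subseteq> S"
      using S(1) ux open_contains_ball by blast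
    obtain d2 where d2: "d2 > 0" "\<And>y. y \<in> S \<Longrightarrow> dist y (u x) < d2 \<Longrightarrow> dist (D y) (D (u x)) < e/2"
      using cont ux e unfolding continuous_on_iff by (metis half_gt_zero)
    define d3 where "d3 = min d1 d2"
    have d3: "d3 > 0" "d3 \<le> d1" "d3 \<le> d2" using d1 d2 by (auto simp: d3_def)
    obtain d where d: "d > 0" "\<And>r. dist r x < d \<Longrightarrow> dist (u r) (u x) < d3"
      using cu d3(1) unfolding continuous_on_iff by (metis UNIV_I)
    have "\<bar>F b - F a\<bar> \<le> e * (G b - G a)" if ab: "a \<le> x" "x \<le> b" "b - a < d" for a b
    proof -
      have near: "dist (u r) (u x) < d3" if "a \<le> r" "r \<le> b" for r
        using d(2)[of r] that ab by (auto simp: dist_real_def)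
      have mv: "\<exists>\<xi>. \<bar>\<xi> - u x\<bar> < d3 \<and> \<Phi> p - \<Phi> q = D \<xi> * (p - q)"
        if "q < p" "dist p (u x) < d3" "dist q (u x) < d3" for p q
      proof -
        have "\<exists>z. q < z \<and> z < p \<and> \<Phi> p - \<Phi> q = (p - q) * D z"
        proof (rule MVT2[OF that(1)])
          fix z assume "q \<le> z" "z \<le> p"
          then have "z \<in> ball (u x) d1" using that d3 by (auto simp: dist_real_def)
          then show "(\<Phi> has_real_derivative D z) (at z)" using d1 D by blast
        qed
        then obtain z where "q < z" "z < p" "\<Phi> p - \<Phi> q = (p - q) * D z" by blast
        then show ?thesis using that by (intro exI[of _ z]) (auto simp: dist_real_def mult.commute)
      qed
      \<comment> \<open>A single mean value \<open>D \<xi>\<close> represents the whole increment;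
        on a short interval it differs from every \<open>D (u r)\<close> by at most
        \<open>e\<close>.\<close>
      obtain \<xi> where \<xi>: "\<bar>\<xi> - u x\<bar> < d3" "\<Phi> (u b) - \<Phi> (u a) = D \<xi> * (u b - u a)"
      proof (cases "u b" "u a" rule: linorder_cases)
        case less
        then show ?thesis using mv[OF less near near] ab that
          by (smt (verit, ccfv_SIG) mult_minus_right)
      next
        case equal
        then show ?thesis using that[of "u x"] d3 by simp
      next
        case greater
        then show ?thesis using mv[OF greater near near] ab that by fastforce
      qed
      have DD: "\<bar>D \<xi> - D (u r)\<bar> \<le> e" if "a \<le> r" "r \<le> b" for r
      proof -
        have "dist (D (u r)) (D (u x)) < e/2" using d2(2) near[OF that] S(2) d3 by fastforce
        moreover have "dist (D \<xi>) (D (u x)) < e/2"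
          by (rule d2(2)) (use \<xi>(1) d3 d1(2) in \<open>auto simp: dist_real_def subset_iff\<close>)
        ultimately show ?thesis unfolding dist_real_def by linarith
      qed
      have 1: "antideriv (\<lambda>t. D \<xi> * u t - w t) (\<lambda>t. D \<xi> * f t - D (u t) * f t)"
        using antideriv_diff[OF antideriv_scaleR_left[OF u, of "D \<xi>"] w] by simp
      have 2: "antideriv (\<lambda>t. e * G t) (\<lambda>t. e * norm (f t))"
        using antideriv_scaleR_left[OF G, of e] by simp
      have "norm ((D \<xi> * u b - w b) - (D \<xi> * u a - w a)) \<le> e * G b - e * G a"
      proof (rule antideriv_norm_le[OF 1 2])
        show "a \<le> b" using ab by simp
        fix r assume "a \<le> r" "r \<le> b"
        then show "norm (D \<xi> * f r - D (u r) * f r) \<le> e * norm (f r)"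
          using DD by (simp add: left_diff_distrib[symmetric] abs_mult mult_right_mono)
      qed
      moreover have "F b - F a = (D \<xi> * u b - w b) - (D \<xi> * u a - w a)"
        using \<xi>(2) by (simp add: F_def algebra_simps)
      ultimately show ?thesis by (simp add: algebra_simps)
    qed
    then show ?case using d(1) by blast
  qed
  have Fc: "F t = F s" if st: "s \<le> t" for s t
  proof (rule ccontr)
    assume ne: "F t \<noteq> F s"
    have G0: "G t - G s \<ge> 0" using order_trans[OF abs_ge_zero F[OF st zero_less_one]] by simp
    \<comment> \<open>Chosen so that \<open>e * (G t - G s)\<close> stays below the increment
      itself; the summand 1 covers \<open>G t = G s\<close>.\<close>
    define e where "e = \<bar>F t - F s\<bar> / (2 * (G t - G s + 1))"
    have e: "e > 0" using ne G0 by (simp add: e_def)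
    have "\<bar>F t - F s\<bar> \<le> e * (G t - G s)" using F[OF st e] .
    also have "\<dots> < e * (2 * (G t - G s + 1))" using e G0 by (intro mult_strict_left_mono) auto
    also have "\<dots> = \<bar>F t - F s\<bar>" using G0 by (simp add: e_def)
    finally show False by simp
  qed
  show ?thesis
    unfolding antideriv_def
  proof (intro conjI allI impI li)
    fix s t :: real assume "s \<le> t"
    then show "\<Phi> (u t) - \<Phi> (u s) = integral {s..t} (\<lambda>t. D (u t) * f t)"
      using Fc[of s t] antideriv_integral[OF w, of s t] by (simp add: F_def)
  qed
qed

text \<open>Polarization reduces the product to squares, which the chain rule covers.\<close>

lemma antideriv_mult:
  fixes u v f g :: "real \<Rightarrow> real"
  assumes "antideriv u f" "antideriv v g"
  shows "antideriv (\<lambda>t. u t * v t) (\<lambda>t. f t * v t + u t * g t)"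
proof -
  have sq: "antideriv (\<lambda>t. (w t)\<^sup>2) (\<lambda>t. (2 * w t) * h t)" if "antideriv w h" for w h :: "real \<Rightarrow> real"
    by (rule antideriv_chain[OF that open_UNIV]) (auto intro!: derivative_eq_intros continuous_intros)
  have "antideriv (\<lambda>t. (1/4) *\<^sub>R ((u t + v t)\<^sup>2 - (u t - v t)\<^sup>2))
      (\<lambda>t. (1/4) *\<^sub>R (2 * (u t + v t) * (f t + g t) - 2 * (u t - v t) * (f t - g t)))"
    by (intro antideriv_scaleR_left antideriv_diff sq antideriv_add assms)
  then show ?thesis
    by (rule antideriv_cong) (auto simp: power2_eq_square algebra_simps)
qed

lemma antideriv_sum:
  assumes "finite I" "\<And>i. i \<in> I \<Longrightarrow> antideriv (u i) (f i)"
  shows "antideriv (\<lambda>t. \<Sum>i\<in>I. u i t) (\<lambda>t. \<Sum>i\<in>I. f i t)"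
  using assms by (induction) (auto intro: antideriv_const antideriv_add)

lemma antideriv_inner:
  assumes "antideriv u f" "antideriv v g"
  shows "antideriv (\<lambda>t. u t \<bullet> v t) (\<lambda>t. f t \<bullet> v t + u t \<bullet> g t)"
proof -
  have c: "antideriv (\<lambda>t. w t \<bullet> b) (\<lambda>t. h t \<bullet> b)" if "antideriv w h" for w h :: "real \<Rightarrow> 'a" and b
    by (rule antideriv_linear[OF that bounded_linear_inner_left])
  have "antideriv (\<lambda>t. \<Sum>b\<in>Basis. (u t \<bullet> b) * (v t \<bullet> b))
     (\<lambda>t. \<Sum>b\<in>Basis. (f t \<bullet> b) * (v t \<bullet> b) + (u t \<bullet> b) * (g t \<bullet> b))"
    by (intro antideriv_sum antideriv_mult c assms) auto
  then show ?thesis by (simp add: euclidean_inner[symmetric] sum.distrib)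
qed

lemma antideriv_scaleR:
  fixes u :: "real \<Rightarrow> real" and v :: "real \<Rightarrow> 'a::euclidean_space"
  assumes "antideriv u f" "antideriv v g"
  shows "antideriv (\<lambda>t. u t *\<^sub>R v t) (\<lambda>t. f t *\<^sub>R v t + u t *\<^sub>R g t)"
proof (rule antideriv_componentwise)
  fix b :: 'a
  have "antideriv (\<lambda>t. v t \<bullet> b) (\<lambda>t. g t \<bullet> b)"
    by (rule antideriv_linear[OF assms(2) bounded_linear_inner_left])
  from antideriv_mult[OF assms(1) this]
  show "antideriv (\<lambda>t. u t *\<^sub>R v t \<bullet> b) (\<lambda>t. (f t *\<^sub>R v t + u t *\<^sub>R g t) \<bullet> b)"
    by (simp add: inner_add_left)
qed

lemma antideriv_exp:
  fixes G k :: "real \<Rightarrow> real"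
  assumes "antideriv G k"
  shows "antideriv (\<lambda>t. exp (c * G t)) (\<lambda>t. c * exp (c * G t) * k t)"
  by (rule antideriv_chain[OF assms open_UNIV]) (auto intro!: derivative_eq_intros continuous_intros)

section \<open>Caratheodory equations with Lipschitz right-hand side\<close>

text \<open>The square \<open>q = d \<bullet> d\<close> changes at a rate of at most
  \<open>2 * k * q\<close>, so \<open>q * exp (- 2 * G)\<close> does not increase and
  \<open>q * exp (2 * G)\<close> does not decrease. Both vanish at \<open>a\<close>; the first
  handles later times, the second earlier ones.\<close>

lemma antideriv_gronwall_zero:
  assumes d: "antideriv d g" and k: "locally_integrable k"
    and le: "\<And>t. norm (g t) \<le> k t * norm (d t)" and "d a = 0"
  shows "d t = 0"
proof -
  obtain G where G: "antideriv G k" using antideriv_exists[OF k] by metis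
  define q where "q t = d t \<bullet> d t" for t
  have q: "antideriv q (\<lambda>t. g t \<bullet> d t + d t \<bullet> g t)"
    unfolding q_def by (rule antideriv_inner[OF d d])
  have gd: "\<bar>g r \<bullet> d r + d r \<bullet> g r\<bar> \<le> 2 * k r * q r" for r
  proof -
    have "\<bar>g r \<bullet> d r\<bar> \<le> norm (g r) * norm (d r)" by (rule Cauchy_Schwarz_ineq2)
    also have "\<dots> \<le> k r * norm (d r) * norm (d r)" by (intro mult_right_mono le) auto
    also have "\<dots> = k r * q r" by (simp add: q_def power2_norm_eq_inner[symmetric] power2_eq_square)
    finally show ?thesis by (simp add: inner_commute)
  qed
  have exps: "antideriv (\<lambda>t. q t * exp (c * G t))
      (\<lambda>t. (g t \<bullet> d t + d t \<bullet> g t) * exp (c * G t) + q t * (c * exp (c * G t) * k t))" for c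
    by (rule antideriv_mult[OF q antideriv_exp[OF G]])
  have "q t \<le> 0"
  proof (cases "a \<le> t")
    case True
    have "q t * exp (- 2 * G t) - q a * exp (- 2 * G a) \<le> 0 - 0"
    proof (rule antideriv_mono[OF exps antideriv_const True])
      fix r
      have "(g r \<bullet> d r + d r \<bullet> g r) * exp (- 2 * G r) + q r * (- 2 * exp (- 2 * G r) * k r)
          = (g r \<bullet> d r + d r \<bullet> g r - 2 * k r * q r) * exp (- 2 * G r)" by (simp add: algebra_simps)
      also have "\<dots> \<le> 0" using gd[of r] by (intro mult_nonpos_nonneg) auto
      finally show "(g r \<bullet> d r + d r \<bullet> g r) * exp (- 2 * G r) + q r * (- 2 * exp (- 2 * G r) * k r) \<le> 0" .
    qed
    then show ?thesis using \<open>d a = 0\<close> by (simp add: q_def mult_le_0_iff)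
  next
    case False
    then have ta: "t \<le> a" by simp
    have "0 - 0 \<le> q a * exp (2 * G a) - q t * exp (2 * G t)"
    proof (rule antideriv_mono[OF antideriv_const exps ta])
      fix r
      have "0 \<le> (g r \<bullet> d r + d r \<bullet> g r + 2 * k r * q r) * exp (2 * G r)"
        using gd[of r] by (intro mult_nonneg_nonneg) auto
      then show "0 \<le> (g r \<bullet> d r + d r \<bullet> g r) * exp (2 * G r) + q r * (2 * exp (2 * G r) * k r)"
        by (simp add: algebra_simps)
    qed
    then show ?thesis using \<open>d a = 0\<close> by (simp add: q_def mult_le_0_iff)
  qed
  then show ?thesis unfolding q_def by (metis inner_ge_zero inner_eq_zero_iff order_antisym)
qed

lemma ode_solution_unique:
  assumes "ode_solution f u" "ode_solution f v" "locally_integrable k"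
    and "\<And>t. norm (f t (u t) - f t (v t)) \<le> k t * norm (u t - v t)" "u a = v a"
  shows "u = v"
proof
  fix t
  have "u t - v t = 0"
    by (rule antideriv_gronwall_zero[OF antideriv_diff[OF assms(1,2)[unfolded ode_solution_iff_antideriv]]
          assms(3)]) (use assms(4,5) in auto)
  then show "u t = v t" by simp
qed

text \<open>One Picard step halves the weighted norm: \<open>exp (2 * G) / 2\<close> is a primitive
  of \<open>k * exp (2 * G)\<close>, so the factor 2 in the exponent becomes the contraction factor
  1/2. Before \<open>a\<close> the primitive \<open>G\<close> is nonpositive and the mirrored weight
  is used.\<close>

lemma antideriv_weighted_bound:
  assumes G: "antideriv G k" "G a = 0" and k: "\<And>t. 0 \<le> k t"
    and v: "antideriv v h" "v a = 0" and h: "\<And>t. norm (h t) \<le> k t * (exp (2 * \<bar>G t\<bar>) * M)"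
    and M: "0 \<le> M"
  shows "norm (v t) \<le> exp (2 * \<bar>G t\<bar>) * (M / 2)"
proof -
  have mono: "G s \<le> G r" if "s \<le> r" for r s
    using antideriv_mono[OF antideriv_const G(1) that] k by force
  show ?thesis
  proof (cases "a \<le> t")
    case True
    have e1: "antideriv (\<lambda>t. (M/2) *\<^sub>R exp (2 * G t)) (\<lambda>t. (M/2) *\<^sub>R (2 * exp (2 * G t) * k t))"
      by (intro antideriv_scaleR_left antideriv_exp G)
    have "norm (v t - v a) \<le> (M/2) *\<^sub>R exp (2 * G t) - (M/2) *\<^sub>R exp (2 * G a)"
    proof (rule antideriv_norm_le[OF v(1) e1 True])
      fix r assume "a \<le> r"
      then have "G r \<ge> 0" using mono[of a r] G by simp
      then show "norm (h r) \<le> (M/2) *\<^sub>R (2 * exp (2 * G r) * k r)"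
        using h[of r] by (simp add: mult.commute mult.left_commute)
    qed
    moreover have "G t \<ge> 0" using mono[OF True] G by simp
    ultimately show ?thesis using v(2) G(2) M by (simp add: mult.commute)
  next
    case False
    then have ta: "t \<le> a" by simp
    have e1: "antideriv (\<lambda>t. (-M/2) *\<^sub>R exp (-2 * G t)) (\<lambda>t. (-M/2) *\<^sub>R (-2 * exp (-2 * G t) * k t))"
      by (intro antideriv_scaleR_left antideriv_exp G)
    have "norm (v a - v t) \<le> (-M/2) *\<^sub>R exp (-2 * G a) - (-M/2) *\<^sub>R exp (-2 * G t)"
    proof (rule antideriv_norm_le[OF v(1) e1 ta])
      fix r assume "r \<le> a"
      then have "G r \<le> 0" using mono[of r a] G by simp
      then show "norm (h r) \<le> (-M/2) *\<^sub>R (-2 * exp (-2 * G r) * k r)"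
        using h[of r] by (simp add: mult.commute mult.left_commute)
    qed
    moreover have "G t \<le> 0" using mono[OF ta] G by simp
    ultimately show ?thesis using v(2) G(2) M by (simp add: mult.commute)
  qed
qed

text \<open>Picard iteration is a contraction on all of the real line for the weighted supremum norm
  with weight \<open>exp (- 2 * \<bar>G t\<bar>)\<close>, where \<open>G\<close> is a primitive of the Lipschitz constant.\<close>

lemma lipschitz_ode_exists:
  fixes f :: "real \<Rightarrow> 'a::euclidean_space \<Rightarrow> 'a"
  assumes k: "locally_integrable k"
    and lip: "\<And>t x y. norm (f t x - f t y) \<le> k t * norm (x - y)"
    and f0: "\<And>t. norm (f t 0) \<le> k t"
    and meas: "\<And>u. continuous_on UNIV u \<Longrightarrow> locally_integrable (\<lambda>t. f t (u t))"
  obtains u where "ode_solution f u" "u a = c"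
proof -
  obtain G where G: "antideriv G k" "G a = 0" using antideriv_exists[OF k] by metis
  have k0: "0 \<le> k t" for t using f0[of t] norm_ge_zero order_trans by blast
  define E where "E t = exp (2 * \<bar>G t\<bar>)" for t
  have cE: "continuous_on UNIV E"
    unfolding E_def by (intro continuous_intros antideriv_continuous[OF G(1)])
  have E1: "E t \<ge> 1" for t by (simp add: E_def)
  then have E0: "E t > 0" for t using less_le_trans zero_less_one by blast
  note wb = antideriv_weighted_bound[OF G k0, folded E_def]
  \<comment> \<open>Here \<open>w\<close> stands for a trajectory divided by the weight
    \<open>E\<close>, so that the weighted norm becomes the supremum norm on bounded continuous
    functions.\<close>
  define h where "h w t = f t (E t *\<^sub>R apply_bcontfun w t)" for w t
  have nE: "norm (x /\<^sub>R E t) = norm x / E t" for x :: 'a and t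
    using E0[of t] by (simp add: field_simps)
  have lih: "locally_integrable (h w)" for w
    unfolding h_def by (rule meas, rule continuous_on_scaleR[OF cE continuous_on_apply_bcontfun])
  have "\<forall>w. \<exists>u. antideriv u (h w) \<and> u a = c" using antideriv_exists[OF lih] by metis
  then obtain I where I: "\<And>w. antideriv (I w) (h w)" "\<And>w. I w a = c" by metis
  define T where "T w = Bcontfun (\<lambda>t. I w t /\<^sub>R E t)" for w
  \<comment> \<open>Boundedness makes the image a legitimate argument of \<open>Bcontfun\<close>;
    the 1 accounts for \<open>f t 0\<close>.\<close>
  have Tb: "norm (I w t /\<^sub>R E t) \<le> norm c + (1 + norm w) / 2" for w t
  proof -
    have "norm (I w t - c) \<le> E t * ((1 + norm w) / 2)"
    proof (rule wb)
      show "antideriv (\<lambda>t. I w t - c) (h w)"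
        using antideriv_diff[OF I(1) antideriv_const] by simp
      fix r
      have "norm (h w r) \<le> norm (f r 0) + norm (f r (E r *\<^sub>R apply_bcontfun w r) - f r 0)"
        unfolding h_def by (metis add.commute diff_add_cancel norm_triangle_ineq)
      also have "\<dots> \<le> k r + k r * norm (E r *\<^sub>R apply_bcontfun w r - 0)" using f0 lip add_mono by blast
      also have "\<dots> = k r * (1 + E r * norm (apply_bcontfun w r))" using E0[of r] by (simp add: algebra_simps)
      also have "\<dots> \<le> k r * (E r + E r * norm w)"
        using E0[of r] E1[of r] k0[of r] norm_bounded[of w r]
        by (intro mult_left_mono add_mono) (auto intro: mult_left_mono)
      finally show "norm (h w r) \<le> k r * (E r * (1 + norm w))" by (simp add: algebra_simps)
    qed (auto simp: I add_nonneg_nonneg)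
    then have "norm (I w t) \<le> norm c + E t * ((1 + norm w) / 2)"
      by (metis add_left_mono diff_add_cancel norm_triangle_ineq add.commute order_trans)
    then have "norm (I w t) / E t \<le> (norm c + E t * ((1 + norm w) / 2)) / E t"
      using E0[of t] by (intro divide_right_mono) auto
    also have "\<dots> = norm c / E t + (1 + norm w) / 2" using E0[of t] by (simp add: field_simps)
    also have "\<dots> \<le> norm c + (1 + norm w) / 2"
      using divide_left_mono[OF E1[of t], of "norm c"] E0[of t] by simp
    finally show ?thesis unfolding nE .
  qed
  have Ta: "apply_bcontfun (T w) t = I w t /\<^sub>R E t" for w t
  proof -
    have "continuous_on UNIV (\<lambda>t. I w t /\<^sub>R E t)"
      by (rule continuous_on_scaleR[OF continuous_on_inverse[OF cE] antideriv_continuous[OF I(1)]])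
         (use E0 in \<open>simp add: less_imp_neq[symmetric]\<close>)
    then have "(\<lambda>t. I w t /\<^sub>R E t) \<in> bcontfun"
      using Tb by (rule bcontfun_normI)
    then show ?thesis by (simp add: T_def Bcontfun_inverse)
  qed
  have "dist (T v) (T w) \<le> (1/2) * dist v w" for v w
    unfolding dist_norm
  proof (rule norm_bound)
    fix t
    have "norm (I v t - I w t) \<le> E t * (norm (v - w) / 2)"
    proof (rule wb)
      show "antideriv (\<lambda>t. I v t - I w t) (\<lambda>t. h v t - h w t)"
        by (intro antideriv_diff I)
      fix r
      have "norm (h v r - h w r) \<le> k r * norm (E r *\<^sub>R apply_bcontfun v r - E r *\<^sub>R apply_bcontfun w r)"
        unfolding h_def by (rule lip)
      also have "\<dots> = k r * (E r * norm (apply_bcontfun (v - w) r))"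
        using E0[of r] by (simp add: scaleR_diff_right[symmetric] minus_bcontfun.rep_eq)
      also have "\<dots> \<le> k r * (E r * norm (v - w))"
        using E0[of r] k0[of r] by (intro mult_left_mono norm_bounded) auto
      finally show "norm (h v r - h w r) \<le> k r * (E r * norm (v - w))" .
    qed (auto simp: I)
    then have "norm (I v t - I w t) / E t \<le> norm (v - w) / 2"
      using E0[of t] by (simp add: field_simps)
    moreover have "norm (apply_bcontfun (T v - T w) t) = norm (I v t - I w t) / E t"
      by (simp only: minus_bcontfun.rep_eq Ta scaleR_diff_right[symmetric] nE)
    ultimately show "norm (apply_bcontfun (T v - T w) t) \<le> 1 / 2 * norm (v - w)" by simp
  qed
  then obtain w where w: "T w = w" using banach_fix_type[of "1/2" T] by auto
  have "I w t = E t *\<^sub>R apply_bcontfun w t" for t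
    using Ta[of w t] E0[of t] unfolding w by simp
  then have "antideriv (I w) (\<lambda>t. f t (I w t))" using I(1)[of w] unfolding h_def by simp
  then show thesis using that I(2) ode_solution_iff_antideriv by blast
qed

text \<open>An arbitrary bilinear product covers the state equation, the adjoint equation and the
  matrix equation at once.\<close>

lemma bilinear_ode_exists:
  fixes h :: "'b::euclidean_space \<Rightarrow> 'a::euclidean_space \<Rightarrow> 'a"
  assumes h: "bilinear h" and A: "locally_integrable A" and b: "locally_integrable b"
  obtains u where "ode_solution (\<lambda>t x. h (A t) x + b t) u" "u a = c"
proof -
  obtain B where B: "B > 0" "\<And>x y. norm (h x y) \<le> B * norm x * norm y"
    using bilinear_bounded_pos[OF h] by blast
  define k where "k t = B * norm (A t) + norm (b t)" for t
  have "bounded_linear (\<lambda>x. B * x)" by (rule bounded_linear_mult_right)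
  then have k: "locally_integrable k"
    unfolding k_def
    by (intro locally_integrable_add locally_integrable_norm b
        locally_integrable_linear[OF locally_integrable_norm[OF A]])
  have h0: "h x 0 = 0" for x using h by (simp add: bilinear_rzero)
  show thesis
  proof (rule lipschitz_ode_exists[of k "\<lambda>t x. h (A t) x + b t" a c, OF k])
    show "norm (h (A t) x + b t - (h (A t) y + b t)) \<le> k t * norm (x - y)" for t x y
    proof -
      have "norm (h (A t) x + b t - (h (A t) y + b t)) = norm (h (A t) (x - y))"
        by (simp add: bilinear_rsub[OF h])
      also have "\<dots> \<le> B * norm (A t) * norm (x - y)" by (rule B)
      also have "\<dots> \<le> k t * norm (x - y)" by (intro mult_right_mono) (auto simp: k_def)
      finally show ?thesis .
    qed
    show "norm (h (A t) 0 + b t) \<le> k t" for t using B(1) by (simp add: h0 k_def)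
    show "locally_integrable (\<lambda>t. h (A t) (u t) + b t)" if "continuous_on UNIV u" for u
      by (rule locally_integrable_add[OF locally_integrable_bilinear[OF _ that A] b, of "\<lambda>x y. h y x"])
         (use h in \<open>simp add: bilinear_def\<close>)
  qed (use that in blast)
qed

lemma bilinear_ode_unique:
  fixes h :: "'b::euclidean_space \<Rightarrow> 'a::euclidean_space \<Rightarrow> 'a"
  assumes h: "bilinear h" and A: "locally_integrable A"
    and u: "ode_solution (\<lambda>t x. h (A t) x + b t) u" and v: "ode_solution (\<lambda>t x. h (A t) x + b t) v"
    and "u a = v a"
  shows "u = v"
proof -
  obtain B where B: "B > 0" "\<And>x y. norm (h x y) \<le> B * norm x * norm y"
    using bilinear_bounded_pos[OF h] by blast
  have k: "locally_integrable (\<lambda>t. B * norm (A t))"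
    by (intro locally_integrable_linear[OF locally_integrable_norm[OF A]] bounded_linear_mult_right)
  show ?thesis
    by (rule ode_solution_unique[OF u v k _ \<open>u a = v a\<close>])
       (simp add: bilinear_rsub[OF h, symmetric] B)
qed

section \<open>Time shifts, null sets, limits and concatenation of solutions\<close>

lemma ode_solution_shift:
  assumes "ode_solution f u"
  shows "ode_solution (\<lambda>t. f (t + c)) (\<lambda>t. u (t + c))"
  unfolding ode_solution_iff_antideriv antideriv_def
proof (intro conjI allI impI)
  have u: "antideriv u (\<lambda>r. f r (u r))" using assms ode_solution_iff_antideriv by blast
  then show "locally_integrable (\<lambda>r. f (r + c) (u (r + c)))"
    using locally_integrable_translate[of "\<lambda>r. f r (u r)" c] antideriv_def by blast
  fix s t :: real assume "s \<le> t"
  then show "u (t + c) - u (s + c) = integral {s..t} (\<lambda>r. f (r + c) (u (r + c)))"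
    using antideriv_integral[OF u, of "s + c" "t + c"]
      integral_shift_Icc_real[of s t "\<lambda>r. f r (u r)" c] by (simp add: o_def add.commute)
qed

text \<open>Serves twice: to exchange representatives of a class in the hull, and to replace an
  almost everywhere bounded control by one that is bounded everywhere.\<close>

lemma ode_solution_cong_AE:
  assumes "AE t in lebesgue. \<forall>x. f t x = g t x" "ode_solution f u"
  shows "ode_solution g u"
proof -
  let ?N = "{t. \<not> (\<forall>x. f t x = g t x)}"
  have N: "negligible ?N"
    using assms(1) by (simp add: completion.AE_iff_null_sets negligible_iff_null_sets)
  have eq: "g r (u r) = f r (u r)" if "r \<in> {s..t} - ?N" for r s t using that by auto
  show ?thesis
    unfolding ode_solution_def
  proof (intro allI impI conjI)
    fix s t :: real assume "s \<le> t"
    then have f: "(\<lambda>r. f r (u r)) absolutely_integrable_on {s..t}"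
      "u t - u s = integral {s..t} (\<lambda>r. f r (u r))" using assms(2) by (auto simp: ode_solution_def)
    show "(\<lambda>r. g r (u r)) absolutely_integrable_on {s..t}"
      by (rule absolutely_integrable_spike[OF f(1) N eq])
    show "u t - u s = integral {s..t} (\<lambda>r. g r (u r))"
      unfolding f(2) by (rule integral_spike[OF N eq])
  qed
qed

text \<open>The integral identity on \<open>{s..t}\<close> involves no time before \<open>s\<close>.
  Pointwise limits of solutions, which are compared with true solutions only from a given time on,
  are recognized as solutions in this way.\<close>

lemma ode_solution_eq_on_right:
  assumes "\<And>s. \<exists>y. ode_solution f y \<and> (\<forall>t\<ge>s. y t = X t)"
  shows "ode_solution f X"
  unfolding ode_solution_def
proof (intro allI impI)
  fix s t :: real assume st: "s \<le> t"
  obtain y where y: "ode_solution f y" "\<And>t. t \<ge> s \<Longrightarrow> y t = X t" using assms by metis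
  have "(\<lambda>r. f r (X r)) absolutely_integrable_on {s..t}"
    by (rule absolutely_integrable_spike[OF _ negligible_empty, where f = "\<lambda>r. f r (y r)"])
       (use y st in \<open>auto simp: ode_solution_def\<close>)
  moreover have "integral {s..t} (\<lambda>r. f r (y r)) = integral {s..t} (\<lambda>r. f r (X r))"
    by (rule Henstock_Kurzweil_Integration.integral_cong) (use y in auto)
  ultimately show "(\<lambda>r. f r (X r)) absolutely_integrable_on {s..t} \<and>
      X t - X s = integral {s..t} (\<lambda>r. f r (X r))"
    using y st by (metis ode_solution_def order_refl)
qed

lemma ode_solution_concat:
  assumes u: "ode_solution f u" and v: "ode_solution g v" and eq: "u a = v a"
  shows "ode_solution (\<lambda>t. if t \<le> a then f t else g t) (\<lambda>t. if t \<le> a then u t else v t)"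
    (is "ode_solution ?h ?w")
  unfolding ode_solution_def
proof (intro allI impI)
  fix s t :: real assume st: "s \<le> t"
  have left: "(\<lambda>r. ?h r (?w r)) absolutely_integrable_on {p..q} \<and>
      ?w q - ?w p = integral {p..q} (\<lambda>r. ?h r (?w r))" if "p \<le> q" "q \<le> a" for p q
  proof -
    have "(\<lambda>r. ?h r (?w r)) absolutely_integrable_on {p..q}"
      by (rule absolutely_integrable_spike[OF _ negligible_empty, where f = "\<lambda>r. f r (u r)"])
         (use u that in \<open>auto simp: ode_solution_def\<close>)
    moreover have "integral {p..q} (\<lambda>r. ?h r (?w r)) = integral {p..q} (\<lambda>r. f r (u r))"
      by (rule Henstock_Kurzweil_Integration.integral_cong) (use that in auto)
    ultimately show ?thesis using u that by (auto simp: ode_solution_def)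
  qed
  have right: "(\<lambda>r. ?h r (?w r)) absolutely_integrable_on {p..q} \<and>
      ?w q - ?w p = integral {p..q} (\<lambda>r. ?h r (?w r))" if "p \<le> q" "a \<le> p" for p q
  proof -
    \<comment> \<open>At the junction the combined field is \<open>f\<close> and not
      \<open>g\<close>; a single time is negligible.\<close>
    have N: "negligible {a}" by simp
    have "(\<lambda>r. ?h r (?w r)) absolutely_integrable_on {p..q}"
      by (rule absolutely_integrable_spike[OF _ N, where f = "\<lambda>r. g r (v r)"])
         (use v that in \<open>auto simp: ode_solution_def\<close>)
    moreover have "integral {p..q} (\<lambda>r. ?h r (?w r)) = integral {p..q} (\<lambda>r. g r (v r))"
      by (rule integral_spike[OF N]) (use that in auto)
    moreover have "?w q = v q" "?w p = v p" using that eq by (auto dest: antisym)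
    moreover have "v q - v p = integral {p..q} (\<lambda>r. g r (v r))"
      using v that(1) by (simp add: ode_solution_def)
    ultimately show ?thesis by (simp only: simp_thms)
  qed
  consider "t \<le> a" | "a \<le> s" | "s \<le> a" "a \<le> t" by linarith
  then show "(\<lambda>r. ?h r (?w r)) absolutely_integrable_on {s..t} \<and>
      ?w t - ?w s = integral {s..t} (\<lambda>r. ?h r (?w r))"
  proof cases
    case 3
    have arith: "(x - y) + (z - x) = z - y" for x y z :: 'a by simp
    have i: "(\<lambda>r. ?h r (?w r)) absolutely_integrable_on {s..t}"
      by (rule absolutely_integrable_on_combine[where c = a]) (use left[of s a] right[of a t] 3 in auto)
    have "?w t - ?w s = (?w a - ?w s) + (?w t - ?w a)" by (rule arith[symmetric])
    also have "\<dots> = integral {s..a} (\<lambda>r. ?h r (?w r)) + integral {a..t} (\<lambda>r. ?h r (?w r))"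
      by (rule arg_cong2[where f = "(+)", OF left[of s a, THEN conjunct2] right[of a t, THEN conjunct2]])
         (use 3 in auto)
    also have "\<dots> = integral {s..t} (\<lambda>r. ?h r (?w r))"
      by (rule Henstock_Kurzweil_Integration.integral_combine[OF 3])
         (use i in \<open>simp add: absolutely_integrable_on_def\<close>)
    finally have "?w t - ?w s = integral {s..t} (\<lambda>r. ?h r (?w r))" .
    then show ?thesis using i by blast
  qed (use left right st in auto)
qed

lemma antideriv_Pair_iff:
  fixes u :: "real \<Rightarrow> 'a::euclidean_space \<times> 'b::euclidean_space"
  shows "antideriv u f \<longleftrightarrow> antideriv (\<lambda>t. fst (u t)) (\<lambda>t. fst (f t)) \<and> antideriv (\<lambda>t. snd (u t)) (\<lambda>t. snd (f t))"
    (is "?l \<longleftrightarrow> ?r")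
proof
  assume ?l
  then show ?r
    using antideriv_linear[OF _ bounded_linear_fst] antideriv_linear[OF _ bounded_linear_snd] by metis
next
  assume r: ?r
  have l1: "bounded_linear (\<lambda>x::'a. (x, 0::'b))" "bounded_linear (\<lambda>y::'b. (0::'a, y))"
    by (simp_all add: bounded_linear_Pair bounded_linear_ident bounded_linear_zero)
  have "antideriv (\<lambda>t. (fst (u t), 0) + (0, snd (u t))) (\<lambda>t. (fst (f t), 0) + (0, snd (f t)))"
    using r by (intro antideriv_add antideriv_linear[OF _ l1(1)] antideriv_linear[OF _ l1(2)]) auto
  then show ?l by simp
qed

section \<open>The linear system, its adjoint and the flow of normals\<close>

lemma bilinear_matrix_vector: "bilinear (\<lambda>(A::real^'n^'m) x. A *v x)"
  unfolding bilinear_def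
  by (intro conjI allI linearI)
     (auto simp: matrix_vector_mult_add_rdistrib matrix_vector_right_distrib
       scaleR_matrix_vector_assoc vector_scaleR_matrix_ac matrix_vector_mult_scaleR)

lemma bilinear_neg_transpose_vector: "bilinear (\<lambda>(A::real^'n^'m) x. - (transpose A *v x))"
proof -
  have 1: "linear (\<lambda>x. transpose A *v x)" for A :: "real^'n^'m"
    by (rule matrix_vector_mul_linear)
  have 2: "linear (\<lambda>A::real^'n^'m. transpose A *v x)" for x
  proof -
    have "linear (transpose :: real^'n^'m \<Rightarrow> _)"
      by (intro linearI) (auto simp: transpose_def vec_eq_iff)
    moreover have "linear (\<lambda>A::real^'m^'n. A *v x)"
      using bilinear_matrix_vector unfolding bilinear_def by blast
    ultimately show ?thesis using linear_compose[of transpose "\<lambda>A. A *v x"] by (simp add: o_def)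
  qed
  show ?thesis unfolding bilinear_def
    by (intro conjI allI linear_compose_neg 1 2)
qed

lemma bilinear_matrix_matrix: "bilinear (\<lambda>(A::real^'n^'n) B. A ** (B::real^'n^'n))"
  unfolding bilinear_def
  by (intro conjI allI linearI)
     (auto simp: matrix_matrix_mult_def vec_eq_iff sum.distrib sum_distrib_left algebra_simps)

abbreviation adjoint_field :: "(real \<Rightarrow> real^'n^'n) \<Rightarrow> real \<Rightarrow> real^'n \<Rightarrow> real^'n" where
  "adjoint_field W \<equiv> (\<lambda>t m. - (transpose (W t) *v m))"

definition normal_field :: "(real \<Rightarrow> real^'n^'n) \<Rightarrow> real \<Rightarrow> real^'n \<Rightarrow> real^'n" where
  "normal_field W = (\<lambda>t n. - (transpose (W t) *v n) + (n \<bullet> (transpose (W t) *v n)) *\<^sub>R n)"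

lemma adjoint_exists:
  assumes "locally_integrable W"
  obtains m where "ode_solution (adjoint_field W) m" "m a = c"
  using bilinear_ode_exists[OF bilinear_neg_transpose_vector assms, of "\<lambda>t. 0" a c]
    locally_integrable_continuous[of "\<lambda>t. 0"] by auto

lemma adjoint_unique:
  assumes "locally_integrable W" "ode_solution (adjoint_field W) m" "ode_solution (adjoint_field W) m'"
    "m a = m' a"
  shows "m = m'"
  using bilinear_ode_unique[OF bilinear_neg_transpose_vector assms(1), of "\<lambda>t. 0" m m' a] assms by simp

lemma adjoint_nonzero:
  assumes "locally_integrable W" "ode_solution (adjoint_field W) m" "m a \<noteq> 0"
  shows "m t \<noteq> 0"
proof
  assume "m t = 0"
  moreover have "ode_solution (adjoint_field W) (\<lambda>t. 0)"
    by (simp add: ode_solution_iff_antideriv antideriv_const)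
  ultimately have "m = (\<lambda>t. 0)" using adjoint_unique[OF assms(1,2)] by metis
  then show False using assms(3) by simp
qed

text \<open>Dividing by the norm removes the radial part of \<open>m'\<close>: the derivative of
  \<open>1 / norm (m t)\<close> produces exactly the quadratic term. Hence the nonlinear equation
  has solutions for all times.\<close>

lemma normalized_adjoint:
  assumes W: "locally_integrable W" and m: "ode_solution (adjoint_field W) m" and nz: "\<And>t. m t \<noteq> 0"
  shows "ode_solution (normal_field W) (\<lambda>t. m t /\<^sub>R norm (m t))"
proof -
  define m' where "m' t = - (transpose (W t) *v m t)" for t
  have m1: "antideriv m m'" using m unfolding ode_solution_iff_antideriv m'_def .
  define q where "q t = m t \<bullet> m t" for t
  have q: "antideriv q (\<lambda>t. m' t \<bullet> m t + m t \<bullet> m' t)" unfolding q_def by (intro antideriv_inner m1)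
  have q0: "q t \<in> {0<..}" for t using nz by (simp add: q_def)
  have r: "antideriv (\<lambda>t. inverse (sqrt (q t))) (\<lambda>t. - (inverse (sqrt (q t)) / (2 * q t)) * (m' t \<bullet> m t + m t \<bullet> m' t))"
  proof (rule antideriv_chain[OF q, of "{0<..}"])
    fix x :: real assume "x \<in> {0<..}"
    then have "((\<lambda>x. inverse (sqrt x)) has_real_derivative - (inverse (sqrt x) * (inverse (sqrt x) / 2) * inverse (sqrt x))) (at x)"
      by (auto intro!: derivative_eq_intros)
    moreover have "inverse (sqrt x) * (inverse (sqrt x) / 2) * inverse (sqrt x) = inverse (sqrt x) / (2 * x)"
      using \<open>x \<in> {0<..}\<close> by (simp add: field_simps)
    ultimately show "((\<lambda>x. inverse (sqrt x)) has_real_derivative - (inverse (sqrt x) / (2 * x))) (at x)"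
      by (simp only:)
  next
    show "continuous_on {0<..} (\<lambda>x. - (inverse (sqrt x) / (2 * x)))"
      by (intro continuous_intros) auto
  qed (use q0 in auto)
  have sq: "sqrt (q t) = norm (m t)" "q t = norm (m t) * norm (m t)" for t
    by (simp_all add: q_def norm_eq_sqrt_inner)
  show ?thesis
    unfolding ode_solution_iff_antideriv
  proof (rule antideriv_cong[OF antideriv_scaleR[OF r m1]])
    fix t
    show "inverse (sqrt (q t)) *\<^sub>R m t = m t /\<^sub>R norm (m t)" by (simp add: sq)
    have tr: "transpose (W t) *v (c *\<^sub>R m t) = - (c *\<^sub>R m' t)" for c
      by (simp add: m'_def matrix_vector_mult_scaleR del: transpose_matrix_vector)
    define N where "N = norm (m t)"
    have N: "N > 0" using nz[of t] by (simp add: N_def)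
    show "(- (inverse (sqrt (q t)) / (2 * q t)) * (m' t \<bullet> m t + m t \<bullet> m' t)) *\<^sub>R m t + inverse (sqrt (q t)) *\<^sub>R m' t
      = normal_field W t (m t /\<^sub>R norm (m t))"
      unfolding normal_field_def tr sq N_def[symmetric] using N
      by (simp add: inner_commute field_simps)
  qed
qed

text \<open>Between two curves on the unit sphere the quadratic field satisfies a Lipschitz estimate
  with a locally integrable constant, and the Gronwall argument applies.\<close>

lemma normal_field_unique:
  fixes W :: "real \<Rightarrow> real^'n^'n"
  assumes W: "locally_integrable W"
    and n: "ode_solution (normal_field W) n" "\<And>t. norm (n t) = 1"
    and n': "ode_solution (normal_field W) n'" "\<And>t. norm (n' t) = 1" and eq: "n a = n' a"
  shows "n = n'"
proof -
  obtain B where B: "B > 0" "\<And>(A::real^'n^'n) x. norm (- (transpose A *v x)) \<le> B * norm A * norm x"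
    using bilinear_bounded_pos[OF bilinear_neg_transpose_vector] by metis
  have B2: "norm (transpose A *v x) \<le> B * norm A * norm x" for A :: "real^'n^'n" and x
    using B(2)[of A x] by (simp del: transpose_matrix_vector)
  have k: "locally_integrable (\<lambda>t. 4 * B * norm (W t))"
    by (intro locally_integrable_linear[OF locally_integrable_norm[OF W]] bounded_linear_mult_right)
  show ?thesis
  proof (rule ode_solution_unique[OF n(1) n'(1) k _ eq])
    fix t
    define T where "T x = transpose (W t) *v x" for x
    define d where "d = n t - n' t"
    define C where "C = B * norm (W t)"
    have Tl: "T d = T (n t) - T (n' t)" by (simp add: T_def d_def matrix_vector_mult_diff_distrib del: transpose_matrix_vector)
    have TC: "norm (T x) \<le> C * norm x" for x unfolding T_def C_def by (rule B2)
    have ip: "\<bar>x \<bullet> T y\<bar> \<le> norm x * (C * norm y)" for x y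
      using Cauchy_Schwarz_ineq2[of x "T y"] mult_left_mono[OF TC[of y] norm_ge_zero[of x]] by linarith
    \<comment> \<open>The difference of the trilinear terms is telescoped, one factor changing at a
      time; together with the linear term this gives four summands and the factor 4.\<close>
    have "normal_field W t (n t) - normal_field W t (n' t)
        = - T d + ((d \<bullet> T (n t)) *\<^sub>R n t + ((n' t \<bullet> T d) *\<^sub>R n t + (n' t \<bullet> T (n' t)) *\<^sub>R d))"
      unfolding normal_field_def T_def[symmetric] Tl
      by (simp add: d_def inner_diff_left inner_diff_right scaleR_diff_left scaleR_diff_right)
    also have "norm \<dots> \<le> norm (- T d) + (norm ((d \<bullet> T (n t)) *\<^sub>R n t)
        + (norm ((n' t \<bullet> T d) *\<^sub>R n t) + norm ((n' t \<bullet> T (n' t)) *\<^sub>R d)))"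
      by (meson add_left_mono norm_triangle_ineq order_trans)
    also have "\<dots> \<le> C * norm d + (C * norm d + (C * norm d + C * norm d))"
    proof (intro add_mono)
      show "norm (- T d) \<le> C * norm d" using TC by simp
      show "norm ((d \<bullet> T (n t)) *\<^sub>R n t) \<le> C * norm d" "norm ((n' t \<bullet> T d) *\<^sub>R n t) \<le> C * norm d"
        using ip[of d "n t"] ip[of "n' t" d] by (simp_all add: n n' mult.commute)
      show "norm ((n' t \<bullet> T (n' t)) *\<^sub>R d) \<le> C * norm d"
        using ip[of "n' t" "n' t"] by (simp add: n' mult_right_mono)
    qed
    finally show "norm (normal_field W t (n t) - normal_field W t (n' t)) \<le> 4 * B * norm (W t) * norm (n t - n' t)"
      by (simp add: C_def d_def algebra_simps)
  qed
qed

lemma normal_field_solution: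
  assumes W: "locally_integrable W" and "norm v = 1"
  obtains m n where "ode_solution (adjoint_field W) m" "m a = v" "\<And>t. m t \<noteq> 0"
    "ode_solution (normal_field W) n" "\<And>t. norm (n t) = 1" "\<And>t. m t = norm (m t) *\<^sub>R n t" "n a = v"
proof -
  obtain m where m: "ode_solution (adjoint_field W) m" "m a = v" using adjoint_exists[OF W] by metis
  have nz: "m t \<noteq> 0" for t
    using adjoint_nonzero[OF W m(1), of a] m(2) \<open>norm v = 1\<close> by force
  show thesis
    by (rule that[OF m nz normalized_adjoint[OF W m(1) nz]]) (use nz m \<open>norm v = 1\<close> in auto)
qed

text \<open>By uniqueness every unit solution of the normal equation is a normalized adjoint
  solution, so estimates can be made on the linear equation.\<close>

lemma normal_field_adjoint:
  assumes W: "locally_integrable W" and n: "ode_solution (normal_field W) n" "\<And>t. norm (n t) = 1"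
  obtains m where "ode_solution (adjoint_field W) m" "m a = n a" "\<And>t. m t \<noteq> 0"
    "\<And>t. m t = norm (m t) *\<^sub>R n t"
  using normal_field_solution[OF W n(2)[of a], of a] normal_field_unique[OF W _ _ n, of _ a] by metis

section \<open>Controlled trajectories of an exponentially stable system\<close>

lemma locally_integrable_bounded:
  fixes f :: "real \<Rightarrow> 'a::euclidean_space"
  assumes "f \<in> borel_measurable lebesgue" "\<And>t. norm (f t) \<le> c"
  shows "locally_integrable f"
  unfolding locally_integrable_def
proof (intro allI)
  fix a b
  show "f absolutely_integrable_on {a..b}"
    by (rule measurable_bounded_by_integrable_imp_absolutely_integrable[where g = "\<lambda>t. c"])
       (auto intro: measurable_restrict_space1 assms)
qed

text \<open>The two occurrences of \<open>W\<close> cancel by transposition and only the forcing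
  remains. The decay of the adjoint, the variation of constants estimate and the maximum property of
  boundary trajectories all rest on this identity.\<close>

lemma antideriv_adjoint_inner:
  assumes m: "ode_solution (adjoint_field W) m" and z: "antideriv z (\<lambda>t. W t *v z t + b t)"
  shows "antideriv (\<lambda>t. m t \<bullet> z t) (\<lambda>t. m t \<bullet> b t)"
  by (rule antideriv_cong[OF antideriv_inner[OF m[unfolded ode_solution_iff_antideriv] z]])
     (simp_all add: inner_add_right dot_lmul_matrix)

text \<open>The bound on the control holds at all times rather than almost all, which spares
  exceptional sets; \<open>reach_eq_control_reach\<close> shows that the reachable sets are the
  same.\<close>

definition control_solution ::
  "(real \<Rightarrow> real^'n^'n) \<Rightarrow> real \<Rightarrow> (real \<Rightarrow> real^'n) \<Rightarrow> (real \<Rightarrow> real^'n) \<Rightarrow> bool" where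
  "control_solution W \<rho> \<xi> x \<longleftrightarrow> \<xi> \<in> borel_measurable lebesgue \<and> (\<forall>t. norm (\<xi> t) \<le> 1) \<and>
     ode_solution (\<lambda>t y. W t *v y + \<rho> *\<^sub>R \<xi> t) x"

definition control_reach ::
  "(real \<Rightarrow> real^'n^'n) \<Rightarrow> real \<Rightarrow> real \<Rightarrow> real \<Rightarrow> (real^'n) set \<Rightarrow> (real^'n) set" where
  "control_reach W \<rho> t s M = {x t | x \<xi>. control_solution W \<rho> \<xi> x \<and> x s \<in> M}"

definition boundary_solution ::
  "(real \<Rightarrow> real^'n^'n) \<Rightarrow> real \<Rightarrow> (real \<Rightarrow> real^'n) \<Rightarrow> (real \<Rightarrow> real^'n) \<Rightarrow> bool" where
  "boundary_solution W \<rho> x n \<longleftrightarrow> ode_solution (normal_field W) n \<and> (\<forall>t. norm (n t) = 1) \<and>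
     ode_solution (\<lambda>t y. W t *v y + \<rho> *\<^sub>R n t) x"

lemma boundary_solution_imp_control_solution:
  assumes "boundary_solution W \<rho> x n"
  shows "control_solution W \<rho> n x"
proof -
  have "continuous_on UNIV n"
    using assms antideriv_continuous ode_solution_iff_antideriv unfolding boundary_solution_def by blast
  then have "n \<in> borel_measurable lebesgue"
    by (simp add: borel_measurable_continuous_onI measurable_completion)
  then show ?thesis using assms by (simp add: boundary_solution_def control_solution_def)
qed

text \<open>The decay is stated for solutions and not for the principal matrix because this is the
  form in which it is carried over to the hull.\<close>

locale stable_system =
  fixes W :: "real \<Rightarrow> real^'n^'n" and \<rho> K \<gamma> :: real
  assumes W: "locally_integrable W" and \<rho>: "\<rho> > 0" and K: "K \<ge> 1" and \<gamma>: "\<gamma> > 0"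
    and decay: "\<And>x s t. ode_solution (\<lambda>t y. W t *v y) x \<Longrightarrow> s \<le> t \<Longrightarrow>
      norm (x t) \<le> K * exp (- \<gamma> * (t - s)) * norm (x s)"
begin

text \<open>The integral of \<open>K * exp (- \<gamma> * s) * \<rho>\<close> over
  \<open>s \<ge> 0\<close>: what remains of the bound on a trajectory when the initial time recedes
  to minus infinity.\<close>

definition "R = \<rho> * K / \<gamma>"

lemma R_pos: "R > 0" using \<rho> K \<gamma> by (simp add: R_def)

lemma decay_at_bot: "((\<lambda>s. K * exp (- \<gamma> * (t - s)) * C) \<longlongrightarrow> 0) at_bot"
proof -
  have "filterlim (\<lambda>s. - (\<gamma> * t) + \<gamma> * s) at_bot at_bot"
    by (simp only: filterlim_tendsto_add_at_bot_iff[OF tendsto_const]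
        filterlim_tendsto_pos_mult_at_bot_iff[OF tendsto_const \<gamma>] filterlim_ident)
  then have "((\<lambda>s. exp (- (\<gamma> * t) + \<gamma> * s)) \<longlongrightarrow> 0) at_bot"
    by (rule filterlim_compose[OF exp_at_bot])
  then have "((\<lambda>s. K * exp (- (\<gamma> * t) + \<gamma> * s) * C) \<longlongrightarrow> K * 0 * C) at_bot"
    by (intro tendsto_intros)
  then show ?thesis by (simp add: algebra_simps)
qed

lemma decay_at_top: "((\<lambda>t. K * exp (- \<gamma> * (t - s)) * C) \<longlongrightarrow> 0) at_top"
proof -
  have "((\<lambda>t. K * exp (- \<gamma> * (- s - (- t))) * C) \<longlongrightarrow> 0) at_top"
    by (rule filterlim_compose[OF decay_at_bot filterlim_uminus_at_bot_at_top])
  then show ?thesis by (simp add: algebra_simps)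
qed

lemma decay_factor_le: "s \<le> t \<Longrightarrow> K * exp (- \<gamma> * (t - s)) \<le> K"
  using K \<gamma> by (simp add: mult_le_cancel_left1 mult_left_le)

text \<open>Expresses that the influence of the initial state disappears as the initial time tends
  to minus infinity.\<close>

lemma le_of_le_decay:
  assumes "\<And>s. s \<le> b \<Longrightarrow> x \<le> K * exp (- \<gamma> * (t - s)) * C + y"
  shows "x \<le> y"
proof -
  have "((\<lambda>s. K * exp (- \<gamma> * (t - s)) * C + y) \<longlongrightarrow> 0 + y) at_bot"
    by (intro tendsto_add decay_at_bot tendsto_const)
  then have "x \<le> 0 + y"
    by (rule tendsto_lowerbound) (use assms in \<open>auto simp: eventually_at_bot_linorder\<close>)
  then show ?thesis by simp
qed

text \<open>Duality: start a homogeneous solution \<open>x\<close> at time \<open>r\<close> in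
  \<open>m r\<close>. The product \<open>m \<bullet> x\<close> is constant, so the square of
  \<open>norm (m r)\<close> equals \<open>m t \<bullet> x t\<close>, which the decay of
  \<open>x\<close> bounds.\<close>

lemma adjoint_decay:
  assumes m: "ode_solution (adjoint_field W) m" and "r \<le> t"
  shows "norm (m r) \<le> K * exp (- \<gamma> * (t - r)) * norm (m t)"
proof (cases "m r = 0")
  case True
  then show ?thesis using K by simp
next
  case False
  obtain x where x: "ode_solution (\<lambda>t y. W t *v y + 0) x" "x r = m r"
    using bilinear_ode_exists[OF bilinear_matrix_vector W, of "\<lambda>t. 0" r "m r"]
      locally_integrable_continuous[of "\<lambda>t. 0"] by auto
  have "antideriv (\<lambda>t. m t \<bullet> x t) (\<lambda>t. m t \<bullet> 0)"
    by (rule antideriv_adjoint_inner[OF m x(1)[unfolded ode_solution_iff_antideriv]])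
  then have "m r \<bullet> x r = m t \<bullet> x t" using antideriv_eq_const[of "\<lambda>t. m t \<bullet> x t" r t] by simp
  then have "norm (m r) * norm (m r) = m t \<bullet> x t"
    by (simp add: x power2_norm_eq_inner[symmetric] power2_eq_square)
  also have "\<dots> \<le> norm (m t) * norm (x t)" by (rule norm_cauchy_schwarz)
  also have "\<dots> \<le> norm (m t) * (K * exp (- \<gamma> * (t - r)) * norm (x r))"
    using decay[of x r t] x \<open>r \<le> t\<close> by (intro mult_left_mono) auto
  finally have "norm (m r) * norm (m r) \<le> (K * exp (- \<gamma> * (t - r)) * norm (m t)) * norm (m r)"
    by (simp add: x algebra_simps)
  then show ?thesis using False by (simp add: mult_le_cancel_right)
qed

text \<open>Variation of constants without a fundamental matrix: the adjoint solution that ends in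
  \<open>z t\<close> turns \<open>z t \<bullet> z t\<close> into \<open>m s \<bullet> z s\<close>
  plus the integral of \<open>m \<bullet> b\<close>. The primitive \<open>\<beta>\<close> is left
  open so that constant and integrable bounds on the forcing can both be inserted.\<close>

lemma forced_bound_aux:
  assumes z: "antideriv z (\<lambda>t. W t *v z t + b t)" and st: "s \<le> t"
    and \<beta>: "antideriv \<beta> (\<lambda>r. K * exp (- \<gamma> * (t - r)) * c r)"
    and b: "\<And>r. norm (b r) \<le> c r"
  shows "norm (z t) \<le> K * exp (- \<gamma> * (t - s)) * norm (z s) + (\<beta> t - \<beta> s)"
proof -
  obtain m where m: "ode_solution (adjoint_field W) m" "m t = z t" using adjoint_exists[OF W] by metis
  have Q: "antideriv (\<lambda>t. m t \<bullet> z t) (\<lambda>t. m t \<bullet> b t)" by (rule antideriv_adjoint_inner[OF m(1) z])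
  have B: "antideriv (\<lambda>r. norm (z t) *\<^sub>R \<beta> r) (\<lambda>r. norm (z t) *\<^sub>R (K * exp (- \<gamma> * (t - r)) * c r))"
    by (rule antideriv_scaleR_left[OF \<beta>])
  have md: "norm (m r) \<le> K * exp (- \<gamma> * (t - r)) * norm (z t)" if "r \<le> t" for r
    using adjoint_decay[OF m(1) that] m(2) by simp
  have "norm (m t \<bullet> z t - m s \<bullet> z s) \<le> norm (z t) *\<^sub>R \<beta> t - norm (z t) *\<^sub>R \<beta> s"
  proof (rule antideriv_norm_le[OF Q B st])
    fix r assume "r \<le> t"
    have "norm (m r \<bullet> b r) \<le> norm (m r) * norm (b r)" by (simp add: Cauchy_Schwarz_ineq2)
    also have "\<dots> \<le> (K * exp (- \<gamma> * (t - r)) * norm (z t)) * c r"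
      using md[OF \<open>r \<le> t\<close>] b K by (intro mult_mono) auto
    finally show "norm (m r \<bullet> b r) \<le> norm (z t) *\<^sub>R (K * exp (- \<gamma> * (t - r)) * c r)"
      by (simp add: mult.commute mult.left_commute)
  qed
  then have "z t \<bullet> z t \<le> m s \<bullet> z s + norm (z t) * (\<beta> t - \<beta> s)"
    by (simp add: m(2) right_diff_distrib abs_le_iff)
  moreover have "m s \<bullet> z s \<le> norm (m s) * norm (z s)" by (rule norm_cauchy_schwarz)
  moreover have "norm (m s) * norm (z s) \<le> (K * exp (- \<gamma> * (t - s)) * norm (z t)) * norm (z s)"
    using md[OF st] by (intro mult_right_mono) auto
  ultimately have "norm (z t) * norm (z t) \<le>
      norm (z t) * (K * exp (- \<gamma> * (t - s)) * norm (z s) + (\<beta> t - \<beta> s))"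
    by (simp add: power2_norm_eq_inner[symmetric] power2_eq_square algebra_simps)
  moreover have "0 \<le> \<beta> t - \<beta> s"
    using antideriv_mono[OF antideriv_const \<beta> st, of 0] K b norm_ge_zero order_trans
    by (smt (verit, best) exp_ge_zero mult_nonneg_nonneg)
  ultimately show ?thesis using K by (cases "z t = 0") (auto simp: mult_le_cancel_left)
qed

lemma forced_bound:
  assumes z: "antideriv z (\<lambda>t. W t *v z t + b t)" and b: "\<And>r. norm (b r) \<le> c" and st: "s \<le> t"
  shows "norm (z t) \<le> K * exp (- \<gamma> * (t - s)) * norm (z s) + c * K / \<gamma>"
proof -
  have "antideriv (\<lambda>r::real. r - t) (\<lambda>r. 1)"
    by (simp add: antideriv_def locally_integrable_continuous)
  then have "antideriv (\<lambda>r. (c * K / \<gamma>) *\<^sub>R exp (\<gamma> * (r - t)))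
      (\<lambda>r. (c * K / \<gamma>) *\<^sub>R (\<gamma> * exp (\<gamma> * (r - t)) * 1))"
    by (intro antideriv_scaleR_left antideriv_exp)
  moreover have "\<gamma> * (r - t) = - \<gamma> * (t - r)" for r by (simp add: algebra_simps)
  ultimately have \<beta>: "antideriv (\<lambda>r. c * K / \<gamma> * exp (- \<gamma> * (t - r))) (\<lambda>r. K * exp (- \<gamma> * (t - r)) * c)"
    using \<gamma> by (simp add: ac_simps)
  have "c \<ge> 0" using b norm_ge_zero order_trans by blast
  then have "0 \<le> c * K / \<gamma> * exp (- \<gamma> * (t - s))" using K \<gamma> by simp
  then show ?thesis using forced_bound_aux[OF z st \<beta> b] by simp
qed

text \<open>Meant for two trajectories whose controls are close in the mean but not uniformly: the
  exponential weight is given up, and the forcing enters through the integral of its norm.\<close>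

lemma forced_bound_primitive:
  assumes z: "antideriv z (\<lambda>t. W t *v z t + b t)" and \<beta>: "antideriv \<beta> (\<lambda>t. norm (b t))" and st: "s \<le> t"
  shows "norm (z t) \<le> K * exp (- \<gamma> * (t - s)) * norm (z s) + K * (\<beta> t - \<beta> s)"
proof -
  have "continuous_on UNIV (\<lambda>r. K * exp (- \<gamma> * (t - r)))" by (intro continuous_intros)
  then have "locally_integrable (\<lambda>r. K * exp (- \<gamma> * (t - r)) * norm (b r))"
    by (rule locally_integrable_mult) (use \<beta> antideriv_def in blast)
  then obtain \<beta>' where \<beta>': "antideriv \<beta>' (\<lambda>r. K * exp (- \<gamma> * (t - r)) * norm (b r))"
    using antideriv_exists by metis
  have "\<beta>' t - \<beta>' s \<le> K *\<^sub>R \<beta> t - K *\<^sub>R \<beta> s"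
    by (rule antideriv_mono[OF \<beta>' antideriv_scaleR_left[OF \<beta>] st])
       (use decay_factor_le in \<open>simp add: mult_right_mono\<close>)
  then show ?thesis using forced_bound_aux[OF z st \<beta>' order_refl] by (simp add: right_diff_distrib)
qed

lemma control_solution_exists:
  assumes "\<xi> \<in> borel_measurable lebesgue" "\<And>t. norm (\<xi> t) \<le> 1"
  obtains x where "control_solution W \<rho> \<xi> x" "x a = c"
proof -
  have "locally_integrable \<xi>" by (rule locally_integrable_bounded[OF assms])
  then have "locally_integrable (\<lambda>t. \<rho> *\<^sub>R \<xi> t)"
    by (rule locally_integrable_linear[OF _ bounded_linear_scaleR_right])
  from bilinear_ode_exists[OF bilinear_matrix_vector W this, of a c]
  obtain x where "ode_solution (\<lambda>t y. W t *v y + \<rho> *\<^sub>R \<xi> t) x" "x a = c" by blast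
  then show thesis using that assms by (simp add: control_solution_def)
qed

lemma control_solution_diff:
  assumes "control_solution W \<rho> \<xi> x" "control_solution W \<rho> \<eta> y"
  shows "antideriv (\<lambda>t. x t - y t) (\<lambda>t. W t *v (x t - y t) + \<rho> *\<^sub>R (\<xi> t - \<eta> t))"
proof -
  have "antideriv x (\<lambda>t. W t *v x t + \<rho> *\<^sub>R \<xi> t)" "antideriv y (\<lambda>t. W t *v y t + \<rho> *\<^sub>R \<eta> t)"
    using assms by (simp_all only: control_solution_def ode_solution_iff_antideriv)
  from antideriv_diff[OF this] show ?thesis
    by (rule antideriv_cong) (simp_all add: matrix_vector_mult_diff_distrib scaleR_diff_right)
qed

lemma control_solution_decay:
  assumes "control_solution W \<rho> \<xi> x" "control_solution W \<rho> \<xi> y" "s \<le> t"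
  shows "norm (x t - y t) \<le> K * exp (- \<gamma> * (t - s)) * norm (x s - y s)"
  using decay[of "\<lambda>t. x t - y t"] control_solution_diff[OF assms(1,2)] assms(3)
  by (simp add: ode_solution_iff_antideriv)

lemma control_solution_bound:
  assumes "control_solution W \<rho> \<xi> x" "s \<le> t"
  shows "norm (x t) \<le> K * exp (- \<gamma> * (t - s)) * norm (x s) + R"
  unfolding R_def
  by (rule forced_bound[where b = "\<lambda>t. \<rho> *\<^sub>R \<xi> t"])
     (use assms \<rho> in \<open>auto simp: control_solution_def ode_solution_iff_antideriv\<close>)

text \<open>A bounded past already forces the bound \<open>R\<close> at all times, so membership in
  \<open>entire\<close> can be checked on any left half-line.\<close>

lemma control_solution_backward_bounded:
  assumes x: "control_solution W \<rho> \<xi> x" and "\<And>t. t \<le> a \<Longrightarrow> norm (x t) \<le> M"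
  shows "norm (x t) \<le> R"
proof (rule le_of_le_decay[where b = "min a t"])
  fix s assume "s \<le> min a t"
  then have "norm (x t) \<le> K * exp (- \<gamma> * (t - s)) * norm (x s) + R" "norm (x s) \<le> M"
    using control_solution_bound[OF x] assms(2) by auto
  then show "norm (x t) \<le> K * exp (- \<gamma> * (t - s)) * M + R"
    using K by (smt (verit) exp_ge_zero mult_left_mono mult_nonneg_nonneg)
qed

section \<open>Bounded entire trajectories\<close>

definition entire :: "(real \<Rightarrow> real^'n) \<Rightarrow> (real \<Rightarrow> real^'n) \<Rightarrow> bool" where
  "entire \<xi> x \<longleftrightarrow> control_solution W \<rho> \<xi> x \<and> (\<forall>t. norm (x t) \<le> R)"

definition attr :: "real \<Rightarrow> (real^'n) set" where
  "attr t = {x t | x \<xi>. entire \<xi> x}"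

text \<open>The bounded entire trajectory of a control is the limit of the trajectories that start at
  the origin at time \<open>-k\<close>.\<close>

lemma entire_exists:
  assumes \<xi>: "\<xi> \<in> borel_measurable lebesgue" "\<And>t. norm (\<xi> t) \<le> 1"
  obtains x where "entire \<xi> x"
proof -
  have "\<forall>k::nat. \<exists>x. control_solution W \<rho> \<xi> x \<and> x (- real k) = 0"
    using control_solution_exists[OF \<xi>] by metis
  then obtain x where x: "\<And>k. control_solution W \<rho> \<xi> (x k)" "\<And>k. x k (- real k) = 0" by metis
  have xR: "norm (x k t) \<le> R" if "- real k \<le> t" for k t
    using control_solution_bound[OF x(1)[of k] that] by (simp add: x(2))
  \<comment> \<open>At time \<open>- k\<close> the trajectory \<open>x k\<close> is at the origin,
    while \<open>x j\<close>, started earlier, is within \<open>R\<close> of it.\<close>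
  have d: "norm (x j t - x k t) \<le> K * exp (- \<gamma> * (t - (- real k))) * R"
    if "k \<le> j" "- real k \<le> t" for j k t
  proof -
    have "norm (x j t - x k t) \<le> K * exp (- \<gamma> * (t - (- real k))) * norm (x j (- real k) - x k (- real k))"
      by (rule control_solution_decay[OF x(1) x(1) that(2)])
    also have "\<dots> \<le> K * exp (- \<gamma> * (t - (- real k))) * R"
      using xR[of j "- real k"] that K by (intro mult_left_mono) (auto simp: x(2))
    finally show ?thesis .
  qed
  define X where "X t = lim (\<lambda>k. x k t)" for t
  have "Cauchy (\<lambda>k. x k t)" for t
  proof (rule metric_CauchyI)
    fix e :: real assume e: "e > 0"
    have "((\<lambda>k. K * exp (- \<gamma> * (t - (- real k))) * R) \<longlongrightarrow> 0) sequentially"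
      by (rule filterlim_compose[OF decay_at_bot])
         (intro filterlim_compose[OF filterlim_uminus_at_bot_at_top] filterlim_real_sequentially)
    then have "\<forall>\<^sub>F k in sequentially. K * exp (- \<gamma> * (t - (- real k))) * R < e / 2"
      by (rule order_tendstoD) (use e in simp)
    moreover have "\<forall>\<^sub>F k in sequentially. - real k \<le> t"
      by (rule eventually_mono[OF eventually_ge_at_top[of "nat \<lceil>- t\<rceil>"]]) linarith
    ultimately obtain N where N: "K * exp (- \<gamma> * (t - (- real N))) * R < e / 2" "- real N \<le> t"
      using eventually_conj eventually_sequentially by (metis (mono_tags, lifting) order_refl)
    show "\<exists>M. \<forall>m\<ge>M. \<forall>n\<ge>M. dist (x m t) (x n t) < e"
    proof (intro exI allI impI)
      fix m n assume "N \<le> m" "N \<le> n"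
      then have "dist (x m t) (x N t) < e / 2" "dist (x n t) (x N t) < e / 2"
        using d[of N m t] d[of N n t] N by (auto simp: dist_norm)
      then show "dist (x m t) (x n t) < e"
        by (rule dist_triangle_half_l)
    qed
  qed
  then have X: "(\<lambda>k. x k t) \<longlonglongrightarrow> X t" for t
    unfolding X_def convergent_LIMSEQ_iff[symmetric] Cauchy_convergent_iff[symmetric] .
  \<comment> \<open>From any time \<open>s\<close> on the limit agrees with the true solution
    through \<open>X s\<close>: the distance of \<open>x k\<close> to that solution is controlled by
    the distance at \<open>s\<close>, which tends to 0.\<close>
  have "ode_solution (\<lambda>t y. W t *v y + \<rho> *\<^sub>R \<xi> t) X"
  proof (rule ode_solution_eq_on_right)
    fix s
    obtain y where y: "control_solution W \<rho> \<xi> y" "y s = X s" using control_solution_exists[OF \<xi>] by metis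
    have "y t = X t" if "s \<le> t" for t
    proof -
      have lim0: "(\<lambda>k. K * exp (- \<gamma> * (t - s)) * norm (x k s - y s)) \<longlonglongrightarrow> K * exp (- \<gamma> * (t - s)) * norm (X s - y s)"
        by (intro tendsto_intros X)
      have "(\<lambda>k. x k t - y t) \<longlonglongrightarrow> 0"
        by (rule Lim_null_comparison[OF _ lim0[unfolded y(2) diff_self norm_zero mult_zero_right, folded y(2)]])
           (simp add: control_solution_decay[OF x(1) y(1) that, simplified])
      then have "(\<lambda>k. x k t) \<longlonglongrightarrow> y t" by (simp add: LIM_zero_cancel)
      then show ?thesis using X LIMSEQ_unique by blast
    qed
    then show "\<exists>y. ode_solution (\<lambda>t y. W t *v y + \<rho> *\<^sub>R \<xi> t) y \<and> (\<forall>t\<ge>s. y t = X t)"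
      using y control_solution_def by blast
  qed
  moreover have "norm (X t) \<le> R" for t
  proof (rule tendsto_upperbound[OF tendsto_norm[OF X[of t]]])
    show "\<forall>\<^sub>F k in sequentially. norm (x k t) \<le> R"
      by (rule eventually_mono[OF eventually_ge_at_top[of "nat \<lceil>- t\<rceil>"]]) (rule xR, linarith)
  qed simp
  ultimately have "entire \<xi> X" using \<xi> by (simp add: entire_def control_solution_def)
  then show thesis by (rule that)
qed

text \<open>Only the past decides about boundedness, so a bounded entire trajectory may be continued
  with any control. This yields the forward invariance of the fibres.\<close>

lemma entire_concat:
  assumes x: "entire \<xi> x" and y: "control_solution W \<rho> \<eta> y" and eq: "x a = y a"
  obtains \<zeta> z where "entire \<zeta> z" "\<And>t. t \<le> a \<Longrightarrow> z t = x t" "\<And>t. a \<le> t \<Longrightarrow> z t = y t"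
proof -
  define \<zeta> where "\<zeta> t = (if t \<le> a then \<xi> t else \<eta> t)" for t
  define z where "z t = (if t \<le> a then x t else y t)" for t
  have f: "(\<lambda>t. if t \<le> a then \<lambda>y. W t *v y + \<rho> *\<^sub>R \<xi> t else (\<lambda>y. W t *v y + \<rho> *\<^sub>R \<eta> t))
      = (\<lambda>t y. W t *v y + \<rho> *\<^sub>R \<zeta> t)" by (auto simp: \<zeta>_def fun_eq_iff)
  have "ode_solution (\<lambda>t y. W t *v y + \<rho> *\<^sub>R \<zeta> t) z"
    unfolding z_def f[symmetric]
    by (rule ode_solution_concat) (use assms in \<open>auto simp: entire_def control_solution_def\<close>)
  moreover have "\<zeta> \<in> borel_measurable lebesgue"
    unfolding \<zeta>_def using x y
    by (intro measurable_If) (auto simp: entire_def control_solution_def)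
  ultimately have z: "control_solution W \<rho> \<zeta> z"
    using x y by (simp add: entire_def control_solution_def \<zeta>_def)
  moreover have "norm (z t) \<le> R" if "t \<le> a" for t using that x by (simp add: z_def entire_def)
  ultimately have "entire \<zeta> z"
    unfolding entire_def using control_solution_backward_bounded by blast
  then show thesis by (rule that) (use eq in \<open>auto simp: z_def\<close>)
qed

end

section \<open>Invariance, convexity and compactness of the fibres\<close>

context stable_system
begin

lemma attr_le_R: "y \<in> attr t \<Longrightarrow> norm y \<le> R"
  by (auto simp: attr_def entire_def)

lemma attr_nonempty: "attr t \<noteq> {}"
proof -
  obtain x where "entire (\<lambda>t. 0) x" by (rule entire_exists[of "\<lambda>t. 0"]) auto
  then show ?thesis by (auto simp: attr_def)
qed

lemma control_reach_attr:
  assumes "s \<le> t"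
  shows "control_reach W \<rho> t s (attr s) = attr t"
proof (intro equalityI subsetI)
  fix p assume "p \<in> control_reach W \<rho> t s (attr s)"
  then obtain y \<eta> where y: "control_solution W \<rho> \<eta> y" "y s \<in> attr s" "p = y t"
    by (auto simp: control_reach_def)
  then obtain x \<xi> where x: "entire \<xi> x" "y s = x s" by (auto simp: attr_def)
  obtain \<zeta> z where "entire \<zeta> z" "z t = y t" using entire_concat[OF x(1) y(1) x(2)[symmetric]] assms by metis
  then show "p \<in> attr t" using y by (auto simp: attr_def intro: exI[of _ z])
next
  fix p assume "p \<in> attr t"
  then show "p \<in> control_reach W \<rho> t s (attr s)"
    unfolding attr_def control_reach_def entire_def by blast
qed

text \<open>The nearby point is obtained with the same control, started in \<open>A\<close> at time
  \<open>s\<close>.\<close>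

lemma control_reach_near:
  assumes y: "p \<in> control_reach W \<rho> t s C" and C: "\<And>c. c \<in> C \<Longrightarrow> norm c \<le> M"
    and A: "\<And>c. c \<in> A \<Longrightarrow> norm c \<le> M'" "A \<noteq> {}" and st: "s \<le> t"
  obtains q where "q \<in> control_reach W \<rho> t s A" "dist p q \<le> K * exp (- \<gamma> * (t - s)) * (M + M')"
proof -
  obtain x \<xi> where x: "control_solution W \<rho> \<xi> x" "x s \<in> C" "p = x t"
    using y by (auto simp: control_reach_def)
  obtain a where a: "a \<in> A" using A by auto
  obtain z where z: "control_solution W \<rho> \<xi> z" "z s = a"
    by (rule control_solution_exists[of \<xi> s a]) (use x(1) in \<open>auto simp: control_solution_def\<close>)
  have "norm (x t - z t) \<le> K * exp (- \<gamma> * (t - s)) * norm (x s - z s)"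
    by (rule control_solution_decay[OF x(1) z(1) st])
  also have "norm (x s - z s) \<le> M + M'"
    using C[OF x(2)] A(1)[OF a] z(2) norm_triangle_ineq4[of "x s" "z s"] by auto
  finally have "dist p (z t) \<le> K * exp (- \<gamma> * (t - s)) * (M + M')"
    using K x(3) by (simp add: dist_norm mult_left_mono)
  moreover have "z t \<in> control_reach W \<rho> t s A" using z a by (auto simp: control_reach_def)
  ultimately show thesis by (rule that[rotated])
qed

text \<open>A point of \<open>A t\<close> is reached from \<open>A s\<close> for every earlier
  \<open>s\<close>; the same control started in \<open>C s\<close> ends in \<open>C t\<close> at a
  distance that vanishes as \<open>s\<close> recedes. Minimality and uniqueness of the uniform
  attractor both follow from this.\<close>

lemma invariant_subset:
  assumes A: "\<And>s t. s < t \<Longrightarrow> control_reach W \<rho> t s (A s) = A t" "\<And>t c. c \<in> A t \<Longrightarrow> norm c \<le> M"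
    and C: "\<And>s t. s < t \<Longrightarrow> control_reach W \<rho> t s (C s) = C t" "\<And>t c. c \<in> C t \<Longrightarrow> norm c \<le> M'"
      "\<And>t. C t \<noteq> {}" "\<And>t. closed (C t)"
  shows "A t \<subseteq> C t"
proof
  fix p assume p: "p \<in> A t"
  have "infdist p (C t) \<le> 0"
  proof (rule le_of_le_decay)
    fix s assume "s \<le> t - 1"
    then have st: "s < t" by simp
    obtain q where "q \<in> control_reach W \<rho> t s (C s)" "dist p q \<le> K * exp (- \<gamma> * (t - s)) * (M + M')"
      by (rule control_reach_near[of p t s "A s" M "C s" M'])
         (use A(1)[OF st] A(2) C(2,3) st p in auto)
    then show "infdist p (C t) \<le> K * exp (- \<gamma> * (t - s)) * (M + M') + 0"
      using C(1)[OF st] infdist_le2 by auto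
  qed
  then have "infdist p (C t) = 0" using infdist_nonneg[of p "C t"] by simp
  then show "p \<in> C t" using C(3,4) in_closed_iff_infdist_zero by blast
qed

text \<open>The equation is linear in the pair of state and control, and the bounds on both are
  convex conditions.\<close>

lemma convex_attr: "convex (attr t)"
proof (rule convexI)
  fix p q and u v :: real assume pq: "p \<in> attr t" "q \<in> attr t" and uv: "0 \<le> u" "0 \<le> v" "u + v = 1"
  obtain x \<xi> y \<eta> where x: "entire \<xi> x" "p = x t" and y: "entire \<eta> y" "q = y t"
    using pq by (auto simp: attr_def)
  define \<zeta> where "\<zeta> t = u *\<^sub>R \<xi> t + v *\<^sub>R \<eta> t" for t
  define z where "z t = u *\<^sub>R x t + v *\<^sub>R y t" for t
  have le: "norm (u *\<^sub>R a + v *\<^sub>R b) \<le> c" if "norm a \<le> c" "norm b \<le> c" for a b :: "real^'n" and c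
    by (metis that uv convex_cball convexD mem_cball_0)
  have "antideriv x (\<lambda>t. W t *v x t + \<rho> *\<^sub>R \<xi> t)" "antideriv y (\<lambda>t. W t *v y t + \<rho> *\<^sub>R \<eta> t)"
    using x y by (simp_all only: entire_def control_solution_def ode_solution_iff_antideriv)
  then have "antideriv z (\<lambda>t. u *\<^sub>R (W t *v x t + \<rho> *\<^sub>R \<xi> t) + v *\<^sub>R (W t *v y t + \<rho> *\<^sub>R \<eta> t))"
    unfolding z_def by (intro antideriv_add antideriv_scaleR_left)
  then have "antideriv z (\<lambda>t. W t *v z t + \<rho> *\<^sub>R \<zeta> t)"
    by (rule antideriv_cong)
       (simp_all add: z_def \<zeta>_def algebra_simps matrix_vector_mult_scaleR matrix_vector_right_distrib)
  moreover have "\<zeta> \<in> borel_measurable lebesgue"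
    unfolding \<zeta>_def using x y by (auto simp: entire_def control_solution_def)
  moreover have "norm (\<zeta> t) \<le> 1" "norm (z t) \<le> R" for t
    unfolding \<zeta>_def z_def using x y by (auto intro!: le simp: entire_def control_solution_def)
  ultimately have "entire \<zeta> z"
    by (simp add: entire_def control_solution_def ode_solution_iff_antideriv)
  moreover have "u *\<^sub>R p + v *\<^sub>R q = z t" using x y by (simp add: z_def)
  ultimately show "u *\<^sub>R p + v *\<^sub>R q \<in> attr t" by (auto simp: attr_def)
qed

text \<open>The strict convexity of the fibres: with an adjoint solution \<open>m\<close> along \<open>n\<close>, the product
  \<open>m \<bullet> (x - y)\<close> vanishes at \<open>-\<infinity>\<close> and increases at rate \<open>\<rho> * norm m * (1 - n \<bullet> \<xi>)\<close>, which in turn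
  controls the distance of \<open>\<xi>\<close> from \<open>n\<close>.\<close>

lemma
  assumes b: "boundary_solution W \<rho> x n" and x: "\<And>t. norm (x t) \<le> R"
  shows boundary_maximal: "\<And>y. y \<in> attr a \<Longrightarrow> 0 \<le> n a \<bullet> (x a - y)"
    and boundary_strict: "e > 0 \<Longrightarrow>
      \<exists>d>0. \<forall>y\<in>attr a. n a \<bullet> (x a - y) < d \<longrightarrow> norm (x a - y) < e"
proof -
  have n: "ode_solution (normal_field W) n" "\<And>t. norm (n t) = 1" using b by (auto simp: boundary_solution_def)
  obtain m where m: "ode_solution (adjoint_field W) m" "m a = n a" "\<And>t. m t \<noteq> 0"
    "\<And>t. m t = norm (m t) *\<^sub>R n t" by (rule normal_field_adjoint[OF W n, of a]) (rule that)
  have cx: "control_solution W \<rho> n x" by (rule boundary_solution_imp_control_solution[OF b])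
  have key: "antideriv (\<lambda>t. m t \<bullet> (x t - y t)) (\<lambda>t. \<rho> * norm (m t) * (1 - n t \<bullet> \<xi> t))
      \<and> (\<forall>t. \<rho> * norm (m t) * (1 - n t \<bullet> \<xi> t) \<ge> 0) \<and> (\<forall>t. 0 \<le> m t \<bullet> (x t - y t))" if y: "entire \<xi> y" for y \<xi>
  proof (intro conjI allI)
    have cy: "control_solution W \<rho> \<xi> y" using y entire_def by blast
    have eq: "m t \<bullet> \<rho> *\<^sub>R (n t - \<xi> t) = \<rho> * norm (m t) * (1 - n t \<bullet> \<xi> t)" for t
    proof -
      have "n t \<bullet> n t = 1" using n(2)[of t] by (simp add: power2_norm_eq_inner[symmetric])
      then show ?thesis by (subst m(4)) (simp add: inner_diff_right algebra_simps)
    qed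
    show 1: "antideriv (\<lambda>t. m t \<bullet> (x t - y t)) (\<lambda>t. \<rho> * norm (m t) * (1 - n t \<bullet> \<xi> t))"
      unfolding eq[symmetric] by (rule antideriv_adjoint_inner[OF m(1) control_solution_diff[OF cx cy]])
    show 2: "\<rho> * norm (m t) * (1 - n t \<bullet> \<xi> t) \<ge> 0" for t
    proof -
      have "n t \<bullet> \<xi> t \<le> norm (n t) * norm (\<xi> t)" by (rule norm_cauchy_schwarz)
      also have "\<dots> \<le> 1" using cy n(2) by (simp add: control_solution_def)
      finally show ?thesis using \<rho> by simp
    qed
    show "0 \<le> m t \<bullet> (x t - y t)" for t
    proof -
      \<comment> \<open>A nondecreasing function that tends to 0 at minus infinity is nonnegative;
        the limit argument is applied to its negative.\<close>
      have "- (m t \<bullet> (x t - y t)) \<le> 0"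
      proof (rule le_of_le_decay)
        fix s assume st: "s \<le> t"
        have "- (m s \<bullet> (x s - y s)) \<le> norm (m s) * norm (x s - y s)"
          using Cauchy_Schwarz_ineq2[of "m s" "x s - y s"] by linarith
        also have "\<dots> \<le> (K * exp (- \<gamma> * (t - s)) * norm (m t)) * (R + R)"
        proof (rule mult_mono)
          show "norm (m s) \<le> K * exp (- \<gamma> * (t - s)) * norm (m t)" by (rule adjoint_decay[OF m(1) st])
          show "norm (x s - y s) \<le> R + R"
            using norm_triangle_ineq4[of "x s" "y s"] x[of s] y[unfolded entire_def, THEN conjunct2, rule_format, of s]
            by linarith
        qed (use K in auto)
        finally have "- (m s \<bullet> (x s - y s)) \<le> K * exp (- \<gamma> * (t - s)) * (norm (m t) * (R + R))" by (simp add: mult.assoc)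
        moreover have "0 - 0 \<le> m t \<bullet> (x t - y t) - m s \<bullet> (x s - y s)"
          by (rule antideriv_mono[OF antideriv_const 1 st 2])
        ultimately show "- (m t \<bullet> (x t - y t)) \<le> K * exp (- \<gamma> * (t - s)) * (norm (m t) * (R + R)) + 0" by simp
      qed
      then show ?thesis by simp
    qed
  qed
  show "0 \<le> n a \<bullet> (x a - y)" if yA: "y \<in> attr a" for y
  proof -
    obtain z \<xi> where "entire \<xi> z" "y = z a" using yA by (auto simp: attr_def)
    then show ?thesis using key m(2) by metis
  qed
  assume e: "e > 0"
  \<comment> \<open>The error is split into thirds: the states at a remote time \<open>T\<close>,
    the tolerance \<open>\<eta>\<close> for the distance of the controls, and the defect
    \<open>d\<close>.\<close>
  have "\<forall>\<^sub>F s in at_bot. K * exp (- \<gamma> * (a - s)) * (R + R) < e / 3"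
    by (rule order_tendstoD(2)[OF decay_at_bot]) (use e in simp)
  then obtain T0 where "\<And>s. s \<le> T0 \<Longrightarrow> K * exp (- \<gamma> * (a - s)) * (R + R) < e / 3"
    by (auto simp: eventually_at_bot_linorder)
  then obtain T where T: "T \<le> a" "K * exp (- \<gamma> * (a - T)) * (R + R) < e / 3"
    by (metis min.cobounded1 min.cobounded2)
  have cm: "continuous_on {T..a} (\<lambda>t. norm (m t))"
    using antideriv_continuous[OF m(1)[unfolded ode_solution_iff_antideriv]]
    by (intro continuous_intros) (auto intro: continuous_on_subset)
  have "\<exists>t0\<in>{T..a}. \<forall>t\<in>{T..a}. norm (m t0) \<le> norm (m t)"
    by (rule continuous_attains_inf[OF _ _ cm]) (use T(1) in auto)
  then obtain t0 where t0: "\<forall>t\<in>{T..a}. norm (m t0) \<le> norm (m t)" by blast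
  define c where "c = norm (m t0)"
  have c: "c > 0" "\<And>t. T \<le> t \<Longrightarrow> t \<le> a \<Longrightarrow> c \<le> norm (m t)" using m(3) t0 by (auto simp: c_def)
  \<comment> \<open>A Young parameter: the distance of the controls will be bounded by
    \<open>\<eta>\<close> plus a multiple of the defect divided by \<open>\<eta>\<close>. Its value
    makes \<open>K * \<rho> * \<eta> * (a - T + 1)\<close> equal to \<open>e / 3\<close>; the 1
    covers \<open>T = a\<close>.\<close>
  define \<eta> where "\<eta> = e / (3 * (K * \<rho> * (a - T + 1)))"
  have \<eta>: "\<eta> > 0" using e K \<rho> T by (simp add: \<eta>_def)
  \<comment> \<open>Solves \<open>K * d / (\<eta> * c) = e / 3\<close>. The factor \<open>c\<close>
    enters because the defect is weighted by \<open>norm (m t)\<close>, which is at least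
    \<open>c\<close> on \<open>{T..a}\<close>.\<close>
  define d where "d = e * \<eta> * c / (3 * K)"
  have "norm (x a - p) < e" if p: "p \<in> attr a" and pd: "n a \<bullet> (x a - p) < d" for p
  proof -
    obtain y \<xi> where y: "entire \<xi> y" "p = y a" using p by (auto simp: attr_def)
    have cy: "control_solution W \<rho> \<xi> y" using y entire_def by blast
    note Q = key[OF y(1)]
    have lb: "locally_integrable (\<lambda>t. \<rho> *\<^sub>R (n t - \<xi> t))"
      using cx cy unfolding control_solution_def
      by (intro locally_integrable_linear[OF _ bounded_linear_scaleR_right] locally_integrable_diff
          locally_integrable_bounded[where c = 1]) auto
    obtain \<beta> where \<beta>: "antideriv \<beta> (\<lambda>t. norm (\<rho> *\<^sub>R (n t - \<xi> t)))"
      using antideriv_exists[OF locally_integrable_norm[OF lb]] by metis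
    have id: "antideriv (\<lambda>t. t) (\<lambda>t. 1::real)"
      by (simp add: antideriv_def locally_integrable_continuous)
    have G: "antideriv (\<lambda>t. (\<rho> * \<eta>) *\<^sub>R t + (1 / (\<eta> * c)) *\<^sub>R (m t \<bullet> (x t - y t)))
        (\<lambda>t. (\<rho> * \<eta>) *\<^sub>R 1 + (1 / (\<eta> * c)) *\<^sub>R (\<rho> * norm (m t) * (1 - n t \<bullet> \<xi> t)))"
      by (intro antideriv_add antideriv_scaleR_left id Q[THEN conjunct1])
    have "\<beta> a - \<beta> T \<le> ((\<rho> * \<eta>) *\<^sub>R a + (1 / (\<eta> * c)) *\<^sub>R (m a \<bullet> (x a - y a)))
        - ((\<rho> * \<eta>) *\<^sub>R T + (1 / (\<eta> * c)) *\<^sub>R (m T \<bullet> (x T - y T)))"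
    proof (rule antideriv_mono[OF \<beta> G T(1)])
      fix r assume r: "T \<le> r" "r \<le> a"
      define D where "D = norm (n r - \<xi> r)"
      define g where "g = 1 - n r \<bullet> \<xi> r"
      \<comment> \<open>For \<open>\<xi> r\<close> in the unit ball the squared distance from the
        unit vector \<open>n r\<close> is at most twice the defect \<open>g\<close>.\<close>
      have "D\<^sup>2 = norm (n r)^2 + norm (\<xi> r)^2 - 2 * (n r \<bullet> \<xi> r)"
        unfolding D_def by (simp add: power2_norm_eq_inner inner_diff_left inner_diff_right inner_commute)
      also have "\<dots> \<le> 1 + 1 - 2 * (n r \<bullet> \<xi> r)"
        using n(2)[of r] cy by (simp add: control_solution_def power_le_one)
      finally have D2: "D\<^sup>2 \<le> 2 * g" by (simp add: g_def)
      have g0: "0 \<le> g" using D2 by (smt (verit) zero_le_power2)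
      have "2 * \<eta> * D \<le> \<eta>\<^sup>2 + D\<^sup>2" using sum_squares_bound[of \<eta> D] by simp
      moreover have "0 \<le> \<eta> * \<eta>" by simp
      ultimately have "\<eta> * D \<le> \<eta> * \<eta> + g" using D2 unfolding power2_eq_square by linarith
      then have "D \<le> \<eta> + g / \<eta>" using \<eta> by (simp add: field_simps)
      also have "g / \<eta> \<le> norm (m r) * g / (\<eta> * c)"
        using mult_right_mono[OF c(2)[OF r] g0] c(1) \<eta> by (simp add: field_simps)
      finally have "\<rho> * D \<le> \<rho> * (\<eta> + norm (m r) * g / (\<eta> * c))" using \<rho> by simp
      moreover have "norm (\<rho> *\<^sub>R (n r - \<xi> r)) = \<rho> * D" using \<rho> by (simp add: D_def)
      moreover have "(\<rho> * \<eta>) *\<^sub>R 1 + (1 / (\<eta> * c)) *\<^sub>R (\<rho> * norm (m r) * g) = \<rho> * (\<eta> + norm (m r) * g / (\<eta> * c))"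
        by (simp add: distrib_left)
      ultimately show "norm (\<rho> *\<^sub>R (n r - \<xi> r)) \<le> (\<rho> * \<eta>) *\<^sub>R 1 + (1 / (\<eta> * c)) *\<^sub>R (\<rho> * norm (m r) * (1 - n r \<bullet> \<xi> r))"
        unfolding g_def by (simp only:)
    qed
    also have "\<dots> \<le> \<rho> * \<eta> * (a - T) + (1 / (\<eta> * c)) * (m a \<bullet> (x a - y a))"
    proof -
      have "0 \<le> (1 / (\<eta> * c)) * (m T \<bullet> (x T - y T))"
        by (intro mult_nonneg_nonneg Q[THEN conjunct2, THEN conjunct2, rule_format]) (use \<eta> c(1) in simp)
      then show ?thesis unfolding real_scaleR_def right_diff_distrib by linarith
    qed
    also have "\<dots> < \<rho> * \<eta> * (a - T + 1) + (1 / (\<eta> * c)) * d"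
      using pd m(2) y(2) \<eta> c(1) \<rho> by (intro add_less_le_mono mult_strict_left_mono mult_left_mono) auto
    finally have \<beta>d: "K * (\<beta> a - \<beta> T) < K * (\<rho> * \<eta> * (a - T + 1) + (1 / (\<eta> * c)) * d)" using K by simp
    have "norm (x a - y a) \<le> K * exp (- \<gamma> * (a - T)) * norm (x T - y T) + K * (\<beta> a - \<beta> T)"
      by (rule forced_bound_primitive[OF control_solution_diff[OF cx cy] \<beta> T(1)])
    also have "norm (x T - y T) \<le> R + R"
      using norm_triangle_ineq4[of "x T" "y T"] x[of T] y(1)[unfolded entire_def, THEN conjunct2, rule_format, of T]
      by linarith
    finally have "norm (x a - y a) \<le> K * exp (- \<gamma> * (a - T)) * (R + R) + K * (\<beta> a - \<beta> T)"
      using K by (simp add: mult_left_mono)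
    moreover have "K * (\<rho> * \<eta> * (a - T + 1)) = e / 3"
      using K \<rho> T by (simp add: \<eta>_def)
    moreover have "K * ((1 / (\<eta> * c)) * d) = e / 3"
      using K \<eta> c(1) by (simp add: d_def)
    ultimately show ?thesis using \<beta>d T(2) y(2) by (simp add: distrib_left)
  qed
  moreover have "d > 0" using e \<eta> c(1) K by (simp add: d_def)
  ultimately show "\<exists>d>0. \<forall>y\<in>attr a. n a \<bullet> (x a - y) < d \<longrightarrow> norm (x a - y) < e" by blast
qed

lemma boundary_exists:
  assumes "norm v = 1"
  obtains x n where "boundary_solution W \<rho> x n" "n a = v" "\<And>t. norm (x t) \<le> R"
proof -
  obtain n where n: "ode_solution (normal_field W) n" "\<And>t. norm (n t) = 1" "n a = v"
    by (rule normal_field_solution[OF W assms, of a]) (rule that)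
  have "continuous_on UNIV n"
    using n(1) antideriv_continuous ode_solution_iff_antideriv by blast
  then have "n \<in> borel_measurable lebesgue"
    by (simp add: borel_measurable_continuous_onI measurable_completion)
  then obtain x where "entire n x" by (rule entire_exists[of n]) (simp_all add: n(2))
  then have "boundary_solution W \<rho> x n" "\<And>t. norm (x t) \<le> R"
    using n by (auto simp: entire_def control_solution_def boundary_solution_def)
  then show thesis using that n(3) by blast
qed

lemma entire_boundary: "boundary_solution W \<rho> x n \<Longrightarrow> (\<And>t. norm (x t) \<le> R) \<Longrightarrow> x a \<in> attr a"
  unfolding attr_def entire_def using boundary_solution_imp_control_solution by blast

text \<open>The maximizer is unique even among the points of the closure: points of the fibre near
  \<open>p\<close> are almost maximal, hence near \<open>x a\<close> by
  \<open>boundary_strict\<close>. Admitting the closure is what makes the fibres closed.\<close>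

lemma boundary_eq_maximal:
  assumes b: "boundary_solution W \<rho> x n" "\<And>t. norm (x t) \<le> R"
    and p: "p \<in> closure (attr a)" and max: "\<And>y. y \<in> attr a \<Longrightarrow> n a \<bullet> y \<le> n a \<bullet> p"
  shows "x a = p"
proof -
  have "norm (x a - p) \<le> 0"
  proof (rule field_le_epsilon)
    fix e :: real assume e: "e > 0"
    obtain d where d: "d > 0" "\<And>y. y \<in> attr a \<Longrightarrow> n a \<bullet> (x a - y) < d \<Longrightarrow> norm (x a - y) < e / 2"
      using boundary_strict[OF b, where a = a and e = "e/2"] e by auto
    obtain y where y: "y \<in> attr a" "dist y p < min d (e / 2)"
      using p d(1) e closure_approachable by (metis half_gt_zero min_less_iff_conj)
    have "n a \<bullet> (x a - y) = n a \<bullet> x a - n a \<bullet> p + n a \<bullet> (p - y)" by (simp add: inner_diff_right)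
    also have "\<dots> \<le> n a \<bullet> (p - y)" using max[OF entire_boundary[OF b]] by simp
    also have "\<dots> \<le> norm (n a) * norm (p - y)" by (rule norm_cauchy_schwarz)
    also have "\<dots> < d" using y(2) b(1) by (simp add: boundary_solution_def dist_norm norm_minus_commute)
    finally have "norm (x a - y) < e / 2" using d(2) y(1) by blast
    moreover have "norm (x a - p) \<le> norm (x a - y) + norm (y - p)"
      using norm_triangle_ineq[of "x a - y" "y - p"] by simp
    ultimately show "norm (x a - p) \<le> 0 + e" using y(2) by (simp add: dist_norm)
  qed
  then show ?thesis by simp
qed

lemma compact_attr: "compact (attr a)"
proof -
  have "p \<in> attr a" if p: "p \<in> closure (attr a)" for p
  proof (rule ccontr)
    assume np: "p \<notin> attr a"
    have "convex ((\<lambda>x. x - p) ` attr a)" using convex_attr by simp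
    moreover have "0 \<notin> (\<lambda>x. x - p) ` attr a" using np by auto
    ultimately have "\<exists>c. c \<noteq> 0 \<and> (\<forall>z\<in>(\<lambda>x. x - p) ` attr a. 0 \<le> c \<bullet> z)"
      by (rule separating_hyperplane_set_0)
    then obtain c where c: "c \<noteq> 0" "\<And>y. y \<in> attr a \<Longrightarrow> 0 \<le> c \<bullet> (y - p)" by auto
    \<comment> \<open>The vector \<open>c\<close> points from \<open>p\<close> towards the fibre, so
      the outer normal is the negative direction.\<close>
    define v where "v = - c /\<^sub>R norm c"
    have nv: "norm v = 1" using c(1) by (simp add: v_def)
    obtain x n where b: "boundary_solution W \<rho> x n" "n a = v" "\<And>t. norm (x t) \<le> R"
      by (rule boundary_exists[OF nv, of a]) (rule that)
    have "n a \<bullet> y \<le> n a \<bullet> p" if "y \<in> attr a" for y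
      using c(2)[OF that] c(1) unfolding b(2) v_def by (simp add: inner_diff_right divide_right_mono)
    then have "x a = p" by (rule boundary_eq_maximal[OF b(1,3) p])
    then show False using entire_boundary[OF b(1,3)] np by blast
  qed
  then have "closure (attr a) = attr a" using closure_subset by blast
  then have "closed (attr a)" by (metis closed_closure)
  moreover have "bounded (attr a)" unfolding bounded_iff using attr_le_R by blast
  ultimately show ?thesis by (simp add: compact_eq_bounded_closed)
qed

section \<open>Supporting normals of a fibre as values of boundary trajectories\<close>

definition normals :: "((real^'n) \<times> (real^'n)) set" where
  "normals = {(x 0, n 0) | x n. boundary_solution W \<rho> x n \<and> (\<forall>t. norm (x t) \<le> R)}"

text \<open>One inclusion is the maximum property. Conversely, the boundary trajectory with normal
  \<open>v\<close> passes through \<open>p\<close> because maximizers in direction \<open>v\<close>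
  are unique.\<close>

lemma normals_eq:
  "normals = {(p, v). p \<in> attr 0 \<and> norm v = 1 \<and> (\<forall>y\<in>attr 0. v \<bullet> y \<le> v \<bullet> p)}"
proof (intro equalityI subsetI)
  fix q assume "q \<in> normals"
  then obtain x n where b: "boundary_solution W \<rho> x n" "\<And>t. norm (x t) \<le> R" "q = (x 0, n 0)"
    unfolding normals_def by blast
  show "q \<in> {(p, v). p \<in> attr 0 \<and> norm v = 1 \<and> (\<forall>y\<in>attr 0. v \<bullet> y \<le> v \<bullet> p)}"
    using entire_boundary[OF b(1,2)] boundary_maximal[OF b(1,2)] b
    by (auto simp: boundary_solution_def inner_diff_right)
next
  fix q assume "q \<in> {(p, v). p \<in> attr 0 \<and> norm v = 1 \<and> (\<forall>y\<in>attr 0. v \<bullet> y \<le> v \<bullet> p)}"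
  then obtain p v where q: "q = (p, v)" "p \<in> attr 0" "norm v = 1" "\<And>y. y \<in> attr 0 \<Longrightarrow> v \<bullet> y \<le> v \<bullet> p"
    by auto
  obtain x n where b: "boundary_solution W \<rho> x n" "n 0 = v" "\<And>t. norm (x t) \<le> R"
    by (rule boundary_exists[OF q(3), of 0]) (rule that)
  have "x 0 = p"
    by (rule boundary_eq_maximal[OF b(1,3)]) (use q b closure_subset in auto)
  then show "q \<in> normals" using b q(1) unfolding normals_def by blast
qed

end

section \<open>Normal bundle of a compact convex set\<close>

text \<open>The limes superior runs over boundary points only and, where the boundary is smooth, its
  condition holds for the inner normal as well; outwardness excludes that one. Convexity turns the
  two local conditions into the global support inequality.\<close>

lemma outward_regular_normal_convex:
  fixes A :: "'a::euclidean_space set"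
  assumes A: "compact A" "convex A"
  shows "p \<in> frontier A \<and> outward_regular_normal A p v \<longleftrightarrow>
    p \<in> A \<and> norm v = 1 \<and> (\<forall>y\<in>A. v \<bullet> y \<le> v \<bullet> p)"
proof
  assume l: "p \<in> frontier A \<and> outward_regular_normal A p v"
  then have v: "norm v = 1" and out: "\<forall>\<^sub>F \<epsilon> in at_right 0. p + \<epsilon> *\<^sub>R v \<notin> A"
    and ls: "Limsup (at p within frontier A) (\<lambda>y. ereal (v \<bullet> (y - p) / norm (y - p))) \<le> 0"
    by (auto simp: outward_regular_normal_def outward_pointing_def)
  have pA: "p \<in> A" using l A frontier_subset_compact by blast
  \<comment> \<open>By convexity a ray that is outside \<open>A\<close> at small distances never
    returns.\<close>
  have notin: "p + s *\<^sub>R v \<notin> A" if "s > 0" for s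
  proof
    assume "p + s *\<^sub>R v \<in> A"
    obtain b where b: "b > 0" "\<And>y. 0 < y \<Longrightarrow> y < b \<Longrightarrow> p + y *\<^sub>R v \<notin> A"
      using out unfolding eventually_at_right_field by auto
    define r where "r = min s (b / 2)"
    have r: "0 < r" "r \<le> s" "r < b" using b(1) that by (auto simp: r_def)
    have "(1 - r / s) *\<^sub>R p + (r / s) *\<^sub>R (p + s *\<^sub>R v) \<in> A"
      by (rule convexD[OF A(2) pA \<open>p + s *\<^sub>R v \<in> A\<close>]) (use r that in auto)
    then have "p + r *\<^sub>R v \<in> A" using that by (simp add: algebra_simps)
    then show False using b(2) r by blast
  qed
  have "v \<bullet> y \<le> v \<bullet> p" if y: "y \<in> A" for y
  proof (rule ccontr)
    assume "\<not> v \<bullet> y \<le> v \<bullet> p"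
    then have pos: "v \<bullet> (y - p) > 0" by (simp add: inner_diff_right)
    \<comment> \<open>The cap at 1 gives \<open>\<kappa> * s \<le> s\<close> for the displacement
      \<open>s\<close> along \<open>v\<close>.\<close>
    define \<kappa> where "\<kappa> = min (v \<bullet> (y - p) / norm (y - p)) 1"
    have yp: "norm (y - p) > 0" using pos by auto
    have \<kappa>: "\<kappa> > 0" "\<kappa> \<le> 1" "\<kappa> * norm (y - p) \<le> v \<bullet> (y - p)"
    proof -
      show "\<kappa> > 0" "\<kappa> \<le> 1" using pos yp by (auto simp: \<kappa>_def)
      have "\<kappa> \<le> v \<bullet> (y - p) / norm (y - p)" by (simp add: \<kappa>_def)
      then show "\<kappa> * norm (y - p) \<le> v \<bullet> (y - p)" using yp by (simp add: pos_le_divide_eq)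
    qed
    have "\<forall>\<^sub>F w in at p within frontier A. ereal (v \<bullet> (w - p) / norm (w - p)) < ereal \<kappa>"
      by (rule Limsup_lessD) (use ls \<kappa>(1) in \<open>auto intro: le_less_trans\<close>)
    then obtain d where d: "d > 0" "\<And>w. w \<in> frontier A \<Longrightarrow> w \<noteq> p \<Longrightarrow> dist w p < d \<Longrightarrow>
        v \<bullet> (w - p) / norm (w - p) < \<kappa>"
      unfolding eventually_at by auto
    txt \<open>The limes superior sees boundary points only, so a point of the segment from \<open>p\<close> to \<open>y\<close> is
      moved in direction \<open>v\<close> until it leaves \<open>A\<close>.\<close>
    have "\<exists>w t s. w = p + t *\<^sub>R (y - p) + s *\<^sub>R v \<and> 0 < t \<and> 0 \<le> s \<and> w \<in> frontier A \<and> dist w p < d"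
    proof -
      obtain N where N: "\<And>a. a \<in> A \<Longrightarrow> norm a \<le> N" using compact_imp_bounded[OF A(1)] bounded_iff by blast
      define s0 where "s0 = d / 2"
      have "open (- A)" using A(1) compact_imp_closed by blast
      moreover have "p + s0 *\<^sub>R v \<in> - A" using notin d(1) by (simp add: s0_def)
      ultimately obtain e where e: "e > 0" "ball (p + s0 *\<^sub>R v) e \<subseteq> - A"
        using open_contains_ball by blast
      \<comment> \<open>So small that the segment in direction \<open>v\<close> from the point
        \<open>q\<close> still ends in the ball outside \<open>A\<close>, and that all its points
        stay within \<open>d\<close> of \<open>p\<close>.\<close>
      define t where "t = min (1/2) (min e d / (3 * norm (y - p)))"
      have t: "0 < t" "t \<le> 1" "t * norm (y - p) < e" "t * norm (y - p) < d / 2"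
      proof -
        show "0 < t" "t \<le> 1" using e(1) d(1) yp by (auto simp: t_def)
        have "t \<le> min e d / (3 * norm (y - p))" by (simp add: t_def)
        then have "t * norm (y - p) \<le> min e d / 3" using yp by (simp add: field_simps)
        then show "t * norm (y - p) < e" "t * norm (y - p) < d / 2" using e(1) d(1) by auto
      qed
      define q where "q = p + t *\<^sub>R (y - p)"
      have qA: "q \<in> A"
        using convexD[OF A(2) pA y, of "1 - t" t] t by (simp add: q_def algebra_simps)
      have qs: "q + s0 *\<^sub>R v \<notin> A"
      proof -
        have "q + s0 *\<^sub>R v \<in> ball (p + s0 *\<^sub>R v) e" using t by (simp add: q_def dist_norm)
        then show ?thesis using e(2) by blast
      qed
      define seg where "seg = closed_segment q (q + s0 *\<^sub>R v)"
      have "seg \<inter> frontier A \<noteq> {}"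
        by (rule connected_Int_frontier) (use qA qs in \<open>auto simp: seg_def\<close>)
      then obtain w where w: "w \<in> seg" "w \<in> frontier A" by auto
      then obtain u where u: "0 \<le> u" "u \<le> 1" "w = (1 - u) *\<^sub>R q + u *\<^sub>R (q + s0 *\<^sub>R v)"
        by (auto simp: seg_def in_segment)
      then have w2: "w = p + t *\<^sub>R (y - p) + (u * s0) *\<^sub>R v" by (simp add: q_def algebra_simps)
      have "dist w p \<le> t * norm (y - p) + u * s0"
        unfolding w2 dist_norm
        using norm_triangle_ineq[of "t *\<^sub>R (y - p)" "(u * s0) *\<^sub>R v"] t u d(1) v by (simp add: s0_def)
      also have "\<dots> < d"
      proof -
        have "u * s0 \<le> 1 * s0" using u d(1) by (intro mult_right_mono) (auto simp: s0_def)
        then show ?thesis using t(4) by (simp add: s0_def)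
      qed
      finally show ?thesis using w w2 t(1) u d(1) by (intro exI[of _ w] exI[of _ t] exI[of _ "u * s0"]) (auto simp: s0_def)
    qed
    then obtain w t s where w: "w = p + t *\<^sub>R (y - p) + s *\<^sub>R v" "0 < t" "0 \<le> s" "w \<in> frontier A" "dist w p < d"
      by blast
    have vv: "v \<bullet> v = 1" using v by (simp add: power2_norm_eq_inner[symmetric])
    have vw: "v \<bullet> (w - p) = t * (v \<bullet> (y - p)) + s" by (simp add: w(1) inner_add_right vv)
    then have "v \<bullet> (w - p) > 0" using w(2,3) pos by (simp add: add_pos_nonneg)
    then have "w \<noteq> p" by auto
    \<comment> \<open>The displacement adds \<open>s\<close> to the left side but at most
      \<open>\<kappa> * s\<close> to the right, so moving to the boundary does not spoil the
      contradiction.\<close>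
    then have "v \<bullet> (w - p) < \<kappa> * norm (w - p)"
      using d(2)[OF w(4) _ w(5)] by (simp add: pos_divide_less_eq)
    also have "\<dots> \<le> \<kappa> * (t * norm (y - p) + s)"
    proof (rule mult_left_mono)
      have "w - p = t *\<^sub>R (y - p) + s *\<^sub>R v" using w(1) by simp
      then show "norm (w - p) \<le> t * norm (y - p) + s"
        using norm_triangle_ineq[of "t *\<^sub>R (y - p)" "s *\<^sub>R v"] w(2,3) v by simp
    qed (use \<kappa>(1) in simp)
    also have "\<dots> = t * (\<kappa> * norm (y - p)) + \<kappa> * s" by (simp add: algebra_simps)
    also have "\<dots> \<le> t * (v \<bullet> (y - p)) + 1 * s"
      using \<kappa> w(2,3) by (intro add_mono mult_left_mono mult_right_mono) auto
    finally show False using vw by simp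
  qed
  then show "p \<in> A \<and> norm v = 1 \<and> (\<forall>y\<in>A. v \<bullet> y \<le> v \<bullet> p)" using pA v by blast
next
  assume r: "p \<in> A \<and> norm v = 1 \<and> (\<forall>y\<in>A. v \<bullet> y \<le> v \<bullet> p)"
  then have vv: "v \<bullet> v = 1" by (simp add: power2_norm_eq_inner[symmetric])
  have notin: "p + \<epsilon> *\<^sub>R v \<notin> A" if "\<epsilon> > 0" for \<epsilon>
    using r that vv by (force simp: inner_add_right)
  have fr: "p \<in> frontier A"
  proof -
    have "p \<notin> interior A"
    proof
      assume "p \<in> interior A"
      then obtain e where e: "e > 0" "cball p e \<subseteq> A" using mem_interior_cball by blast
      then have "p + e *\<^sub>R v \<in> A" using r by (auto simp: subset_iff dist_norm)
      then show False using notin e(1) by blast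
    qed
    then show ?thesis using r closure_subset by (auto simp: frontier_def)
  qed
  moreover have "outward_pointing A p v"
    unfolding outward_pointing_def eventually_at_right_field using notin by (auto intro: exI[of _ 1])
  moreover have "Limsup (at p within frontier A) (\<lambda>y. ereal (v \<bullet> (y - p) / norm (y - p))) \<le> 0"
  proof (rule Limsup_bounded)
    show "\<forall>\<^sub>F y in at p within frontier A. ereal (v \<bullet> (y - p) / norm (y - p)) \<le> 0"
      unfolding eventually_at using r frontier_subset_compact[OF A(1)]
      by (intro exI[of _ 1]) (auto simp: inner_diff_right divide_nonpos_nonneg)
  qed
  ultimately show "p \<in> frontier A \<and> outward_regular_normal A p v"
    using r by (simp add: outward_regular_normal_def)
qed

text \<open>The support inequality survives limits, so the limiting cone contains nothing beyond the
  regular normals.\<close>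

lemma normal_bundle_compact_convex:
  fixes A :: "'a::euclidean_space set"
  assumes A: "compact A" "convex A"
  shows "normal_bundle A = {(p, v). p \<in> A \<and> norm v = 1 \<and> (\<forall>y\<in>A. v \<bullet> y \<le> v \<bullet> p)}" (is "_ = ?N")
proof (intro equalityI subsetI)
  fix q assume "q \<in> normal_bundle A"
  then obtain p v ps vs where q: "q = (p, v)" "p \<in> frontier A" "\<And>k. ps k \<in> frontier A \<and> outward_regular_normal A (ps k) (vs k)"
    "ps \<longlonglongrightarrow> p" "vs \<longlonglongrightarrow> v" by (auto simp: normal_bundle_def)
  have k: "norm (vs k) = 1" "\<forall>y\<in>A. vs k \<bullet> y \<le> vs k \<bullet> ps k" for k
    using q(3)[of k] outward_regular_normal_convex[OF A] by blast+
  have "p \<in> A" using q(2) A frontier_subset_compact by blast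
  moreover have "norm v = 1"
    using tendsto_norm[OF q(5)] by (simp add: k LIMSEQ_const_iff)
  moreover have "v \<bullet> y \<le> v \<bullet> p" if "y \<in> A" for y
    by (rule LIMSEQ_le[OF tendsto_inner[OF q(5) tendsto_const] tendsto_inner[OF q(5,4)]]) (use k that in auto)
  ultimately show "q \<in> ?N" using q(1) by simp
next
  fix q assume "q \<in> ?N"
  then obtain p v where q: "q = (p, v)" "p \<in> frontier A \<and> outward_regular_normal A p v"
    using outward_regular_normal_convex[OF A] by auto
  then show "q \<in> normal_bundle A"
    unfolding normal_bundle_def
    by (simp, intro exI[of _ "\<lambda>_. p"] exI[of _ "\<lambda>_. v"]) simp
qed

lemma compact_normal_bundle:
  fixes A :: "'a::euclidean_space set"
  assumes A: "compact A" "convex A"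
  shows "compact (normal_bundle A)"
proof -
  have "closed (fst -` A :: ('a \<times> 'a) set)"
    by (intro continuous_closed_vimage compact_imp_closed A continuous_fst continuous_ident)
  then have "closed {q::'a \<times> 'a. fst q \<in> A}" by (simp add: vimage_def)
  then have "closed {q. fst q \<in> A \<and> norm (snd q) = 1 \<and> (\<forall>y\<in>A. snd q \<bullet> y \<le> snd q \<bullet> fst q)}"
    unfolding Ball_def
    by (intro closed_Collect_conj closed_Collect_all closed_Collect_imp closed_Collect_eq closed_Collect_le
        continuous_intros) auto
  moreover have "normal_bundle A = {q. fst q \<in> A \<and> norm (snd q) = 1 \<and> (\<forall>y\<in>A. snd q \<bullet> y \<le> snd q \<bullet> fst q)}"
    unfolding normal_bundle_compact_convex[OF A] by auto
  moreover have "bounded (A \<times> cball (0::'a) 1)"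
    using A(1) compact_imp_bounded bounded_Times bounded_cball by blast
  then have "bounded (normal_bundle A)"
    by (rule bounded_subset) (auto simp: normal_bundle_compact_convex[OF A])
  ultimately show ?thesis by (simp only: compact_eq_bounded_closed simp_thms)
qed

section \<open>The skew-product flow\<close>

lemma loc_int_eq_sym: "loc_int_eq f g \<Longrightarrow> loc_int_eq g f"
  by (auto simp: loc_int_eq_def eq_commute)

lemma abs_rep_mat_fun: "abs_mat_fun (rep_mat_fun \<omega>) = \<omega>"
  by (rule Quotient3_abs_rep[OF Quotient3_mat_fun])

lemma loc_int_eq_rep: "loc_int_eq (rep_mat_fun \<omega>) (rep_mat_fun \<omega>)"
  by (rule Quotient3_rep_reflp[OF Quotient3_mat_fun])

lemma locally_integrable_rep: "locally_integrable (rep_mat_fun \<omega>)"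
  using loc_int_eq_rep loc_int_eq_def by blast

lemma loc_int_eq_rep_abs: "loc_int_eq f f \<Longrightarrow> loc_int_eq (rep_mat_fun (abs_mat_fun f)) f"
  using Quotient3_rep_abs[OF Quotient3_mat_fun] .

lemma translate_eq_abs: "translate \<tau> \<omega> = abs_mat_fun (\<lambda>t. rep_mat_fun \<omega> (t + \<tau>))"
  using translate.abs_eq[OF loc_int_eq_rep, of \<tau> \<omega>] by (simp add: abs_rep_mat_fun)

lemma loc_int_eq_rep_translate:
  "loc_int_eq (rep_mat_fun (translate \<tau> \<omega>)) (\<lambda>t. rep_mat_fun \<omega> (t + \<tau>))"
  unfolding translate_eq_abs by (rule loc_int_eq_rep_abs[OF loc_int_eq_translate[OF loc_int_eq_rep]])

lemma translate_0 [simp]: "translate 0 \<omega> = \<omega>"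
  by (simp add: translate_eq_abs abs_rep_mat_fun)

lemma translate_translate [simp]: "translate s (translate t \<omega>) = translate (s + t) \<omega>"
proof -
  have "translate t \<omega> = abs_mat_fun (\<lambda>r. rep_mat_fun \<omega> (r + t))" by (rule translate_eq_abs)
  then have "translate s (translate t \<omega>) = abs_mat_fun (\<lambda>r. rep_mat_fun \<omega> (r + s + t))"
    using translate.abs_eq[OF loc_int_eq_translate[OF loc_int_eq_rep], of s \<omega> t] by simp
  then show ?thesis by (simp add: translate_eq_abs[of "s + t"] add.assoc)
qed

lemma ode_solution_cong_loc_int_eq:
  assumes "loc_int_eq V W" "ode_solution (\<lambda>t. F t (V t)) u"
  shows "ode_solution (\<lambda>t. F t (W t)) u"
  by (rule ode_solution_cong_AE[OF _ assms(2)])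
     (use assms(1) in \<open>auto simp: loc_int_eq_def elim!: eventually_mono\<close>)

section \<open>The boundary system and its flow\<close>

lemma boundary_solution_shift:
  "boundary_solution W \<rho> x n \<Longrightarrow>
    boundary_solution (\<lambda>t. W (t + c)) \<rho> (\<lambda>t. x (t + c)) (\<lambda>t. n (t + c))"
  using ode_solution_shift[of "normal_field W" n c]
    ode_solution_shift[of "\<lambda>t y. W t *v y + \<rho> *\<^sub>R n t" x c]
  by (simp add: boundary_solution_def normal_field_def)

lemma boundary_solution_cong:
  assumes "loc_int_eq V W" "boundary_solution V \<rho> x n"
  shows "boundary_solution W \<rho> x n"
  using ode_solution_cong_loc_int_eq[OF assms(1), of "\<lambda>t A m. - (transpose A *v m) + (m \<bullet> (transpose A *v m)) *\<^sub>R m" n]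
    ode_solution_cong_loc_int_eq[OF assms(1), of "\<lambda>t A y. A *v y + \<rho> *\<^sub>R n t" x] assms(2)
  by (simp add: boundary_solution_def normal_field_def)

lemma boundary_solution_translate:
  "boundary_solution (rep_mat_fun \<omega>) \<rho> x n \<Longrightarrow>
    boundary_solution (rep_mat_fun (translate c \<omega>)) \<rho> (\<lambda>t. x (t + c)) (\<lambda>t. n (t + c))"
  by (rule boundary_solution_cong[OF loc_int_eq_sym[OF loc_int_eq_rep_translate] boundary_solution_shift])

lemma boundary_solution_unique:
  assumes W: "locally_integrable W"
    and b: "boundary_solution W \<rho> x n" "boundary_solution W \<rho> x' n'" "x a = x' a" "n a = n' a"
  shows "x = x' \<and> n = n'"
proof -
  have n: "n = n'"
    by (rule normal_field_unique[OF W, where a = a]) (use b in \<open>auto simp: boundary_solution_def\<close>)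
  have "x = x'"
    by (rule bilinear_ode_unique[OF bilinear_matrix_vector W, where a = a and b = "\<lambda>t. \<rho> *\<^sub>R n t"])
       (use b n in \<open>auto simp: boundary_solution_def\<close>)
  then show ?thesis using n by blast
qed

lemma boundary_solution_exists:
  assumes W: "locally_integrable W" and "norm v = 1"
  obtains x n where "boundary_solution W \<rho> x n" "x a = c" "n a = v"
proof -
  obtain n where n: "ode_solution (normal_field W) n" "\<And>t. norm (n t) = 1" "n a = v"
    by (rule normal_field_solution[OF assms, of a]) (rule that)
  have "locally_integrable (\<lambda>t. \<rho> *\<^sub>R n t)"
    by (intro locally_integrable_continuous continuous_intros
        antideriv_continuous[OF n(1)[unfolded ode_solution_iff_antideriv]])
  from bilinear_ode_exists[OF bilinear_matrix_vector W this, of a c]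
  obtain x where "ode_solution (\<lambda>t y. W t *v y + \<rho> *\<^sub>R n t) x" "x a = c" by blast
  then show thesis
    by (intro that[of x n]) (use n in \<open>simp_all add: boundary_solution_def\<close>)
qed

lemma boundary_field_solution_iff:
  "ode_solution (boundary_field \<rho> \<omega>) u \<and> (\<forall>s. u s \<in> UNIV \<times> sphere 0 1) \<longleftrightarrow>
    boundary_solution (rep_mat_fun \<omega>) \<rho> (\<lambda>t. fst (u t)) (\<lambda>t. snd (u t))"
proof -
  have "ode_solution (boundary_field \<rho> \<omega>) u \<longleftrightarrow>
      ode_solution (\<lambda>t y. rep_mat_fun \<omega> t *v y + \<rho> *\<^sub>R snd (u t)) (\<lambda>t. fst (u t)) \<and>
      ode_solution (normal_field (rep_mat_fun \<omega>)) (\<lambda>t. snd (u t))"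
    unfolding ode_solution_iff_antideriv antideriv_Pair_iff[of u]
    by (simp add: boundary_field_def normal_field_def Let_def split_beta del: transpose_matrix_vector)
  then show ?thesis by (auto simp: boundary_solution_def mem_Times_iff)
qed

text \<open>Unique solvability gives the definite description its value. The formula holds for
  negative \<open>t\<close> as well, which later inverts the flow on the normal bundles.\<close>

lemma phi_eq:
  assumes "boundary_solution (rep_mat_fun \<omega>) \<rho> x n"
  shows "\<phi> \<rho> t \<omega> (x 0, n 0) = (x t, n t)"
proof -
  have "(THE u. ode_solution (boundary_field \<rho> \<omega>) u \<and> (\<forall>s. u s \<in> UNIV \<times> sphere 0 1) \<and> u 0 = (x 0, n 0))
      = (\<lambda>t. (x t, n t))"
  proof (rule the_equality)
    show "ode_solution (boundary_field \<rho> \<omega>) (\<lambda>t. (x t, n t)) \<and>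
        (\<forall>s. (x s, n s) \<in> UNIV \<times> sphere 0 1) \<and> (x 0, n 0) = (x 0, n 0)"
      using boundary_field_solution_iff[of \<rho> \<omega> "\<lambda>t. (x t, n t)"] assms by simp
  next
    fix u assume u: "ode_solution (boundary_field \<rho> \<omega>) u \<and> (\<forall>s. u s \<in> UNIV \<times> sphere 0 1) \<and> u 0 = (x 0, n 0)"
    then have "boundary_solution (rep_mat_fun \<omega>) \<rho> (\<lambda>t. fst (u t)) (\<lambda>t. snd (u t))"
      using boundary_field_solution_iff by blast
    then have "(\<lambda>t. fst (u t)) = x \<and> (\<lambda>t. snd (u t)) = n"
      by (rule boundary_solution_unique[OF locally_integrable_rep _ assms, where a = 0]) (use u in auto)
    then show "u = (\<lambda>t. (x t, n t))" by (metis prod.collapse ext)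
  qed
  then show ?thesis by (simp add: \<phi>_def)
qed

lemma phi_obtain:
  assumes "p \<in> UNIV \<times> sphere 0 1"
  obtains x n where "boundary_solution (rep_mat_fun \<omega>) \<rho> x n" "p = (x 0, n 0)"
    "\<And>t. \<phi> \<rho> t \<omega> p = (x t, n t)"
proof -
  have nv: "norm (snd p) = 1" using assms by (auto simp: mem_Times_iff)
  obtain x n where b: "boundary_solution (rep_mat_fun \<omega>) \<rho> x n" "x 0 = fst p" "n 0 = snd p"
    by (rule boundary_solution_exists[OF locally_integrable_rep nv]) (rule that)
  have p: "p = (x 0, n 0)" using b by simp
  show thesis by (rule that[OF b(1) p]) (simp only: p phi_eq[OF b(1)])
qed

lemma phi_sphere:
  assumes "p \<in> UNIV \<times> sphere 0 1"
  shows "\<phi> \<rho> t \<omega> p \<in> UNIV \<times> sphere 0 1"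
proof -
  obtain x n where "boundary_solution (rep_mat_fun \<omega>) \<rho> x n" "\<And>t. \<phi> \<rho> t \<omega> p = (x t, n t)"
    by (rule phi_obtain[OF assms, of \<omega> \<rho>]) (rule that)
  then show ?thesis by (simp add: boundary_solution_def)
qed

text \<open>The cocycle property, for times of either sign: a solution over \<open>\<omega>\<close>,
  shifted by \<open>t\<close>, is a solution over \<open>translate t \<omega>\<close>.\<close>

lemma phi_add:
  assumes "p \<in> UNIV \<times> sphere 0 1"
  shows "\<phi> \<rho> (s + t) \<omega> p = \<phi> \<rho> s (translate t \<omega>) (\<phi> \<rho> t \<omega> p)"
proof -
  obtain x n where b: "boundary_solution (rep_mat_fun \<omega>) \<rho> x n" "\<And>t. \<phi> \<rho> t \<omega> p = (x t, n t)"
    by (rule phi_obtain[OF assms, of \<omega> \<rho>]) (rule that)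
  show ?thesis
    using phi_eq[OF boundary_solution_translate[OF b(1), of t], of s] b(2) by simp
qed

lemma reach_eq_control_reach: "reach \<rho> \<omega> t s M = control_reach (rep_mat_fun \<omega>) \<rho> t s M"
proof (intro equalityI subsetI)
  fix p assume "p \<in> reach \<rho> \<omega> t s M"
  then obtain x \<xi> where x: "\<xi> \<in> controls" "p = x t" "x s \<in> M"
    "ode_solution (\<lambda>s y. rep_mat_fun \<omega> s *v y + \<rho> *\<^sub>R \<xi> s) x" by (auto simp: reach_def)
  \<comment> \<open>The control is replaced by 0 at those times, a null set, where it exceeds the
    bound.\<close>
  define \<eta> where "\<eta> r = (if norm (\<xi> r) \<le> 1 then \<xi> r else 0)" for r
  have \<xi>: "\<xi> \<in> borel_measurable lebesgue" "AE t in lebesgue. norm (\<xi> t) \<le> 1"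
    using x(1) by (auto simp: controls_def)
  have [measurable]: "\<xi> \<in> borel_measurable lebesgue" by (rule \<xi>)
  have "\<eta> \<in> borel_measurable lebesgue" unfolding \<eta>_def by measurable
  moreover have "norm (\<eta> r) \<le> 1" for r by (simp add: \<eta>_def)
  moreover have "ode_solution (\<lambda>s y. rep_mat_fun \<omega> s *v y + \<rho> *\<^sub>R \<eta> s) x"
    by (rule ode_solution_cong_AE[OF _ x(4)]) (use \<xi>(2) in \<open>auto simp: \<eta>_def elim!: eventually_mono\<close>)
  ultimately show "p \<in> control_reach (rep_mat_fun \<omega>) \<rho> t s M"
    using x unfolding control_reach_def control_solution_def by blast
next
  fix p assume "p \<in> control_reach (rep_mat_fun \<omega>) \<rho> t s M"
  then obtain x \<xi> where "control_solution (rep_mat_fun \<omega>) \<rho> \<xi> x" "x s \<in> M" "p = x t"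
    unfolding control_reach_def by blast
  then have "\<xi> \<in> controls" "ode_solution (\<lambda>s y. rep_mat_fun \<omega> s *v y + \<rho> *\<^sub>R \<xi> s) x" "x s \<in> M" "p = x t"
    by (auto simp: control_solution_def controls_def)
  then show "p \<in> reach \<rho> \<omega> t s M" unfolding reach_def by blast
qed

section \<open>Exponential stability on the hull\<close>

text \<open>Connects the stability hypothesis, phrased with the principal matrix, to individual
  solutions.\<close>

lemma principal_matrix_solution:
  assumes L: "locally_integrable L" and x: "ode_solution (\<lambda>t y. L t *v y) x"
  shows "x t = principal_matrix L t s *v x s"
proof -
  obtain X where X: "ode_solution (\<lambda>r Y. L r ** Y + 0) X" "X s = mat 1"
    using bilinear_ode_exists[OF bilinear_matrix_matrix L, of "\<lambda>t. 0" s "mat 1"]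
      locally_integrable_continuous[of "\<lambda>t. 0"] by auto
  have "(THE X. ode_solution (\<lambda>r Y. L r ** Y) X \<and> X s = mat 1) = X"
  proof (rule the_equality)
    fix Y assume "ode_solution (\<lambda>r Y. L r ** Y) Y \<and> Y s = mat 1"
    then show "Y = X"
      using bilinear_ode_unique[OF bilinear_matrix_matrix L, of "\<lambda>t. 0" Y X s] X by simp
  qed (use X in simp)
  then have P: "principal_matrix L t s = X t" for t by (simp add: principal_matrix_def)
  have lin: "bounded_linear (\<lambda>Y::real^'a^'a. Y *v x s)"
    using bilinear_matrix_vector linear_conv_bounded_linear unfolding bilinear_def by blast
  have "antideriv (\<lambda>r. X r *v x s) (\<lambda>r. (L r ** X r) *v x s)"
    using antideriv_linear[OF _ lin] X(1) by (simp add: ode_solution_iff_antideriv)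
  then have y: "ode_solution (\<lambda>t y. L t *v y) (\<lambda>r. X r *v x s)"
    by (simp add: ode_solution_iff_antideriv matrix_vector_mul_assoc)
  have "x = (\<lambda>r. X r *v x s)"
    using bilinear_ode_unique[OF bilinear_matrix_vector L, of "\<lambda>t. 0" x _ s] x y X(2) by simp
  then show ?thesis unfolding P by metis
qed

lemma exponentially_stable_decay:
  assumes "locally_integrable L" "exponentially_stable L"
  obtains K \<gamma> where "K \<ge> 1" "\<gamma> > 0" "\<And>x s t. ode_solution (\<lambda>t y. L t *v y) x \<Longrightarrow> s \<le> t \<Longrightarrow>
      norm (x t) \<le> K * exp (- \<gamma> * (t - s)) * norm (x s)"
proof -
  obtain K \<gamma> where K: "K \<ge> 1" "\<gamma> > 0" "\<And>s t. s \<le> t \<Longrightarrow>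
      onorm ((*v) (principal_matrix L t s)) \<le> K * exp (- \<gamma> * (t - s))"
    using assms(2) unfolding exponentially_stable_def by blast
  show thesis
  proof (rule that[OF K(1,2)])
    fix x s t assume x: "ode_solution (\<lambda>t y. L t *v y) x" "s \<le> (t::real)"
    have "norm (x t) \<le> onorm ((*v) (principal_matrix L t s)) * norm (x s)"
      unfolding principal_matrix_solution[OF assms(1) x(1), of t s]
      by (rule onorm[OF matrix_vector_mul_bounded_linear])
    also have "\<dots> \<le> K * exp (- \<gamma> * (t - s)) * norm (x s)"
      by (intro mult_right_mono K x) simp
    finally show "norm (x t) \<le> K * exp (- \<gamma> * (t - s)) * norm (x s)" .
  qed
qed

text \<open>Homogeneous solutions are differences of two trajectories of the boundary system with the
  same normal; hence their decay depends continuously on the coefficient function.\<close>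

lemma phi_diff_homogeneous:
  assumes x: "ode_solution (\<lambda>t y. rep_mat_fun \<omega> t *v y) x" and v: "norm v = 1"
  shows "fst (\<phi> \<rho> t \<omega> (x 0, v)) - fst (\<phi> \<rho> t \<omega> (0, v)) = x t"
proof -
  obtain z n where b: "boundary_solution (rep_mat_fun \<omega>) \<rho> z n" "z 0 = 0" "n 0 = v"
    by (rule boundary_solution_exists[OF locally_integrable_rep v]) (rule that)
  \<comment> \<open>Superposition: adding a homogeneous solution to the trajectory through 0 keeps
    the normal.\<close>
  have "antideriv (\<lambda>t. z t + x t) (\<lambda>t. (rep_mat_fun \<omega> t *v z t + \<rho> *\<^sub>R n t) + rep_mat_fun \<omega> t *v x t)"
    by (rule antideriv_add) (use b(1) x in \<open>simp_all only: boundary_solution_def ode_solution_iff_antideriv\<close>)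
  then have "antideriv (\<lambda>t. z t + x t) (\<lambda>t. rep_mat_fun \<omega> t *v (z t + x t) + \<rho> *\<^sub>R n t)"
    by (simp add: matrix_vector_right_distrib ac_simps)
  then have "boundary_solution (rep_mat_fun \<omega>) \<rho> (\<lambda>t. z t + x t) n"
    using b(1) by (simp add: boundary_solution_def ode_solution_iff_antideriv)
  from phi_eq[OF this, of t] phi_eq[OF b(1), of t] b show ?thesis by simp
qed

lemma continuous_skew_product_at:
  assumes c: "continuous_skew_product \<rho> \<delta> \<Omega>" and t: "t \<ge> 0"
  shows "continuous_map (state_space \<delta> \<Omega>) (state_space \<delta> \<Omega>) (skew_product \<rho> t)"
proof -
  have "continuous_map (state_space \<delta> \<Omega>) (prod_topology (top_of_set {0..}) (state_space \<delta> \<Omega>)) (\<lambda>z. (t, z))"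
    using t by (intro continuous_map_pairedI) (auto simp: continuous_map_const)
  from continuous_map_compose[OF this c[unfolded continuous_skew_product_def]]
  show ?thesis by (simp add: o_def)
qed

lemma continuous_phi_parameter:
  assumes c: "continuous_skew_product \<rho> \<delta> \<Omega>" and t: "t \<ge> 0" and p: "p \<in> UNIV \<times> sphere 0 1"
  shows "continuous_map (subtopology (Metric_space.mtopology UNIV \<delta>) \<Omega>) euclidean (\<lambda>\<omega>. fst (\<phi> \<rho> t \<omega> p))"
proof -
  let ?X = "subtopology (Metric_space.mtopology UNIV \<delta>) \<Omega>"
  have "continuous_map ?X (state_space \<delta> \<Omega>) (\<lambda>\<omega>. (\<omega>, p))"
    unfolding state_space_def using p
    by (intro continuous_map_pairedI) (auto simp: continuous_map_const)
  from continuous_map_compose[OF this continuous_skew_product_at[OF c t]]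
  have "continuous_map ?X (state_space \<delta> \<Omega>) (\<lambda>\<omega>. (translate t \<omega>, \<phi> \<rho> t \<omega> p))"
    by (simp add: o_def skew_product_def)
  from continuous_map_compose[OF this, of "top_of_set (UNIV \<times> sphere 0 1)" snd]
  have "continuous_map ?X (top_of_set (UNIV \<times> sphere 0 1)) (\<lambda>\<omega>. \<phi> \<rho> t \<omega> p)"
    by (simp add: o_def state_space_def continuous_map_snd)
  then have "continuous_map ?X euclidean (\<lambda>\<omega>. \<phi> \<rho> t \<omega> p)" by (simp add: continuous_map_in_subtopology)
  from continuous_map_compose[OF this, of euclidean fst] show ?thesis
    by (simp add: o_def continuous_on_fst continuous_on_id)
qed

text \<open>For a fixed elapsed time and initial vector the decay estimate is a closed condition on
  \<open>\<omega>\<close>. It holds on all translates of \<open>L\<close> with the constants of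
  \<open>L\<close>, and so it passes to their closure. Only the initial time 0 is treated this way;
  another initial time \<open>s\<close> is reduced to it by translating \<open>\<omega>\<close>,
  which stays in the hull.\<close>

lemma hull_stable_system:
  fixes L :: "real \<Rightarrow> real ^ 'n::finite ^ 'n"
  assumes \<rho>: "\<rho> > 0" and L: "locally_integrable L" and \<delta>: "Metric_space UNIV \<delta>"
    and \<Omega>: "\<Omega> = translation_hull \<delta> L" and inv: "\<And>\<omega> \<tau>. \<omega> \<in> \<Omega> \<Longrightarrow> translate \<tau> \<omega> \<in> \<Omega>"
    and st: "exponentially_stable L" and cont: "continuous_skew_product \<rho> \<delta> \<Omega>"
  obtains K \<gamma> where "\<And>\<omega>. \<omega> \<in> \<Omega> \<Longrightarrow> stable_system (rep_mat_fun \<omega>) \<rho> K \<gamma>"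
proof -
  interpret M: Metric_space UNIV \<delta> by (rule \<delta>)
  obtain K \<gamma> where K: "K \<ge> 1" "\<gamma> > 0" and dec: "\<And>x s t. ode_solution (\<lambda>t y. L t *v y) x \<Longrightarrow> s \<le> t \<Longrightarrow>
      norm (x t) \<le> K * exp (- \<gamma> * (t - s)) * norm (x s)"
    by (rule exponentially_stable_decay[OF L st]) (rule that)
  have LL: "loc_int_eq L L" using L by (simp add: loc_int_eq_def)
  \<comment> \<open>An arbitrary auxiliary normal; its contribution cancels in the difference of the
    two trajectories.\<close>
  obtain v :: "real^'n" where v: "norm v = 1" using vector_choose_size[of 1] by auto
  have hom: "\<exists>x. ode_solution (\<lambda>t y. rep_mat_fun \<omega> t *v y) x \<and> x 0 = c" for \<omega> :: "'n mat_fun" and c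
    using bilinear_ode_exists[OF bilinear_matrix_vector locally_integrable_rep[of \<omega>], of "\<lambda>t. 0" 0 c]
      locally_integrable_continuous[of "\<lambda>t. 0"] by auto
  define good where "good t c = {\<omega> \<in> \<Omega>. norm (fst (\<phi> \<rho> t \<omega> (c, v)) - fst (\<phi> \<rho> t \<omega> (0, v)))
      \<le> K * exp (- \<gamma> * t) * norm c}" for t c
  have closed_\<Omega>: "closedin M.mtopology \<Omega>" unfolding \<Omega> translation_hull_def by simp
  have "\<Omega> \<subseteq> good t c" if t: "t \<ge> 0" for t c
  proof -
    have "closedin (subtopology M.mtopology \<Omega>) {\<omega> \<in> topspace (subtopology M.mtopology \<Omega>).
        norm (fst (\<phi> \<rho> t \<omega> (c, v)) - fst (\<phi> \<rho> t \<omega> (0, v))) \<in> {..K * exp (- \<gamma> * t) * norm c}}"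
    proof (rule closedin_continuous_map_preimage[of _ euclidean])
      show "continuous_map (subtopology M.mtopology \<Omega>) euclidean
          (\<lambda>\<omega>. norm (fst (\<phi> \<rho> t \<omega> (c, v)) - fst (\<phi> \<rho> t \<omega> (0, v))))"
        by (intro continuous_map_norm continuous_map_diff continuous_phi_parameter[OF cont t])
           (use v in auto)
    qed simp
    then have "closedin (subtopology M.mtopology \<Omega>) (good t c)"
      by (simp add: good_def)
    then have "closedin M.mtopology (good t c)"
      using closed_\<Omega> closedin_trans_full by blast
    moreover have "range (\<lambda>\<tau>. translate \<tau> (abs_mat_fun L)) \<subseteq> good t c"
    proof clarify
      fix \<tau>
      let ?\<omega> = "translate \<tau> (abs_mat_fun L)"
      have "?\<omega> \<in> \<Omega>"
        using closure_of_subset[of "range (\<lambda>\<tau>. translate \<tau> (abs_mat_fun L))" M.mtopology]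
        unfolding \<Omega> translation_hull_def by auto
      moreover obtain x where x: "ode_solution (\<lambda>t y. rep_mat_fun ?\<omega> t *v y) x" "x 0 = c"
        using hom by blast
      have "loc_int_eq (rep_mat_fun ?\<omega>) (\<lambda>t. L (t + \<tau>))"
        unfolding translate.abs_eq[OF LL] by (rule loc_int_eq_rep_abs[OF loc_int_eq_translate[OF LL]])
      from ode_solution_cong_loc_int_eq[OF this, of "\<lambda>t A y. A *v y", OF x(1)]
      have "ode_solution (\<lambda>t y. L t *v y) (\<lambda>t. x (t - \<tau>))"
        using ode_solution_shift[of "\<lambda>t y. L (t + \<tau>) *v y" x "- \<tau>"] by simp
      from dec[OF this, of \<tau> "\<tau> + t"] t x(2)
      have "norm (x t) \<le> K * exp (- \<gamma> * t) * norm c" by simp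
      ultimately show "?\<omega> \<in> good t c"
        unfolding good_def using phi_diff_homogeneous[OF x(1) v, of \<rho> t] x(2) by simp
    qed
    ultimately show "\<Omega> \<subseteq> good t c"
      unfolding \<Omega> translation_hull_def by (rule closure_of_minimal[rotated])
  qed
  then have good: "norm (fst (\<phi> \<rho> t \<omega> (c, v)) - fst (\<phi> \<rho> t \<omega> (0, v))) \<le> K * exp (- \<gamma> * t) * norm c"
    if "t \<ge> 0" "\<omega> \<in> \<Omega>" for t c \<omega> using that unfolding good_def by blast
  have "stable_system (rep_mat_fun \<omega>) \<rho> K \<gamma>" if \<omega>: "\<omega> \<in> \<Omega>" for \<omega>
  proof (unfold_locales, rule locally_integrable_rep, rule \<rho>, rule K, rule K)
    fix x s t assume x: "ode_solution (\<lambda>t y. rep_mat_fun \<omega> t *v y) x" and st: "s \<le> (t::real)"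
    have "ode_solution (\<lambda>t y. rep_mat_fun (translate s \<omega>) t *v y) (\<lambda>t. x (t + s))"
      by (rule ode_solution_cong_loc_int_eq[OF loc_int_eq_sym[OF loc_int_eq_rep_translate], of "\<lambda>t A y. A *v y"])
         (rule ode_solution_shift[OF x])
    from phi_diff_homogeneous[OF this v, of \<rho> "t - s"]
    have "x t = fst (\<phi> \<rho> (t - s) (translate s \<omega>) (x s, v)) - fst (\<phi> \<rho> (t - s) (translate s \<omega>) (0, v))"
      by simp
    then show "norm (x t) \<le> K * exp (- \<gamma> * (t - s)) * norm (x s)"
      using good[of "t - s" "translate s \<omega>" "x s"] inv[OF \<omega>, of s] st by simp
  qed
  then show thesis by (rule that)
qed

section \<open>Attractors of the skew-product flow\<close>

lemma semidist_le:
  assumes "\<And>x. x \<in> C \<Longrightarrow> \<exists>y\<in>D. d x y \<le> e"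
  shows "semidist d C D \<le> ennreal e"
  unfolding semidist_def
proof (rule SUP_least)
  fix x assume "x \<in> C"
  then obtain y where "y \<in> D" "d x y \<le> e" using assms by blast
  then show "(INF y\<in>D. ennreal (d x y)) \<le> ennreal e"
    by (intro INF_lower2[of y]) (auto intro: ennreal_leI)
qed

lemma semidist_tendsto_0:
  assumes "\<forall>\<^sub>F t in F. \<forall>x\<in>C t. \<exists>y\<in>D t. d x y \<le> f t" and f: "(f \<longlongrightarrow> 0) F"
  shows "((\<lambda>t. semidist d (C t) (D t)) \<longlongrightarrow> 0) F"
proof (rule tendsto_sandwich[of "\<lambda>_. 0" _ F "\<lambda>t. ennreal (f t)"])
  show "\<forall>\<^sub>F t in F. semidist d (C t) (D t) \<le> ennreal (f t)"
    by (rule eventually_mono[OF assms(1)]) (auto intro: semidist_le)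
  show "((\<lambda>t. ennreal (f t)) \<longlongrightarrow> 0) F" using tendsto_ennrealI[OF f] by simp
qed auto

text \<open>Typical use: a point that invariance places in every \<open>C t\<close> belongs to the
  attracting set.\<close>

lemma mem_of_semidist_tendsto_0:
  fixes C :: "real \<Rightarrow> 'a::metric_space set"
  assumes lim: "((\<lambda>t. semidist dist (C t) P) \<longlongrightarrow> 0) at_top" and p: "\<And>t. t \<ge> 0 \<Longrightarrow> p \<in> C t"
    and P: "closed P" "P \<noteq> {}"
  shows "p \<in> P"
proof -
  have "infdist p P \<le> 0"
  proof (rule field_le_epsilon)
    fix e :: real assume e: "e > 0"
    have "\<forall>\<^sub>F t in at_top. semidist dist (C t) P < ennreal e"
      by (rule order_tendstoD(2)[OF lim]) (use e in simp)
    from eventually_happens'[OF trivial_limit_at_top_linorder eventually_conj[OF eventually_ge_at_top[of 0] this]]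
    obtain t where t: "t \<ge> 0" "semidist dist (C t) P < ennreal e"
      by blast
    have "(INF y\<in>P. ennreal (dist p y)) \<le> semidist dist (C t) P"
      unfolding semidist_def by (rule SUP_upper) (rule p[OF t(1)])
    then obtain y where "y \<in> P" "ennreal (dist p y) < ennreal e"
      using t(2) by (meson INF_less_iff le_less_trans)
    then have "dist p y < e" "y \<in> P" using e by (simp_all add: ennreal_less_iff)
    then show "infdist p P \<le> 0 + e" using infdist_le2 by fastforce
  qed
  then have "infdist p P = 0" using infdist_nonneg[of p P] by simp
  then show ?thesis using P in_closed_iff_infdist_zero by blast
qed

text \<open>One pair \<open>K\<close>, \<open>\<gamma>\<close> for all \<open>\<omega>\<close>:
  attraction over a moving base point calls for an estimate that is uniform in
  \<open>\<omega>\<close>.\<close>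

locale stable_hull =
  fixes \<rho> K \<gamma> :: real and \<delta> :: "'n::finite mat_fun \<Rightarrow> 'n mat_fun \<Rightarrow> real" and \<Omega> :: "'n mat_fun set"
  assumes metric: "Metric_space UNIV \<delta>" and nonempty: "\<Omega> \<noteq> {}"
    and translate: "\<omega> \<in> \<Omega> \<Longrightarrow> translate \<tau> \<omega> \<in> \<Omega>"
    and cont: "continuous_skew_product \<rho> \<delta> \<Omega>"
    and stable: "\<omega> \<in> \<Omega> \<Longrightarrow> stable_system (rep_mat_fun \<omega>) \<rho> K \<gamma>"
begin

definition "Att \<omega> = stable_system.attr (rep_mat_fun \<omega>) \<rho> K \<gamma>"
definition "Nor \<omega> = stable_system.normals (rep_mat_fun \<omega>) \<rho> K \<gamma>"
text \<open>The radius \<open>R\<close> of the single systems, which depends on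
  \<open>\<rho>\<close>, \<open>K\<close> and \<open>\<gamma>\<close> alone.\<close>

definition "r = \<rho> * K / \<gamma>"

lemma R_eq: "\<omega> \<in> \<Omega> \<Longrightarrow> stable_system.R \<rho> K \<gamma> = r"
  using stable_system.R_def[OF stable] by (simp add: r_def)

lemma K_ge_1: "K \<ge> 1" and r_pos: "r > 0"
  using nonempty stable stable_system.K stable_system.R_pos R_eq by fastforce+

lemma decay_at_top: "((\<lambda>t. K * exp (- \<gamma> * t) * C) \<longlongrightarrow> 0) at_top"
  using nonempty stable_system.decay_at_top[OF stable, of _ 0 C] by auto

lemma Nor_def': "\<omega> \<in> \<Omega> \<Longrightarrow> Nor \<omega> = {(x 0, n 0) | x n. boundary_solution (rep_mat_fun \<omega>) \<rho> x n \<and> (\<forall>t. norm (x t) \<le> r)}"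
  using stable_system.normals_def[OF stable] R_eq by (simp add: Nor_def)

lemma normal_bundle_Att: "\<omega> \<in> \<Omega> \<Longrightarrow> normal_bundle (Att \<omega> 0) = Nor \<omega>"
  unfolding Att_def Nor_def
  by (simp add: normal_bundle_compact_convex stable_system.compact_attr stable_system.convex_attr
      stable_system.normals_eq stable)

lemma compact_Nor: "\<omega> \<in> \<Omega> \<Longrightarrow> compact (Nor \<omega>)"
  using compact_normal_bundle stable_system.compact_attr[OF stable] stable_system.convex_attr[OF stable]
  by (metis normal_bundle_Att Att_def)

lemma Nor_sphere: "\<omega> \<in> \<Omega> \<Longrightarrow> Nor \<omega> \<subseteq> UNIV \<times> sphere 0 1"
  by (auto simp: Nor_def' boundary_solution_def)

lemma Nor_subset_Att: "\<omega> \<in> \<Omega> \<Longrightarrow> Nor \<omega> \<subseteq> Att \<omega> 0 \<times> sphere 0 1"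
  unfolding Att_def Nor_def using stable_system.normals_eq[OF stable] by auto

lemma Nor_subset: "\<omega> \<in> \<Omega> \<Longrightarrow> Nor \<omega> \<subseteq> cball 0 r \<times> sphere 0 1"
  by (auto simp: Nor_def' boundary_solution_def)

lemma Nor_ex:
  assumes "\<omega> \<in> \<Omega>" "norm v = 1"
  obtains x n where "boundary_solution (rep_mat_fun \<omega>) \<rho> x n" "n 0 = v" "\<And>t. norm (x t) \<le> r"
    "(x 0, v) \<in> Nor \<omega>"
proof -
  obtain x n where b: "boundary_solution (rep_mat_fun \<omega>) \<rho> x n" "n 0 = v" "\<And>t. norm (x t) \<le> stable_system.R \<rho> K \<gamma>"
    by (rule stable_system.boundary_exists[OF stable[OF assms(1)] assms(2), of 0]) (rule that)
  then have x: "\<And>t. norm (x t) \<le> r" by (simp only: R_eq[OF assms(1)])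
  have "(x 0, v) \<in> Nor \<omega>" unfolding Nor_def'[OF assms(1)] using b(1,2) x by blast
  then show thesis by (rule that[OF b(1,2) x])
qed

lemma Nor_nonempty: "\<omega> \<in> \<Omega> \<Longrightarrow> Nor \<omega> \<noteq> {}"
proof -
  assume \<omega>: "\<omega> \<in> \<Omega>"
  obtain v :: "real^'n" where v: "norm v = 1" using vector_choose_size[of 1] by auto
  show ?thesis by (rule Nor_ex[OF \<omega> v]) auto
qed

section \<open>Invariance and attraction of the normal bundles\<close>

lemma phi_Nor_subset:
  assumes "\<omega> \<in> \<Omega>"
  shows "\<phi> \<rho> t \<omega> ` Nor \<omega> \<subseteq> Nor (translate t \<omega>)"
proof (rule image_subsetI)
  fix q assume "q \<in> Nor \<omega>"
  then obtain x n where b: "boundary_solution (rep_mat_fun \<omega>) \<rho> x n" "\<forall>t. norm (x t) \<le> r" "q = (x 0, n 0)"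
    unfolding Nor_def'[OF assms] by blast
  have "(x (0 + t), n (0 + t)) \<in> Nor (translate t \<omega>)"
    unfolding Nor_def'[OF translate[OF assms]]
    by (intro CollectI exI[of _ "\<lambda>s. x (s + t)"] exI[of _ "\<lambda>s. n (s + t)"] conjI refl
        boundary_solution_translate[OF b(1)]) (use b(2) in simp)
  then show "\<phi> \<rho> t \<omega> q \<in> Nor (translate t \<omega>)" using phi_eq[OF b(1), of t] b(3) by simp
qed

text \<open>Bounded entire solutions may be shifted in time by either sign, so the inclusion at time
  \<open>- t\<close> supplies the preimages.\<close>

lemma phi_Nor:
  assumes \<omega>: "\<omega> \<in> \<Omega>"
  shows "\<phi> \<rho> t \<omega> ` Nor \<omega> = Nor (translate t \<omega>)"
proof (intro equalityI phi_Nor_subset[OF \<omega>] subsetI)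
  fix q assume q: "q \<in> Nor (translate t \<omega>)"
  let ?q = "\<phi> \<rho> (- t) (translate t \<omega>) q"
  have "?q \<in> Nor \<omega>" using phi_Nor_subset[OF translate[OF \<omega>], of "- t" t] q by auto
  have qs: "q \<in> UNIV \<times> sphere 0 1" using q Nor_sphere[OF translate[OF \<omega>]] by blast
  have "\<phi> \<rho> t \<omega> ?q = \<phi> \<rho> (t + - t) (translate t \<omega>) q"
    using phi_add[OF qs, of \<rho> t "- t" "translate t \<omega>"] by simp
  also have "\<dots> = q"
  proof -
    obtain x n where "q = (x 0, n 0)" "\<And>s. \<phi> \<rho> s (translate t \<omega>) q = (x s, n s)"
      by (rule phi_obtain[OF qs, of "translate t \<omega>" \<rho>]) (rule that)
    then show ?thesis by simp
  qed
  finally show "q \<in> \<phi> \<rho> t \<omega> ` Nor \<omega>" using \<open>?q \<in> Nor \<omega>\<close> by force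
qed

text \<open>The comparison point has the same initial normal, hence the same normal at all times,
  and both states are driven by one control. Besides \<open>M\<close> the bound contains only
  constants common to the hull, so it serves pullback attraction and the attraction of compact sets
  alike.\<close>

lemma phi_near_Nor:
  assumes \<omega>: "\<omega> \<in> \<Omega>" and p: "p \<in> cball 0 M \<times> sphere 0 1" and t: "t \<ge> 0"
  shows "\<exists>q\<in>Nor (translate t \<omega>). dist (\<phi> \<rho> t \<omega> p) q \<le> K * exp (- \<gamma> * t) * (M + r)"
proof -
  have ps: "p \<in> UNIV \<times> sphere 0 1" using p by auto
  obtain x n where b: "boundary_solution (rep_mat_fun \<omega>) \<rho> x n" "p = (x 0, n 0)" "\<And>t. \<phi> \<rho> t \<omega> p = (x t, n t)"
    by (rule phi_obtain[OF ps, of \<omega> \<rho>]) (rule that)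
  have nv: "norm (n 0) = 1" using b(1) by (simp add: boundary_solution_def)
  obtain x' n' where b': "boundary_solution (rep_mat_fun \<omega>) \<rho> x' n'" "n' 0 = n 0" "\<And>t. norm (x' t) \<le> r"
    "(x' 0, n 0) \<in> Nor \<omega>"
    by (rule Nor_ex[OF \<omega> nv]) (rule that)
  have n: "n' = n"
    by (rule normal_field_unique[OF locally_integrable_rep[of \<omega>], where a = 0])
       (use b(1) b'(1,2) in \<open>auto simp: boundary_solution_def\<close>)
  have "norm (x t - x' t) \<le> K * exp (- \<gamma> * (t - 0)) * norm (x 0 - x' 0)"
    using stable_system.control_solution_decay[OF stable[OF \<omega>] boundary_solution_imp_control_solution[OF b(1)]
      boundary_solution_imp_control_solution[OF b'(1)[unfolded n]] t] .
  also have "\<dots> \<le> K * exp (- \<gamma> * (t - 0)) * (M + r)"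
  proof (rule mult_left_mono)
    show "norm (x 0 - x' 0) \<le> M + r"
      using norm_triangle_ineq4[of "x 0" "x' 0"] p b(2) b'(3)[of 0] by auto
  qed (use K_ge_1 in simp)
  finally have "dist (\<phi> \<rho> t \<omega> p) (x' t, n' t) \<le> K * exp (- \<gamma> * t) * (M + r)"
    by (simp add: b(3) n dist_Pair_Pair dist_norm)
  moreover have "(x' t, n' t) \<in> Nor (translate t \<omega>)"
    using phi_Nor_subset[OF \<omega>, of t] b'(4) phi_eq[OF b'(1), of t] b'(2) by force
  ultimately show ?thesis by blast
qed

lemma phi_bound:
  assumes \<omega>: "\<omega> \<in> \<Omega>" and p: "p \<in> cball 0 M \<times> sphere 0 1" and t: "t \<ge> 0"
  shows "\<phi> \<rho> t \<omega> p \<in> cball 0 (K * M + r) \<times> sphere 0 1"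
proof -
  have ps: "p \<in> UNIV \<times> sphere 0 1" using p by auto
  obtain x n where b: "boundary_solution (rep_mat_fun \<omega>) \<rho> x n" "p = (x 0, n 0)" "\<And>t. \<phi> \<rho> t \<omega> p = (x t, n t)"
    by (rule phi_obtain[OF ps, of \<omega> \<rho>]) (rule that)
  have "norm (x t) \<le> K * exp (- \<gamma> * (t - 0)) * norm (x 0) + r"
    using stable_system.control_solution_bound[OF stable[OF \<omega>] boundary_solution_imp_control_solution[OF b(1)] t]
    by (simp only: R_eq[OF \<omega>])
  moreover have "K * exp (- \<gamma> * (t - 0)) * norm (x 0) \<le> K * M"
    by (rule mult_mono[OF stable_system.decay_factor_le[OF stable[OF \<omega>] t]]) (use p b(2) K_ge_1 in auto)
  ultimately have "norm (x t) \<le> K * M + r" by linarith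
  then show ?thesis using b(1) by (simp add: b(3) boundary_solution_def)
qed

lemma mem_Nor:
  assumes \<omega>: "\<omega> \<in> \<Omega>" and q: "\<And>t. t \<ge> 0 \<Longrightarrow> infdist q (Nor \<omega>) \<le> K * exp (- \<gamma> * t) * C"
  shows "q \<in> Nor \<omega>"
proof -
  have "infdist q (Nor \<omega>) \<le> 0"
    by (rule tendsto_lowerbound[OF decay_at_top[of C]])
       (use q in \<open>auto intro: eventually_mono[OF eventually_ge_at_top[of 0]]\<close>)
  then have "infdist q (Nor \<omega>) = 0" using infdist_nonneg[of q "Nor \<omega>"] by simp
  then show ?thesis
    using compact_imp_closed[OF compact_Nor[OF \<omega>]] Nor_nonempty[OF \<omega>] in_closed_iff_infdist_zero by blast
qed

lemma bounded_obtain: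
  assumes "bounded D" "D \<subseteq> UNIV \<times> sphere 0 (1::real)"
  obtains M where "D \<subseteq> cball (0::real^'n) M \<times> sphere (0::real^'n) 1"
proof -
  obtain M where "\<And>d. d \<in> D \<Longrightarrow> norm d \<le> M" using assms(1) bounded_iff by blast
  then have "D \<subseteq> cball 0 M \<times> sphere 0 1"
    using assms(2) by (force simp: mem_Times_iff intro: order_trans[OF norm_fst_le])
  then show thesis by (rule that)
qed

section \<open>Existence and uniqueness of the uniform attractors\<close>

lemma uniform_attractor_Att:
  assumes \<omega>: "\<omega> \<in> \<Omega>"
  shows "uniform_attractor \<rho> \<omega> (Att \<omega>)"
proof -
  interpret S: stable_system "rep_mat_fun \<omega>" \<rho> K \<gamma> by (rule stable[OF \<omega>])
  have A: "Att \<omega> = S.attr" by (simp add: Att_def)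
  note inv = S.control_reach_attr[OF less_imp_le]
  have min: "C = S.attr" if C: "\<And>t. closed (C t)" "\<And>t. C t \<subseteq> S.attr t" "C a \<noteq> {}" "invariant_family \<rho> \<omega> C" for C a
  proof
    fix t
    have Ci: "control_reach (rep_mat_fun \<omega>) \<rho> t s (C s) = C t" if "s < t" for s t
      using C(4) that by (simp add: invariant_family_def reach_eq_control_reach)
    \<comment> \<open>Nonemptiness spreads from time \<open>a\<close>: backwards because
      \<open>C a\<close> is the image of each earlier fibre, forwards by following the zero
      control.\<close>
    have "C s \<noteq> {}" for s
    proof (cases s a rule: linorder_cases)
      case less
      then show ?thesis using Ci[OF less] C(3) by (auto simp: control_reach_def)
    next
      case greater
      obtain c where "c \<in> C a" using C(3) by blast
      moreover obtain x where "control_solution (rep_mat_fun \<omega>) \<rho> (\<lambda>t. 0) x" "x a = c"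
        by (rule S.control_solution_exists[of "\<lambda>t. 0" a c]) (auto intro: that)
      ultimately show ?thesis using Ci[OF greater] unfolding control_reach_def by blast
    qed (use C in simp)
    then have "S.attr t \<subseteq> C t"
      by (intro S.invariant_subset[OF inv, where M = S.R and M' = S.R] Ci C S.attr_le_R) (use C(2) S.attr_le_R in blast)+
    then show "C t = S.attr t" using C(2) by blast
  qed
  have near: "\<exists>q\<in>S.attr t. dist p q \<le> K * exp (- \<gamma> * (t - s)) * (M + S.R)"
    if p: "p \<in> reach \<rho> \<omega> t s C" and C: "\<And>c. c \<in> C \<Longrightarrow> norm c \<le> M" and st: "s < t" for p s t C M
  proof -
    obtain q where "q \<in> control_reach (rep_mat_fun \<omega>) \<rho> t s (S.attr s)"
      "dist p q \<le> K * exp (- \<gamma> * (t - s)) * (M + S.R)"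
      by (rule S.control_reach_near[OF p[unfolded reach_eq_control_reach] C S.attr_le_R S.attr_nonempty less_imp_le[OF st]])
    then show ?thesis using inv[OF st] by blast
  qed
  show ?thesis
    unfolding uniform_attractor_def A
  proof (intro conjI allI impI)
    show "\<exists>r. \<forall>t. S.attr t \<subseteq> cball 0 r" using S.attr_le_R by (intro exI[of _ S.R]) auto
    show "invariant_family \<rho> \<omega> S.attr" using inv by (simp add: invariant_family_def reach_eq_control_reach)
    fix C assume "(\<forall>t. closed (C t) \<and> C t \<subseteq> S.attr t) \<and> (\<exists>t. C t \<noteq> {}) \<and> invariant_family \<rho> \<omega> C"
    then show "C = S.attr" using min by blast
  next
    fix C :: "(real^'n) set" and t assume "C \<noteq> {} \<and> compact C"
    then have "bounded C" using compact_imp_bounded by blast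
    then obtain M where M: "\<And>c. c \<in> C \<Longrightarrow> norm c \<le> M" unfolding bounded_iff by blast
    show "((\<lambda>s. semidist dist (reach \<rho> \<omega> t s C) (S.attr t)) \<longlongrightarrow> 0) at_bot"
      by (rule semidist_tendsto_0[OF eventually_mono[OF eventually_gt_at_bot[of t]] S.decay_at_bot[of t "M + S.R"]],
          rule ballI, rule near[OF _ M])
    show "((\<lambda>t'. semidist dist (reach \<rho> \<omega> t' t C) (S.attr t')) \<longlongrightarrow> 0) at_top"
      by (rule semidist_tendsto_0[OF eventually_mono[OF eventually_gt_at_top[of t]] S.decay_at_top[of t "M + S.R"]],
          rule ballI, rule near[OF _ M])
  qed (use S.attr_nonempty S.compact_attr in auto)
qed

text \<open>Two applications of \<open>invariant_subset\<close> in opposite directions. The theorem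
  speaks of an arbitrary choice of attractors, which is thereby reduced to
  \<open>Att\<close>.\<close>

lemma uniform_attractor_unique:
  assumes \<omega>: "\<omega> \<in> \<Omega>" and A: "uniform_attractor \<rho> \<omega> A"
  shows "A = Att \<omega>"
proof -
  interpret S: stable_system "rep_mat_fun \<omega>" \<rho> K \<gamma> by (rule stable[OF \<omega>])
  have A': "\<exists>r. \<forall>t. A t \<subseteq> cball 0 r" "\<forall>t. A t \<noteq> {} \<and> compact (A t)" "invariant_family \<rho> \<omega> A"
    using A by (simp_all only: uniform_attractor_def simp_thms)
  obtain M where "\<forall>t. A t \<subseteq> cball 0 M" using A'(1) by blast
  then have M': "norm c \<le> M" if "c \<in> A t" for t c using that by (meson mem_cball_0 subsetD)
  have ne: "\<And>t. A t \<noteq> {}" and cl: "\<And>t. closed (A t)" using A'(2) by (auto intro: compact_imp_closed)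
  have Ai: "\<And>s t. s < t \<Longrightarrow> control_reach (rep_mat_fun \<omega>) \<rho> t s (A s) = A t"
    using A'(3) by (simp add: invariant_family_def reach_eq_control_reach)
  note Si = S.control_reach_attr[OF less_imp_le]
  have "A t \<subseteq> S.attr t" for t
    by (rule S.invariant_subset[where A = A and C = S.attr and M = M and M' = S.R])
       (use Ai M' Si S.attr_le_R S.attr_nonempty compact_imp_closed[OF S.compact_attr] in auto)
  moreover have "S.attr t \<subseteq> A t" for t
    by (rule S.invariant_subset[where A = S.attr and C = A and M = S.R and M' = M])
       (use Ai M' Si S.attr_le_R ne cl in auto)
  ultimately have "A t = S.attr t" for t by blast
  then show ?thesis by (auto simp: Att_def)
qed

lemma Att_subset: "\<omega> \<in> \<Omega> \<Longrightarrow> Att \<omega> t \<subseteq> cball 0 r"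
  using stable_system.attr_le_R[OF stable] R_eq by (auto simp: Att_def)

section \<open>The pullback attractor and its representation as a limit set\<close>

lemma Nor_attracts:
  assumes \<omega>: "\<omega> \<in> \<Omega>" and D: "bounded D" "D \<subseteq> UNIV \<times> sphere 0 1"
  shows "((\<lambda>t. semidist dist (\<phi> \<rho> t (translate (- t) \<omega>) ` D) (Nor \<omega>)) \<longlongrightarrow> 0) at_top"
proof -
  obtain M where M: "D \<subseteq> cball 0 M \<times> sphere 0 1" by (rule bounded_obtain[OF D])
  have "\<exists>y\<in>Nor \<omega>. dist x y \<le> K * exp (- \<gamma> * t) * (M + r)"
    if "t \<ge> 0" "x \<in> \<phi> \<rho> t (translate (- t) \<omega>) ` D" for t x
    using phi_near_Nor[OF translate[OF \<omega>, of "- t"] _ that(1), of _ M] that(2) M by auto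
  then show ?thesis
    by (intro semidist_tendsto_0[OF _ decay_at_top[of "M + r"]] eventually_mono[OF eventually_ge_at_top[of 0]])
       blast
qed

lemma pullback_attractor_Nor: "pullback_attractor \<rho> \<Omega> Nor"
  unfolding pullback_attractor_def
  using Nor_nonempty compact_Nor Nor_sphere phi_Nor Nor_attracts by simp

lemma backward_bounded_Nor: "backward_bounded \<Omega> Nor"
  unfolding backward_bounded_def
proof
  fix \<omega> assume \<omega>: "\<omega> \<in> \<Omega>"
  have "bounded (cball (0::real^'n) r \<times> sphere (0::real^'n) 1)"
    by (intro bounded_Times bounded_cball) (simp add: bounded_subset[OF bounded_cball sphere_cball])
  then show "bounded (\<Union>t\<in>{0..}. Nor (translate (- t) \<omega>))"
    by (rule bounded_subset) (use Nor_subset[OF translate[OF \<omega>]] in blast)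
qed

lemma pullback_attractor_cong:
  assumes "\<And>\<omega>. \<omega> \<in> \<Omega> \<Longrightarrow> P \<omega> = Q \<omega>"
  shows "unique_pullback_attractor \<rho> \<Omega> P \<longleftrightarrow> unique_pullback_attractor \<rho> \<Omega> Q"
  unfolding unique_pullback_attractor_def pullback_attractor_def backward_bounded_def
  using assms translate by simp

text \<open>A point of an invariant family lies, for every \<open>t\<close>, in the
  time-\<open>t\<close> image of the union of the past fibres. When this union is bounded, the
  competing family attracts it and therefore contains the point. For \<open>Nor\<close> the union is
  always bounded, which gives \<open>Nor \<omega> \<subseteq> P \<omega>\<close>; the reverse
  inclusion takes the bound from \<open>backward_bounded \<Omega> P\<close>.\<close>

lemma unique_pullback_attractor_Nor: "unique_pullback_attractor \<rho> \<Omega> Nor"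
  unfolding unique_pullback_attractor_def
proof (intro conjI allI impI ballI pullback_attractor_Nor backward_bounded_Nor)
  fix P \<omega> assume P: "pullback_attractor \<rho> \<Omega> P" and \<omega>: "\<omega> \<in> \<Omega>"
  have Pc: "compact (P \<omega>)" "P \<omega> \<noteq> {}" using P \<omega> by (auto simp: pullback_attractor_def)
  have attr: "((\<lambda>t. semidist dist (\<phi> \<rho> t (translate (- t) \<omega>) ` D) (P \<omega>)) \<longlongrightarrow> 0) at_top"
    if "D \<noteq> {}" "bounded D" "D \<subseteq> UNIV \<times> sphere 0 1" for D
    using P \<omega> that unfolding pullback_attractor_def by blast
  show sub: "Nor \<omega> \<subseteq> P \<omega>"
  proof
    fix p assume p: "p \<in> Nor \<omega>"
    let ?D = "\<Union>t\<in>{0..}. Nor (translate (- t) \<omega>)"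
    have D: "?D \<subseteq> UNIV \<times> sphere 0 1" using Nor_sphere[OF translate[OF \<omega>]] by blast
    have D0: "?D \<noteq> {}" using p by (auto intro!: bexI[of _ 0])
    have Db: "bounded ?D" using backward_bounded_Nor \<omega> by (simp add: backward_bounded_def)
    show "p \<in> P \<omega>"
    proof (rule mem_of_semidist_tendsto_0[OF attr[OF D0 Db D] _ compact_imp_closed[OF Pc(1)] Pc(2)])
      fix t :: real assume t: "t \<ge> 0"
      have "\<phi> \<rho> t (translate (- t) \<omega>) ` Nor (translate (- t) \<omega>) = Nor \<omega>"
        using phi_Nor[OF translate[OF \<omega>], of t "- t"] by simp
      then show "p \<in> \<phi> \<rho> t (translate (- t) \<omega>) ` ?D" using p t by blast
    qed
  qed
  assume b: "backward_bounded \<Omega> P"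
  have "P \<omega> \<subseteq> Nor \<omega>"
  proof
    fix p assume p: "p \<in> P \<omega>"
    let ?D = "\<Union>t\<in>{0..}. P (translate (- t) \<omega>)"
    have D: "?D \<subseteq> UNIV \<times> sphere 0 1" using P translate[OF \<omega>] by (force simp: pullback_attractor_def)
    have D0: "?D \<noteq> {}" using p by (auto intro!: bexI[of _ 0])
    have Db: "bounded ?D" using b \<omega> by (simp add: backward_bounded_def)
    note lim = Nor_attracts[OF \<omega> Db D]
    show "p \<in> Nor \<omega>"
    proof (rule mem_of_semidist_tendsto_0[OF lim _ compact_imp_closed[OF compact_Nor[OF \<omega>]] Nor_nonempty[OF \<omega>]])
      fix t :: real assume t: "t \<ge> 0"
      have "\<phi> \<rho> t (translate (- t) \<omega>) ` P (translate (- t) \<omega>) = P (translate t (translate (- t) \<omega>))"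
        using P translate[OF \<omega>] t unfolding pullback_attractor_def by blast
      then have "\<phi> \<rho> t (translate (- t) \<omega>) ` P (translate (- t) \<omega>) = P \<omega>" by simp
      then show "p \<in> \<phi> \<rho> t (translate (- t) \<omega>) ` ?D" using p t by blast
    qed
  qed
  with sub show "P \<omega> = Nor \<omega>" by blast
qed

text \<open>Invariance places \<open>Nor \<omega>\<close> in each of the unions, since its past
  fibres lie over \<open>B\<close>. Conversely each union, and so its closure, lies in a closed
  neighbourhood of \<open>Nor \<omega>\<close> whose radius shrinks exponentially.\<close>

lemma Nor_eq_limit_set:
  assumes B: "bounded B" "\<And>\<omega> t. \<omega> \<in> \<Omega> \<Longrightarrow> Att \<omega> t \<subseteq> B" and \<omega>: "\<omega> \<in> \<Omega>"
  shows "Nor \<omega> = (\<Inter>t\<in>{0..}. closure (\<Union>\<tau>\<in>{t..}. \<phi> \<rho> \<tau> (translate (- \<tau>) \<omega>) ` (B \<times> sphere 0 1)))"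
proof (intro equalityI subsetI)
  fix q assume q: "q \<in> Nor \<omega>"
  have "q \<in> (\<Union>\<tau>\<in>{t..}. \<phi> \<rho> \<tau> (translate (- \<tau>) \<omega>) ` (B \<times> sphere 0 1))" for t
  proof -
    have "q \<in> \<phi> \<rho> t (translate (- t) \<omega>) ` Nor (translate (- t) \<omega>)"
      using phi_Nor[OF translate[OF \<omega>], of t "- t"] q by simp
    moreover have "Nor (translate (- t) \<omega>) \<subseteq> B \<times> sphere 0 1"
      using Nor_subset_Att[OF translate[OF \<omega>]] B(2)[OF translate[OF \<omega>]] by blast
    ultimately show ?thesis by (intro UN_I[of t]) auto
  qed
  then show "q \<in> (\<Inter>t\<in>{0..}. closure (\<Union>\<tau>\<in>{t..}. \<phi> \<rho> \<tau> (translate (- \<tau>) \<omega>) ` (B \<times> sphere 0 1)))"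
    using closure_subset by blast
next
  fix q assume q: "q \<in> (\<Inter>t\<in>{0..}. closure (\<Union>\<tau>\<in>{t..}. \<phi> \<rho> \<tau> (translate (- \<tau>) \<omega>) ` (B \<times> sphere 0 1)))"
  obtain M where M: "\<And>b. b \<in> B \<Longrightarrow> norm b \<le> M" using B(1) unfolding bounded_iff by blast
  \<comment> \<open>The sign makes the radius nonincreasing in time; \<open>B\<close> has a point
    because the fibres have one.\<close>
  have M0: "0 \<le> M + r"
  proof -
    have "\<exists>b. b \<in> B" using B(2)[OF \<omega>] Nor_nonempty[OF \<omega>] Nor_subset_Att[OF \<omega>] by blast
    then show ?thesis using M norm_ge_zero r_pos by (smt (verit))
  qed
  show "q \<in> Nor \<omega>"
  proof (rule mem_Nor[OF \<omega>, of _ "M + r"])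
    fix t :: real assume t: "t \<ge> 0"
    define Z where "Z = {z. infdist z (Nor \<omega>) \<le> K * exp (- \<gamma> * t) * (M + r)}"
    have "closed Z" unfolding Z_def by (intro closed_Collect_le continuous_intros)
    moreover have "(\<Union>\<tau>\<in>{t..}. \<phi> \<rho> \<tau> (translate (- \<tau>) \<omega>) ` (B \<times> sphere 0 1)) \<subseteq> Z"
    proof (intro UN_least image_subsetI)
      fix \<tau> z assume \<tau>': "\<tau> \<in> {t..}" "z \<in> B \<times> sphere (0::real^'n) 1"
      then obtain b v where z: "z = (b, v)" and \<tau>: "\<tau> \<in> {t..}" "b \<in> B" "v \<in> sphere (0::real^'n) 1" by auto
      then have "(b, v) \<in> cball 0 M \<times> sphere 0 1" "\<tau> \<ge> 0" using M t by auto
      from phi_near_Nor[OF translate[OF \<omega>, of "- \<tau>"] this]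
      obtain y where y: "y \<in> Nor \<omega>" "dist (\<phi> \<rho> \<tau> (translate (- \<tau>) \<omega>) (b, v)) y \<le> K * exp (- \<gamma> * \<tau>) * (M + r)"
        by auto
      have "\<gamma> > 0" using stable[OF \<omega>] stable_system.\<gamma> by blast
      then have "K * exp (- \<gamma> * \<tau>) * (M + r) \<le> K * exp (- \<gamma> * t) * (M + r)"
        using \<tau>(1) M0 K_ge_1 by (intro mult_right_mono mult_left_mono) auto
      then show "\<phi> \<rho> \<tau> (translate (- \<tau>) \<omega>) z \<in> Z"
        unfolding Z_def z using infdist_le2[OF y] by auto
    qed
    ultimately have "closure (\<Union>\<tau>\<in>{t..}. \<phi> \<rho> \<tau> (translate (- \<tau>) \<omega>) ` (B \<times> sphere 0 1)) \<subseteq> Z"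
      by (rule closure_minimal[rotated])
    then show "infdist q (Nor \<omega>) \<le> K * exp (- \<gamma> * t) * (M + r)" using q t unfolding Z_def by blast
  qed
qed

section \<open>The global attractor over a compact hull\<close>

definition "tube M = \<Omega> \<times> (cball (0::real^'n) M \<times> sphere (0::real^'n) 1)"
definition "Glob = (\<Union>\<omega>\<in>\<Omega>. {\<omega>} \<times> Nor \<omega>)"

lemma skew_Glob: "skew_product \<rho> t ` Glob = Glob"
proof (intro equalityI subsetI)
  fix z assume "z \<in> skew_product \<rho> t ` Glob"
  then obtain \<omega> q where "\<omega> \<in> \<Omega>" "q \<in> Nor \<omega>" "z = (translate t \<omega>, \<phi> \<rho> t \<omega> q)"
    by (auto simp: Glob_def skew_product_def)
  then show "z \<in> Glob" using phi_Nor_subset translate by (auto simp: Glob_def)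
next
  fix z assume "z \<in> Glob"
  then obtain \<omega> q where z: "\<omega> \<in> \<Omega>" "q \<in> Nor \<omega>" "z = (\<omega>, q)" by (auto simp: Glob_def)
  have "q \<in> \<phi> \<rho> t (translate (- t) \<omega>) ` Nor (translate (- t) \<omega>)"
    using phi_Nor[OF translate[OF z(1)], of t "- t"] z(2) by simp
  then obtain p where p: "p \<in> Nor (translate (- t) \<omega>)" "q = \<phi> \<rho> t (translate (- t) \<omega>) p" by blast
  have "z = skew_product \<rho> t (translate (- t) \<omega>, p)" using z p by (simp add: skew_product_def)
  moreover have "(translate (- t) \<omega>, p) \<in> Glob" using p translate[OF z(1)] by (auto simp: Glob_def)
  ultimately show "z \<in> skew_product \<rho> t ` Glob" by blast
qed

lemma Glob_subset_tube: "r \<le> M \<Longrightarrow> Glob \<subseteq> tube M"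
  using Nor_subset unfolding Glob_def tube_def by fastforce

text \<open>Each point of the image of a tube at time \<open>t\<close> is close to the normal bundle
  over its own base point, with a distance decaying in \<open>t\<close>; a point common to all
  images lies in that bundle.\<close>

lemma mem_Glob:
  assumes "\<And>t. t \<ge> 0 \<Longrightarrow> z \<in> skew_product \<rho> t ` tube M"
  shows "z \<in> Glob"
proof -
  obtain \<omega> q where z: "z = (\<omega>, q)" by (cases z)
  have "\<omega> \<in> \<Omega>" using assms[of 0] z by (auto simp: tube_def skew_product_def)
  moreover have "q \<in> Nor \<omega>"
  proof (rule mem_Nor[OF \<open>\<omega> \<in> \<Omega>\<close>, of _ "M + r"])
    fix t :: real assume t: "t \<ge> 0"
    obtain \<omega>' p where p: "\<omega>' \<in> \<Omega>" "p \<in> cball 0 M \<times> sphere 0 1" "\<omega> = translate t \<omega>'" "q = \<phi> \<rho> t \<omega>' p"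
      using assms[OF t] z by (auto simp: tube_def skew_product_def)
    from phi_near_Nor[OF p(1,2) t]
    obtain y where "y \<in> Nor \<omega>" "dist q y \<le> K * exp (- \<gamma> * t) * (M + r)" using p by auto
    then show "infdist q (Nor \<omega>) \<le> K * exp (- \<gamma> * t) * (M + r)" by (rule infdist_le2)
  qed
  ultimately show ?thesis using z by (auto simp: Glob_def)
qed

lemma topspace_state_space: "topspace (state_space \<delta> \<Omega>) = \<Omega> \<times> (UNIV \<times> sphere 0 1)"
proof -
  interpret M: Metric_space UNIV \<delta> by (rule metric)
  show ?thesis by (simp add: state_space_def)
qed

lemma Hausdorff_state_space: "Hausdorff_space (state_space \<delta> \<Omega>)"
proof -
  interpret M: Metric_space UNIV \<delta> by (rule metric)
  have "Hausdorff_space (subtopology M.mtopology \<Omega>)"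
    by (rule Hausdorff_space_subtopology[OF M.Hausdorff_space_mtopology])
  moreover have "Hausdorff_space (top_of_set ((UNIV::(real^'n) set) \<times> sphere (0::real^'n) 1))"
    by (rule Hausdorff_space_subtopology[OF Hausdorff_space_euclidean])
  ultimately show ?thesis
    by (simp add: state_space_def Hausdorff_space_prod_topology)
qed

lemma compactin_skew_tube:
  assumes "compactin (Metric_space.mtopology UNIV \<delta>) \<Omega>" "t \<ge> 0"
  shows "compactin (state_space \<delta> \<Omega>) (skew_product \<rho> t ` tube M)"
proof (rule image_compactin[OF _ continuous_skew_product_at[OF cont assms(2)]])
  have "compact (cball (0::real^'n) M \<times> sphere (0::real^'n) 1)"
    by (intro compact_Times compact_cball compact_sphere)
  then show "compactin (state_space \<delta> \<Omega>) (tube M)"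
    using assms(1) by (auto simp: state_space_def tube_def compactin_Times compactin_subtopology)
qed

lemma closedin_skew_tube:
  assumes "compactin (Metric_space.mtopology UNIV \<delta>) \<Omega>" "t \<ge> 0"
  shows "closedin (state_space \<delta> \<Omega>) (skew_product \<rho> t ` tube M)"
  by (rule compactin_imp_closedin[OF Hausdorff_state_space compactin_skew_tube[OF assms]])

lemma skew_product_add:
  assumes "z \<in> \<Omega> \<times> (UNIV \<times> sphere 0 1)"
  shows "skew_product \<rho> (s + t) z = skew_product \<rho> s (skew_product \<rho> t z)"
  using assms phi_add by (auto simp: skew_product_def)

text \<open>For \<open>K > 1\<close> a tube need not be forward invariant, but its orbits remain in
  the tube of radius \<open>K * M + r\<close>. Hence all later images lie in the single image at
  time \<open>t\<close> of a larger tube, which is closed when the hull is compact.\<close>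

lemma skew_tube_subset:
  assumes "0 \<le> t" "t \<le> \<tau>"
  shows "skew_product \<rho> \<tau> ` tube M \<subseteq> skew_product \<rho> t ` tube (K * M + r)"
proof
  fix z assume "z \<in> skew_product \<rho> \<tau> ` tube M"
  then obtain w where w: "w \<in> tube M" "z = skew_product \<rho> \<tau> w" by blast
  have "w \<in> \<Omega> \<times> (UNIV \<times> sphere 0 1)" using w(1) by (auto simp: tube_def)
  then have "z = skew_product \<rho> t (skew_product \<rho> (\<tau> - t) w)"
    using skew_product_add[of w t "\<tau> - t"] w(2) by simp
  moreover have "skew_product \<rho> (\<tau> - t) w \<in> tube (K * M + r)"
    using w(1) phi_bound[of _ _ M "\<tau> - t"] translate assms(2)
    unfolding tube_def skew_product_def by fastforce
  ultimately show "z \<in> skew_product \<rho> t ` tube (K * M + r)" by blast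
qed

lemma Glob_eq_limit_set:
  assumes \<Omega>: "compactin (Metric_space.mtopology UNIV \<delta>) \<Omega>"
    and B: "bounded B" "\<And>\<omega> t. \<omega> \<in> \<Omega> \<Longrightarrow> Att \<omega> t \<subseteq> B"
  shows "Glob = (\<Inter>t\<in>{0..}. state_space \<delta> \<Omega> closure_of
      (\<Union>\<tau>\<in>{t..}. skew_product \<rho> \<tau> ` (\<Omega> \<times> (B \<times> sphere 0 1))))"
proof (intro equalityI subsetI)
  fix z assume z: "z \<in> Glob"
  have "z \<in> state_space \<delta> \<Omega> closure_of (\<Union>\<tau>\<in>{t..}. skew_product \<rho> \<tau> ` (\<Omega> \<times> (B \<times> sphere 0 1)))" for t
  proof -
    have "Glob \<subseteq> \<Omega> \<times> (B \<times> sphere 0 1)"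
      using Nor_subset_Att B(2) unfolding Glob_def by blast
    then have "z \<in> skew_product \<rho> t ` (\<Omega> \<times> (B \<times> sphere 0 1))"
      using z skew_Glob[of t] by blast
    then have "z \<in> (\<Union>\<tau>\<in>{t..}. skew_product \<rho> \<tau> ` (\<Omega> \<times> (B \<times> sphere 0 1)))" by auto
    moreover have "(\<Union>\<tau>\<in>{t..}. skew_product \<rho> \<tau> ` (\<Omega> \<times> (B \<times> sphere 0 1))) \<subseteq> topspace (state_space \<delta> \<Omega>)"
      unfolding topspace_state_space
    proof (intro UN_least image_subsetI)
      fix \<tau> w assume "w \<in> \<Omega> \<times> (B \<times> sphere (0::real^'n) 1)"
      then obtain \<omega> p where w: "w = (\<omega>, p)" "\<omega> \<in> \<Omega>" "p \<in> UNIV \<times> sphere 0 1" by auto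
      show "skew_product \<rho> \<tau> w \<in> \<Omega> \<times> (UNIV \<times> sphere 0 1)"
        using translate[OF w(2)] phi_sphere[OF w(3)] by (simp add: w(1) skew_product_def)
    qed
    ultimately show ?thesis by (metis (no_types, lifting) closure_of_subset subsetD)
  qed
  then show "z \<in> (\<Inter>t\<in>{0..}. state_space \<delta> \<Omega> closure_of
      (\<Union>\<tau>\<in>{t..}. skew_product \<rho> \<tau> ` (\<Omega> \<times> (B \<times> sphere 0 1))))" by blast
next
  fix z assume z: "z \<in> (\<Inter>t\<in>{0..}. state_space \<delta> \<Omega> closure_of
      (\<Union>\<tau>\<in>{t..}. skew_product \<rho> \<tau> ` (\<Omega> \<times> (B \<times> sphere 0 1))))"
  obtain M where M: "\<And>b. b \<in> B \<Longrightarrow> norm b \<le> M" using B(1) unfolding bounded_iff by blast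
  show "z \<in> Glob"
  proof (rule mem_Glob[of _ "K * M + r"])
    fix t :: real assume t: "t \<ge> 0"
    have "\<Omega> \<times> (B \<times> sphere 0 1) \<subseteq> tube M" using M by (auto simp: tube_def)
    then have "(\<Union>\<tau>\<in>{t..}. skew_product \<rho> \<tau> ` (\<Omega> \<times> (B \<times> sphere 0 1))) \<subseteq> skew_product \<rho> t ` tube (K * M + r)"
      using skew_tube_subset[OF t] by (meson UN_least atLeast_iff image_mono order_trans)
    then have "state_space \<delta> \<Omega> closure_of (\<Union>\<tau>\<in>{t..}. skew_product \<rho> \<tau> ` (\<Omega> \<times> (B \<times> sphere 0 1)))
        \<subseteq> skew_product \<rho> t ` tube (K * M + r)"
      by (rule closure_of_minimal[OF _ closedin_skew_tube[OF \<Omega> t]])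
    then show "z \<in> skew_product \<rho> t ` tube (K * M + r)" using z t by blast
  qed
qed

lemma compactin_subset_tube:
  assumes "compactin (state_space \<delta> \<Omega>) D"
  obtains M where "D \<subseteq> tube M"
proof -
  have D: "D \<subseteq> \<Omega> \<times> (UNIV \<times> sphere 0 1)"
    using compactin_subset_topspace[OF assms] by (simp add: topspace_state_space)
  have "compactin (top_of_set (UNIV \<times> sphere 0 1)) (snd ` D)"
    by (rule image_compactin[OF assms]) (simp add: state_space_def continuous_map_snd)
  then have "bounded (snd ` D)" by (simp add: compactin_subtopology compact_imp_bounded)
  moreover have "snd ` D \<subseteq> UNIV \<times> sphere 0 1" using D by auto
  ultimately obtain M where "snd ` D \<subseteq> cball 0 M \<times> sphere 0 1" by (rule bounded_obtain)
  then have "D \<subseteq> tube M" using D unfolding tube_def by force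
  then show thesis by (rule that)
qed

lemma global_attractor_Glob:
  assumes \<Omega>: "compactin (Metric_space.mtopology UNIV \<delta>) \<Omega>"
  shows "global_attractor \<rho> \<delta> \<Omega> Glob"
  unfolding global_attractor_def Let_def
proof (intro conjI allI impI)
  interpret M: Metric_space UNIV \<delta> by (rule metric)
  show "Glob \<noteq> {}" using nonempty Nor_nonempty by (fastforce simp: Glob_def)
  have sub: "Glob \<subseteq> skew_product \<rho> t ` tube r" for t
    using image_mono[OF Glob_subset_tube[OF order_refl]] skew_Glob[of t] by metis
  \<comment> \<open>Writing \<open>Glob\<close> as an intersection of closed images gives its
    closedness without a continuity statement for \<open>Nor\<close>.\<close>
  have eq: "Glob = (\<Inter>t\<in>{0..}. skew_product \<rho> t ` tube r)"
  proof (intro equalityI INT_greatest sub subsetI)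
    fix z assume "z \<in> (\<Inter>t\<in>{0..}. skew_product \<rho> t ` tube r)"
    then show "z \<in> Glob" by (intro mem_Glob[of z r]) simp
  qed
  have "closedin (state_space \<delta> \<Omega>) Glob"
    unfolding eq by (intro closedin_INT closedin_skew_tube[OF \<Omega>]) auto
  then show "compactin (state_space \<delta> \<Omega>) Glob"
    by (rule closed_compactin[OF compactin_skew_tube[OF \<Omega> order_refl] sub])
  show "skew_product \<rho> t ` Glob = Glob" for t by (rule skew_Glob)
  show "C \<subseteq> Glob" if C: "C \<noteq> {} \<and> compactin (state_space \<delta> \<Omega>) C \<and> (\<forall>t\<ge>0. skew_product \<rho> t ` C = C)" for C
  proof
    fix z assume "z \<in> C"
    obtain M where M: "C \<subseteq> tube M" by (rule compactin_subset_tube[of C]) (use C in auto)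
    show "z \<in> Glob"
    proof (rule mem_Glob)
      fix t :: real assume "0 \<le> t"
      then have "z \<in> skew_product \<rho> t ` C" using C \<open>z \<in> C\<close> by simp
      then show "z \<in> skew_product \<rho> t ` tube M" using M by blast
    qed
  qed
  fix D assume "compactin (state_space \<delta> \<Omega>) D"
  then obtain M where M: "D \<subseteq> tube M" by (rule compactin_subset_tube)
  have "\<exists>y\<in>Glob. prod_dist \<delta> dist x y \<le> K * exp (- \<gamma> * t) * (M + r)"
    if t: "t \<ge> 0" and x: "x \<in> skew_product \<rho> t ` D" for t x
  proof -
    obtain \<omega> p where p: "\<omega> \<in> \<Omega>" "p \<in> cball 0 M \<times> sphere 0 1" "x = (translate t \<omega>, \<phi> \<rho> t \<omega> p)"
      using x M by (force simp: tube_def skew_product_def)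
    from phi_near_Nor[OF p(1,2) t]
    obtain y where y: "y \<in> Nor (translate t \<omega>)" "dist (\<phi> \<rho> t \<omega> p) y \<le> K * exp (- \<gamma> * t) * (M + r)" by blast
    \<comment> \<open>Both points lie over the same base point, so \<open>\<delta>\<close>
      contributes 0 to the product distance.\<close>
    have "(translate t \<omega>, y) \<in> Glob" using y(1) translate[OF p(1)] by (auto simp: Glob_def)
    moreover have "prod_dist \<delta> dist x (translate t \<omega>, y) = dist (\<phi> \<rho> t \<omega> p) y"
      using p(3) by (simp add: prod_dist_def)
    ultimately show ?thesis using y(2) by force
  qed
  then show "((\<lambda>t. semidist (prod_dist \<delta> dist) (skew_product \<rho> t ` D) Glob) \<longlongrightarrow> 0) at_top"
    by (intro semidist_tendsto_0[OF _ decay_at_top[of "M + r"]] eventually_mono[OF eventually_ge_at_top[of 0]])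
       blast
qed

end

theorem theorem4p12:
  fixes L :: "real \<Rightarrow> real ^ 'n::finite ^ 'n"
    and \<rho> :: real
    and \<delta> :: "'n mat_fun \<Rightarrow> 'n mat_fun \<Rightarrow> real"
    and \<Omega> :: "'n mat_fun set"
  assumes dim: "CARD('n) \<ge> 2"
    and \<rho>_pos: "\<rho> > 0"
    and L_int: "locally_integrable L"
    and metric: "Metric_space UNIV \<delta>"
    and \<Omega>_eq: "\<Omega> = translation_hull \<delta> L"
    and \<Omega>_invariant: "\<And>\<omega> \<tau>. \<omega> \<in> \<Omega> \<Longrightarrow> translate \<tau> \<omega> \<in> \<Omega>"
    and stable: "exponentially_stable L"
    and continuous: "continuous_skew_product \<rho> \<delta> \<Omega>"
  shows "(\<forall>\<omega>\<in>\<Omega>. \<exists>A. uniform_attractor \<rho> \<omega> A) \<and>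
    (\<forall>A. (\<forall>\<omega>\<in>\<Omega>. uniform_attractor \<rho> \<omega> (A \<omega>)) \<longrightarrow>
       (\<exists>B. bounded B \<and> (\<Union>\<omega>\<in>\<Omega>. \<Union>t. A \<omega> t) \<subseteq> B) \<and>
       unique_pullback_attractor \<rho> \<Omega> (\<lambda>\<omega>. normal_bundle (A \<omega> 0)) \<and>
       (\<forall>B. bounded B \<and> (\<Union>\<omega>\<in>\<Omega>. \<Union>t. A \<omega> t) \<subseteq> B \<longrightarrow>
          (\<forall>\<omega>\<in>\<Omega>. normal_bundle (A \<omega> 0) =
             (\<Inter>t\<in>{0..}. closure (\<Union>\<tau>\<in>{t..}. \<phi> \<rho> \<tau> (translate (- \<tau>) \<omega>) ` (B \<times> sphere 0 1)))) \<and>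
          (compactin (Metric_space.mtopology UNIV \<delta>) \<Omega> \<longrightarrow>
             (\<exists>\<AA>. global_attractor \<rho> \<delta> \<Omega> \<AA> \<and>
                \<AA> = (\<Inter>t\<in>{0..}. state_space \<delta> \<Omega> closure_of
                        (\<Union>\<tau>\<in>{t..}. skew_product \<rho> \<tau> ` (\<Omega> \<times> (B \<times> sphere 0 1)))) \<and>
                \<AA> = (\<Union>\<omega>\<in>\<Omega>. {\<omega>} \<times> normal_bundle (A \<omega> 0))))))"
proof -
  obtain K \<gamma> where K: "\<And>\<omega>. \<omega> \<in> \<Omega> \<Longrightarrow> stable_system (rep_mat_fun \<omega>) \<rho> K \<gamma>"
    by (rule hull_stable_system[OF \<rho>_pos L_int metric \<Omega>_eq \<Omega>_invariant stable continuous], assumption, rule that)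
  interpret M: Metric_space UNIV \<delta> by (rule metric)
  have ne: "\<Omega> \<noteq> {}"
    using closure_of_subset[of "range (\<lambda>\<tau>. translate \<tau> (abs_mat_fun L))" M.mtopology]
    unfolding \<Omega>_eq translation_hull_def by auto
  interpret stable_hull \<rho> K \<gamma> \<delta> \<Omega>
    by (rule stable_hull.intro[OF metric ne _ continuous]) (rule \<Omega>_invariant K, assumption)+
  \<comment> \<open>Every admissible family of attractors is the canonical one, so the remaining
    claims concern \<open>Att\<close>, \<open>Nor\<close> and \<open>Glob\<close>.\<close>
  have A: "A \<omega> = Att \<omega>" "normal_bundle (A \<omega> 0) = Nor \<omega>"
    if "\<forall>\<omega>\<in>\<Omega>. uniform_attractor \<rho> \<omega> (A \<omega>)" "\<omega> \<in> \<Omega>" for A \<omega>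
  proof -
    show "A \<omega> = Att \<omega>" by (rule uniform_attractor_unique) (use that in auto)
    then show "normal_bundle (A \<omega> 0) = Nor \<omega>" using normal_bundle_Att[OF that(2)] by simp
  qed
  show ?thesis
  proof (intro conjI allI impI)
    show "\<forall>\<omega>\<in>\<Omega>. \<exists>A. uniform_attractor \<rho> \<omega> A" using uniform_attractor_Att by blast
  next
    fix A assume A': "\<forall>\<omega>\<in>\<Omega>. uniform_attractor \<rho> \<omega> (A \<omega>)"
    show "\<exists>B. bounded B \<and> (\<Union>\<omega>\<in>\<Omega>. \<Union>t. A \<omega> t) \<subseteq> B"
      using A(1)[OF A'] Att_subset by (intro exI[of _ "cball 0 r"]) fastforce
    show "unique_pullback_attractor \<rho> \<Omega> (\<lambda>\<omega>. normal_bundle (A \<omega> 0))"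
      using pullback_attractor_cong[of Nor "\<lambda>\<omega>. normal_bundle (A \<omega> 0)"] A(2)[OF A']
        unique_pullback_attractor_Nor by simp
    fix B assume B: "bounded B \<and> (\<Union>\<omega>\<in>\<Omega>. \<Union>t. A \<omega> t) \<subseteq> B"
    have bB: "bounded B" using B by blast
    have AB: "Att \<omega> t \<subseteq> B" if "\<omega> \<in> \<Omega>" for \<omega> t
      using B that unfolding A(1)[OF A' that, symmetric] by blast
    show "\<forall>\<omega>\<in>\<Omega>. normal_bundle (A \<omega> 0) =
        (\<Inter>t\<in>{0..}. closure (\<Union>\<tau>\<in>{t..}. \<phi> \<rho> \<tau> (translate (- \<tau>) \<omega>) ` (B \<times> sphere 0 1)))"
      using A(2)[OF A'] Nor_eq_limit_set[OF bB AB] by simp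
    assume c: "compactin (Metric_space.mtopology UNIV \<delta>) \<Omega>"
    have "Glob = (\<Union>\<omega>\<in>\<Omega>. {\<omega>} \<times> normal_bundle (A \<omega> 0))" using A(2)[OF A'] by (simp add: Glob_def)
    then show "\<exists>\<AA>. global_attractor \<rho> \<delta> \<Omega> \<AA> \<and>
        \<AA> = (\<Inter>t\<in>{0..}. state_space \<delta> \<Omega> closure_of
          (\<Union>\<tau>\<in>{t..}. skew_product \<rho> \<tau> ` (\<Omega> \<times> (B \<times> sphere 0 1)))) \<and>
        \<AA> = (\<Union>\<omega>\<in>\<Omega>. {\<omega>} \<times> normal_bundle (A \<omega> 0))"
      using global_attractor_Glob[OF c] Glob_eq_limit_set[OF c bB AB] by blast
  qed
qed

end
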